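(* Let $(\mathbb{K},\partial)$ be a differential field with field of constants $\Bbbk$ and $U=\mathbb{K}[Y;\partial]$. The isomorphism $\Phi:U^*\to\mathcal{H}(\mathbb{K})$, $f\mapsto(f(Y^n))_{n\ge0}$, induces an isomorphism of $(\mathbb{K}\otimes\mathbb{K})$-algebras $\phi:U^\circ\to\mathcal{D}lin_{\mathbb{K}}$ such that $\Phi\circ\zeta=\phi$ (as maps into $\mathcal{H}(\mathbb{K})$), where $\zeta:U^\circ\to U^*$ is the canonical morphism. It is explicitly given by $$\phi\big(\overline{\varphi\otimes_{T_M}m}\big)=\big(\varphi(\partial_M^n(m))\big)_{n\ge0},$$ with inverse $\phi^{-1}(\alpha)=\overline{\tilde f_\alpha\otimes_{T_{M_\alpha}}\overline{1}}$, for all $\overline{\varphi\otimes_{T_M}m}\in U^\circ$ and all $\alpha\in\mathcal{D}lin_{\mathbb{K}}$. It is also an isomorphism of differential $\mathbb{K}$-algebras.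
   Context: A differential field $(\mathbb{K},\partial)$ is a field with an additive map $\partial$ satisfying the Leibniz rule; $\Bbbk=\{c\in\mathbb{K}\mid\partial(c)=0\}$. Unadorned $\otimes$ is over $\Bbbk$. $\mathcal{H}(\mathbb{K})=\mathbb{K}^{\mathbb{N}}$ with Hurwitz product $(\alpha\beta)(n)=\sum_{k=0}^n\binom nk\alpha(k)\beta(n-k)$; $\mathcal{N}(\alpha)(n)=\alpha(n+1)$. It is a $(\mathbb{K}\otimes\mathbb{K})$-algebra via $x\otimes y\mapsto s(x)t(y)$, where $s(x)=(x,0,0,\ldots)$ and $t(x)=(\partial^n(x))_{n\ge0}$. $\mathcal{D}lin_{\mathbb{K}}$ is the set of $\alpha\in\mathcal{H}(\mathbb{K})$ for which there are $d\ge0$, $c_0,\ldots,c_d\in\mathbb{K}$, $c_d\ne0$, with $\sum_{i=0}^dt(c_i)\mathcal{N}^i(\alpha)=0$. It is a differential $\mathbb{K}$-algebra via $s$ with derivation $\mathcal{N}$. $U=\mathbb{K}[Y;\partial]$ is the $\Bbbk$-algebra generated by $\mathbb{K}$ and $Y$ with $xY=Yx+\partial(x)$; right $\mathbb{K}$-basis $\{Y^i\}_{i\ge0}$. $(-)^*$ denotes right $\mathbb{K}$-linear maps to $\mathbb{K}$. $U^*$ is a commutative ring under the convolution $(f*g)(Y^n)=\sum_{k=0}^n\binom nkf(Y^k)g(Y^{n-k})$ and a $(\mathbb{K}\otimes\mathbb{K})$-algebra via $x\otimes y\mapsto(x\varepsilon_U)*\mu(y)$, $\varepsilon_U(Y^n)=\delta_{0,n}$,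 $\mu(y)(Y^n)=\partial^n(y)$. $U^\circ$: a finite-dimensional differential $\mathbb{K}$-vector space is a finite-dimensional right $\mathbb{K}$-space $M$ with a $\Bbbk$-linear $\partial_M$ such that $\partial_M(mx)=\partial_M(m)x+m\partial(x)$ (equivalently a right $U$-module, $m\triangleleft Y=\partial_M(m)$). $T_{MN}$ is the space of $\mathbb{K}$-linear maps $M\to N$ commuting with the differentials, $T_M=T_{MM}$; $M\otimes_{\mathbb{K}}N$ has differential $\partial_M\otimes N+M\otimes\partial_N$. $U^\circ$ is the quotient of $\bigoplus_{(M,\partial_M)}M^*\otimes_{T_M}M$ by the span of all $\psi\otimes_{T_N}fx-\psi f\otimes_{T_M}x$ ($\psi\in N^*,x\in M,f\in T_{MN}$); $\overline{\varphi\otimes_{T_M}m}$ is the class of $\varphi\otimes m$. Product: $\overline{\varphi\otimes p}\cdot\overline{\psi\otimes q}=\overline{(\psi\diamond\varphi)\otimes(q\otimes_{\mathbb{K}}p)}$ with $(\psi\diamond\varphi)(q\otimes p)=\varphi(\psi(q)p)$. It is a $(\mathbb{K}\otimes\mathbb{K})$-algebra via source $s_\circ(k)=\overline{k\otimes1}$ and target $t_\circ(k)=\overline{1\otimes k}$ (component $M=\mathbb{K}$), and a differential $\mathbb{K}$-algebra via $s_\circ$ with derivation $\partial_\circ(\overline{\varphi\otimes m})=\overline{\varphi\otimes\partial_M(m)}$. The canonical morphism $\zeta:U^\circ\to U^*$ is the $(\mathbb{K}\otimes\mathbb{K})$-algebra map $\zeta(\overline{\varphi\otimes m})(u)=\varphi(m\triangleleft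 u)$ (known to be injective). For $\alpha\in\mathcal{D}lin_{\mathbb{K}}$, $f_\alpha=\Phi^{-1}(\alpha)\in U^*$ is the map with $f_\alpha(Y^n)=\alpha(n)$; $P_\alpha(Y)=\sum_iY^ic_i$ is the monic generator of $\{\sum_i Y^iq_i\in U\mid\sum_it(q_i)\mathcal{N}^i(\alpha)=0\}$; $M_\alpha=U/P_\alpha(Y)U$ is a finite-dimensional differential $\mathbb{K}$-vector space with differential right multiplication by $Y$; $\overline{1}=1+P_\alpha(Y)U$; and $\tilde f_\alpha\in M_\alpha^*$ is induced by $f_\alpha$, which vanishes on $P_\alpha(Y)U$. *)

theory Defs
  imports
    "HOL-Algebra.Algebraic_Closure_Type"
    "HOL-Algebra.Free_Abelian_Groups"
    "HOL-Algebra.Module"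
    "HOL-Computational_Algebra.Polynomial"
begin

section \<open>Differential fields and differential vector spaces\<close>

text \<open>The field \<open>\<bbbK>\<close> is the type \<^typ>\<open>'k\<close>; as a ring in the sense of HOL-Algebra it is
  \<^const>\<open>ring_of_type_algebra\<close>.\<close>

definition differential_field :: "('k::field \<Rightarrow> 'k) \<Rightarrow> bool" where
  "differential_field \<delta> \<longleftrightarrow>
     (\<forall>x y. \<delta> (x + y) = \<delta> x + \<delta> y) \<and> (\<forall>x y. \<delta> (x * y) = \<delta> x * y + x * \<delta> y)"

lemma differential_fieldD:
  assumes "differential_field \<delta>"
  shows "\<delta> (x + y) = \<delta> x + \<delta> y" "\<delta> (x * y) = \<delta> x * y + x * \<delta> y" "\<delta> 0 = 0" "\<delta> 1 = 0"
proof -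
  show add: "\<delta> (x + y) = \<delta> x + \<delta> y" and mult: "\<delta> (x * y) = \<delta> x * y + x * \<delta> y" for x y
    using assms by (simp_all add: differential_field_def)
  have "\<delta> 0 + \<delta> 0 = \<delta> 0 + 0" "\<delta> 1 + \<delta> 1 = \<delta> 1 + 0"
    using add[of 0 0] mult[of 1 1] by (simp_all del: add_cancel_left_right add_cancel_right_right)
  then show "\<delta> 0 = 0" "\<delta> 1 = 0"
    by (simp_all only: add_left_cancel)
qed

definition constants :: "('k::field \<Rightarrow> 'k) \<Rightarrow> 'k set" where
  "constants \<delta> = {c. \<delta> c = 0}"

text \<open>As \<open>\<bbbK>\<close> is commutative, a right vector space is a module of HOL-Algebra:
  \<open>m x\<close> is written \<open>x \<odot>\<^bsub>M\<^esub> m\<close>. The fields \<open>mult\<close> and \<open>one\<close> that \<^typ>\<open>('k, 'm) module\<close> inherits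
  from rings play no role, and nothing is required of the operations outside the carrier.\<close>

record ('k, 'm) dspace = "('k, 'm) module" +
  der :: "'m \<Rightarrow> 'm"

definition finite_dimensional :: "('k::field, 'm) dspace \<Rightarrow> bool" where
  "finite_dimensional M \<longleftrightarrow>
     (\<exists>B. finite B \<and> B \<subseteq> carrier M \<and>
        (\<forall>v\<in>carrier M. \<exists>c. v = (\<Oplus>\<^bsub>M\<^esub>b\<in>B. c b \<odot>\<^bsub>M\<^esub> b)))"

definition diff_space :: "('k::field \<Rightarrow> 'k) \<Rightarrow> ('k, 'm) dspace \<Rightarrow> bool" where
  "diff_space \<delta> M \<longleftrightarrow>
     Module.module (ring_of_type_algebra :: 'k ring) M \<and> finite_dimensional M \<and>
     der M \<in> carrier M \<rightarrow> carrier M \<and>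
     (\<forall>m\<in>carrier M. \<forall>m'\<in>carrier M. der M (m \<oplus>\<^bsub>M\<^esub> m') = der M m \<oplus>\<^bsub>M\<^esub> der M m') \<and>
     (\<forall>c\<in>constants \<delta>. \<forall>m\<in>carrier M. der M (c \<odot>\<^bsub>M\<^esub> m) = c \<odot>\<^bsub>M\<^esub> der M m) \<and>
     (\<forall>x. \<forall>m\<in>carrier M. der M (x \<odot>\<^bsub>M\<^esub> m) = x \<odot>\<^bsub>M\<^esub> der M m \<oplus>\<^bsub>M\<^esub> \<delta> x \<odot>\<^bsub>M\<^esub> m)"

text \<open>\<open>T\<^sub>M\<^sub>N\<close>, also for spaces with carriers in different types\<close>

definition dspace_homs :: "('k::field, 'm) dspace \<Rightarrow> ('k, 'n) dspace \<Rightarrow> ('m \<Rightarrow> 'n) set" where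
  "dspace_homs M N =
     {f \<in> carrier M \<rightarrow> carrier N.
        (\<forall>m\<in>carrier M. \<forall>m'\<in>carrier M. f (m \<oplus>\<^bsub>M\<^esub> m') = f m \<oplus>\<^bsub>N\<^esub> f m') \<and>
        (\<forall>x. \<forall>m\<in>carrier M. f (x \<odot>\<^bsub>M\<^esub> m) = x \<odot>\<^bsub>N\<^esub> f m) \<and>
        (\<forall>m\<in>carrier M. f (der M m) = der N (f m))}"

definition dspace_isos :: "('k::field, 'm) dspace \<Rightarrow> ('k, 'n) dspace \<Rightarrow> ('m \<Rightarrow> 'n) set" where
  "dspace_isos M N = {f \<in> dspace_homs M N. bij_betw f (carrier M) (carrier N)}"

text \<open>\<open>M\<^sup>*\<close>; functionals are \<^const>\<open>undefined\<close> outside the carrier, so that equality of functionals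
  is equality of functions.\<close>

definition dual :: "('k::field, 'm) dspace \<Rightarrow> ('m \<Rightarrow> 'k) set" where
  "dual M =
     {f \<in> extensional (carrier M).
        (\<forall>m\<in>carrier M. \<forall>m'\<in>carrier M. f (m \<oplus>\<^bsub>M\<^esub> m') = f m + f m') \<and>
        (\<forall>x. \<forall>m\<in>carrier M. f (x \<odot>\<^bsub>M\<^esub> m) = f m * x)}"

definition unit_dspace :: "('k::field \<Rightarrow> 'k) \<Rightarrow> ('k, 'k) dspace" where
  "unit_dspace \<delta> =
     \<lparr>carrier = UNIV, monoid.mult = (*), one = 1, ring.zero = 0, ring.add = (+),
      module.smult = (*), der = \<delta>\<rparr>"


section \<open>Abelian groups given by generators and relations, tensor products\<close>

type_synonym 'a frag = "'a \<Rightarrow>\<^sub>0 int"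

definition pres_rel :: "'a set \<Rightarrow> 'a frag set \<Rightarrow> 'a frag set" where
  "pres_rel A R = generate (free_Abelian_group A) R"

definition pres :: "'a set \<Rightarrow> 'a frag set \<Rightarrow> 'a frag set monoid" where
  "pres A R = free_Abelian_group A Mod pres_rel A R"

definition pres_class :: "'a set \<Rightarrow> 'a frag set \<Rightarrow> 'a frag \<Rightarrow> 'a frag set" where
  "pres_class A R x = pres_rel A R #>\<^bsub>free_Abelian_group A\<^esub> x"

text \<open>Maps out of a quotient, induced by maps on representatives\<close>

definition induced :: "('x \<Rightarrow> 'y) \<Rightarrow> 'x set \<Rightarrow> 'y" where
  "induced h Z = the_elem (h ` Z)"

definition induced2 :: "('x \<Rightarrow> 'x \<Rightarrow> 'y) \<Rightarrow> 'x set \<Rightarrow> 'x set \<Rightarrow> 'y" where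
  "induced2 h Z W = the_elem (case_prod h ` (Z \<times> W))"

text \<open>Additive and biadditive extension of maps defined on generators\<close>

definition frag_sum :: "('a \<Rightarrow> 'k::field) \<Rightarrow> 'a frag \<Rightarrow> 'k" where
  "frag_sum g x = (\<Sum>a\<in>Poly_Mapping.keys x. of_int (Poly_Mapping.lookup x a) * g a)"

definition ring_frag_sum :: "'r ring \<Rightarrow> ('a \<Rightarrow> 'r) \<Rightarrow> 'a frag \<Rightarrow> 'r" where
  "ring_frag_sum R g x =
     (\<Oplus>\<^bsub>R\<^esub>a\<in>Poly_Mapping.keys x. [Poly_Mapping.lookup x a] \<cdot>\<^bsub>R\<^esub> g a)"

definition frag_extend2 :: "('a \<Rightarrow> 'b \<Rightarrow> 'c frag) \<Rightarrow> 'a frag \<Rightarrow> 'b frag \<Rightarrow> 'c frag" where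
  "frag_extend2 g x y = frag_extend (\<lambda>a. frag_extend (g a) y) x"

text \<open>The relations defining \<open>A \<otimes>\<^sub>S B\<close>, for the right action \<open>rA\<close> of \<open>S\<close> on \<open>A\<close> and the left
  action \<open>lB\<close> of \<open>S\<close> on \<open>B\<close>\<close>

definition tensor_rels ::
  "'a set \<Rightarrow> ('a \<Rightarrow> 'a \<Rightarrow> 'a) \<Rightarrow> ('a \<Rightarrow> 's \<Rightarrow> 'a) \<Rightarrow> 's set \<Rightarrow>
   'b set \<Rightarrow> ('b \<Rightarrow> 'b \<Rightarrow> 'b) \<Rightarrow> ('s \<Rightarrow> 'b \<Rightarrow> 'b) \<Rightarrow> ('a \<times> 'b) frag set" where
  "tensor_rels A addA rA S B addB lB =
     {frag_of (addA a a', b) - frag_of (a, b) - frag_of (a', b) | a a' b. a \<in> A \<and> a' \<in> A \<and> b \<in> B} \<union>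
     {frag_of (a, addB b b') - frag_of (a, b) - frag_of (a, b') | a b b'. a \<in> A \<and> b \<in> B \<and> b' \<in> B} \<union>
     {frag_of (rA a s, b) - frag_of (a, lB s b) | a s b. a \<in> A \<and> s \<in> S \<and> b \<in> B}"

text \<open>\<open>N \<otimes>\<^sub>\<bbbK> M\<close> with the differential \<open>\<partial>\<^sub>N \<otimes> M + N \<otimes> \<partial>\<^sub>M\<close>. Neither \<open>\<partial>\<^sub>N \<otimes> M\<close> nor \<open>N \<otimes> \<partial>\<^sub>M\<close>
  is well defined by itself, only their sum is.\<close>

definition tensor_dspace_rels ::
  "('k::field, 'n) dspace \<Rightarrow> ('k, 'm) dspace \<Rightarrow> ('n \<times> 'm) frag set" where
  "tensor_dspace_rels N M =
     tensor_rels (carrier N) (ring.add N) (\<lambda>q x. x \<odot>\<^bsub>N\<^esub> q) UNIV (carrier M) (ring.add M) (module.smult M)"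

definition tensor_elt ::
  "('k::field, 'n) dspace \<Rightarrow> ('k, 'm) dspace \<Rightarrow> 'n \<Rightarrow> 'm \<Rightarrow> ('n \<times> 'm) frag set" where
  "tensor_elt N M q p =
     pres_class (carrier N \<times> carrier M) (tensor_dspace_rels N M) (frag_of (q, p))"

definition tensor_dspace ::
  "('k::field, 'n) dspace \<Rightarrow> ('k, 'm) dspace \<Rightarrow> ('k, ('n \<times> 'm) frag set) dspace" where
  "tensor_dspace N M =
     (let A = carrier N \<times> carrier M; R = tensor_dspace_rels N M in
      \<lparr>carrier = carrier (pres A R), monoid.mult = undefined, one = undefined,
       ring.zero = monoid.one (pres A R), ring.add = monoid.mult (pres A R),
       module.smult = (\<lambda>x. induced (\<lambda>z. pres_class A R
         (frag_extend (\<lambda>(q, p). frag_of (x \<odot>\<^bsub>N\<^esub> q, p)) z))),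
       der = induced (\<lambda>z. pres_class A R
         (frag_extend (\<lambda>(q, p). frag_of (der N q, p) + frag_of (q, der M p)) z))\<rparr>)"

text \<open>\<open>(\<psi> \<diamondop> \<phi>)(q \<otimes> p) = \<phi>(\<psi>(q) p)\<close> on \<open>N \<otimes>\<^sub>\<bbbK> M\<close>\<close>

definition diamond ::
  "('k::field, 'n) dspace \<Rightarrow> ('k, 'm) dspace \<Rightarrow> ('n \<Rightarrow> 'k) \<Rightarrow> ('m \<Rightarrow> 'k) \<Rightarrow>
   ('n \<times> 'm) frag set \<Rightarrow> 'k" where
  "diamond N M \<psi> \<phi> =
     restrict (induced (frag_sum (\<lambda>(q, p). \<phi> (\<psi> q \<odot>\<^bsub>M\<^esub> p)))) (carrier (tensor_dspace N M))"


section \<open>Algebras over \<open>\<bbbK> \<otimes> \<bbbK>\<close> and differential algebras over \<open>\<bbbK>\<close>\<close>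

definition kk_rels :: "('k::field \<Rightarrow> 'k) \<Rightarrow> ('k \<times> 'k) frag set" where
  "kk_rels \<delta> = tensor_rels UNIV (+) (*) (constants \<delta>) UNIV (+) (*)"

definition kk_ring :: "('k::field \<Rightarrow> 'k) \<Rightarrow> ('k \<times> 'k) frag set ring" where
  "kk_ring \<delta> =
     \<lparr>carrier = carrier (pres UNIV (kk_rels \<delta>)),
      monoid.mult = induced2 (\<lambda>z w. pres_class UNIV (kk_rels \<delta>)
        (frag_extend2 (\<lambda>(x, y) (x', y'). frag_of (x * x', y * y')) z w)),
      one = pres_class UNIV (kk_rels \<delta>) (frag_of (1, 1)),
      ring.zero = monoid.one (pres UNIV (kk_rels \<delta>)),
      ring.add = monoid.mult (pres UNIV (kk_rels \<delta>))\<rparr>"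

definition kk_algebra ::
  "('k::field \<Rightarrow> 'k) \<Rightarrow> 'r ring \<Rightarrow> (('k \<times> 'k) frag set \<Rightarrow> 'r) \<Rightarrow> bool" where
  "kk_algebra \<delta> R \<eta> \<longleftrightarrow> cring R \<and> \<eta> \<in> ring_hom (kk_ring \<delta>) R"

definition kk_algebra_hom where
  "kk_algebra_hom \<delta> R \<eta> R' \<eta>' f \<longleftrightarrow>
     kk_algebra \<delta> R \<eta> \<and> kk_algebra \<delta> R' \<eta>' \<and> f \<in> ring_hom R R' \<and>
     (\<forall>z\<in>carrier (kk_ring \<delta>). f (\<eta> z) = \<eta>' z)"

definition kk_algebra_iso where
  "kk_algebra_iso \<delta> R \<eta> R' \<eta>' f \<longleftrightarrow>
     kk_algebra_hom \<delta> R \<eta> R' \<eta>' f \<and> bij_betw f (carrier R) (carrier R')"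

text \<open>The structure map \<open>x \<otimes> y \<mapsto> s(x) t(y)\<close>\<close>

definition source_target :: "'r ring \<Rightarrow> ('k::field \<Rightarrow> 'r) \<Rightarrow> ('k \<Rightarrow> 'r) \<Rightarrow> ('k \<times> 'k) frag set \<Rightarrow> 'r"
  where "source_target R s t = induced (ring_frag_sum R (\<lambda>(x, y). s x \<otimes>\<^bsub>R\<^esub> t y))"

text \<open>The derivation of a differential \<open>\<bbbK>\<close>-algebra is \<open>\<bbbK>\<close>-linear; it does not extend the
  derivation of \<open>\<bbbK>\<close>: in \<open>\<H>(\<bbbK>)\<close>, \<open>\<N>(s(x)) = 0\<close>.\<close>

definition differential_algebra ::
  "'r ring \<Rightarrow> ('k::field \<Rightarrow> 'r) \<Rightarrow> ('r \<Rightarrow> 'r) \<Rightarrow> bool" where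
  "differential_algebra R s d \<longleftrightarrow>
     cring R \<and> s \<in> ring_hom ring_of_type_algebra R \<and> d \<in> carrier R \<rightarrow> carrier R \<and>
     (\<forall>a\<in>carrier R. \<forall>b\<in>carrier R. d (a \<oplus>\<^bsub>R\<^esub> b) = d a \<oplus>\<^bsub>R\<^esub> d b) \<and>
     (\<forall>a\<in>carrier R. \<forall>b\<in>carrier R. d (a \<otimes>\<^bsub>R\<^esub> b) = d a \<otimes>\<^bsub>R\<^esub> b \<oplus>\<^bsub>R\<^esub> a \<otimes>\<^bsub>R\<^esub> d b) \<and>
     (\<forall>x. \<forall>a\<in>carrier R. d (s x \<otimes>\<^bsub>R\<^esub> a) = s x \<otimes>\<^bsub>R\<^esub> d a)"

definition differential_algebra_iso where
  "differential_algebra_iso R s d R' s' d' f \<longleftrightarrow>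
     differential_algebra R s d \<and> differential_algebra R' s' d' \<and> f \<in> ring_iso R R' \<and>
     (\<forall>x. f (s x) = s' x) \<and> (\<forall>a\<in>carrier R. f (d a) = d' (f a))"


section \<open>Hurwitz series and differentially recursive sequences\<close>

definition hurwitz :: "(nat \<Rightarrow> 'k::field) ring" where
  "hurwitz =
     \<lparr>carrier = UNIV,
      monoid.mult = (\<lambda>\<alpha> \<beta> n. \<Sum>k\<le>n. of_nat (n choose k) * \<alpha> k * \<beta> (n - k)),
      one = (\<lambda>n. if n = 0 then 1 else 0),
      ring.zero = (\<lambda>n. 0),
      ring.add = (\<lambda>\<alpha> \<beta> n. \<alpha> n + \<beta> n)\<rparr>"

definition s_hur :: "'k::field \<Rightarrow> nat \<Rightarrow> 'k" where
  "s_hur x = (\<lambda>n. if n = 0 then x else 0)"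

definition t_hur :: "('k::field \<Rightarrow> 'k) \<Rightarrow> 'k \<Rightarrow> nat \<Rightarrow> 'k" where
  "t_hur \<delta> x = (\<lambda>n. (\<delta> ^^ n) x)"

definition shift :: "(nat \<Rightarrow> 'k) \<Rightarrow> nat \<Rightarrow> 'k" where
  "shift \<alpha> = (\<lambda>n. \<alpha> (Suc n))"

definition Dlin :: "('k::field \<Rightarrow> 'k) \<Rightarrow> (nat \<Rightarrow> 'k) set" where
  "Dlin \<delta> =
     {\<alpha>. \<exists>d c. c d \<noteq> 0 \<and>
        (\<forall>n. (\<Sum>i\<le>d. (t_hur \<delta> (c i) \<otimes>\<^bsub>hurwitz\<^esub> (shift ^^ i) \<alpha>) n) = 0)}"

definition dlin_ring :: "('k::field \<Rightarrow> 'k) \<Rightarrow> (nat \<Rightarrow> 'k) ring" where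
  "dlin_ring \<delta> = hurwitz\<lparr>carrier := Dlin \<delta>\<rparr>"


section \<open>The ring \<open>U = \<bbbK>[Y; \<partial>]\<close> and its dual \<open>U\<^sup>*\<close>\<close>

text \<open>The polynomial with coefficients \<open>c\<^sub>i\<close> represents \<open>\<Sum>\<^sub>i Y\<^sup>i c\<^sub>i\<close>, with scalars on the right. From
  \<open>x Y = Y x + \<partial>(x)\<close> one gets \<open>(\<Sum>\<^sub>i Y\<^sup>i c\<^sub>i) Y = \<Sum>\<^sub>i Y\<^sup>i\<^sup>+\<^sup>1 c\<^sub>i + \<Sum>\<^sub>i Y\<^sup>i \<partial>(c\<^sub>i)\<close>.\<close>

definition times_Y :: "('k::field \<Rightarrow> 'k) \<Rightarrow> 'k poly \<Rightarrow> 'k poly" where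
  "times_Y \<delta> p = pCons 0 p + map_poly \<delta> p"

definition ore :: "('k::field \<Rightarrow> 'k) \<Rightarrow> 'k poly ring" where
  "ore \<delta> =
     \<lparr>carrier = UNIV,
      monoid.mult = (\<lambda>p q. \<Sum>j\<le>Polynomial.degree q.
        Polynomial.smult (Polynomial.coeff q j) ((times_Y \<delta> ^^ j) p)),
      one = 1, ring.zero = 0, ring.add = (+)\<rparr>"

abbreviation Ypow :: "nat \<Rightarrow> 'k::field poly" where
  "Ypow n \<equiv> Polynomial.monom 1 n"

abbreviation scal :: "'k::field \<Rightarrow> 'k poly" where
  "scal x \<equiv> [:x:]"

lemma times_Y_add:
  assumes "differential_field \<delta>"
  shows "times_Y \<delta> (p + q) = times_Y \<delta> p + times_Y \<delta> q"
  by (intro poly_eqI)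
    (simp add: times_Y_def coeff_map_poly coeff_pCons differential_fieldD[OF assms] split: nat.split)

lemma times_Y_smult:
  assumes "differential_field \<delta>"
  shows "times_Y \<delta> (Polynomial.smult x p) =
    Polynomial.smult x (times_Y \<delta> p) + Polynomial.smult (\<delta> x) p"
  by (intro poly_eqI)
    (simp add: times_Y_def coeff_map_poly coeff_pCons differential_fieldD[OF assms] algebra_simps
      split: nat.split)

lemma times_Y_pCons:
  assumes "differential_field \<delta>"
  shows "times_Y \<delta> (pCons a q) = pCons (\<delta> a) ([:a:] + times_Y \<delta> q)"
  by (intro poly_eqI)
    (simp add: times_Y_def coeff_map_poly coeff_pCons differential_fieldD[OF assms] split: nat.split)

lemma ore_simps [simp]:
  "carrier (ore \<delta>) = UNIV" "\<one>\<^bsub>ore \<delta>\<^esub> = 1" "\<zero>\<^bsub>ore \<delta>\<^esub> = 0" "p \<oplus>\<^bsub>ore \<delta>\<^esub> q = p + q"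
  by (simp_all add: ore_def)

lemma ore_mult_bound:
  assumes "Polynomial.degree q \<le> n"
  shows "p \<otimes>\<^bsub>ore \<delta>\<^esub> q =
    (\<Sum>j\<le>n. Polynomial.smult (Polynomial.coeff q j) ((times_Y \<delta> ^^ j) p))"
proof -
  have "(\<Sum>j\<le>n. Polynomial.smult (Polynomial.coeff q j) ((times_Y \<delta> ^^ j) p)) =
    (\<Sum>j\<le>Polynomial.degree q. Polynomial.smult (Polynomial.coeff q j) ((times_Y \<delta> ^^ j) p))"
    using assms by (intro sum.mono_neutral_right) (auto simp: coeff_eq_0)
  then show ?thesis
    by (simp add: ore_def)
qed

lemma ore_mult_0 [simp]: "p \<otimes>\<^bsub>ore \<delta>\<^esub> 0 = 0"
  by (simp add: ore_def)

lemma ore_mult_pCons: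
  "p \<otimes>\<^bsub>ore \<delta>\<^esub> pCons a q = Polynomial.smult a p + times_Y \<delta> p \<otimes>\<^bsub>ore \<delta>\<^esub> q"
proof -
  have "p \<otimes>\<^bsub>ore \<delta>\<^esub> pCons a q = (\<Sum>j\<le>Suc (Polynomial.degree q).
      Polynomial.smult (Polynomial.coeff (pCons a q) j) ((times_Y \<delta> ^^ j) p))"
    by (rule ore_mult_bound) (rule degree_pCons_le)
  also have "\<dots> = Polynomial.smult a p + (\<Sum>j\<le>Polynomial.degree q.
      Polynomial.smult (Polynomial.coeff q j) ((times_Y \<delta> ^^ j) (times_Y \<delta> p)))"
    by (subst sum.atMost_Suc_shift) (simp add: funpow_swap1)
  finally show ?thesis
    by (simp add: ore_def)
qed

lemma ore_mult_add_right: "p \<otimes>\<^bsub>ore \<delta>\<^esub> (q + r) = p \<otimes>\<^bsub>ore \<delta>\<^esub> q + p \<otimes>\<^bsub>ore \<delta>\<^esub> r"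
proof -
  let ?n = "max (Polynomial.degree q) (Polynomial.degree r)"
  have "Polynomial.degree (q + r) \<le> ?n"
    by (rule degree_add_le) simp_all
  then show ?thesis
    by (simp add: ore_mult_bound[of _ ?n] smult_add_left sum.distrib)
qed

lemma ore_mult_add_left:
  assumes "differential_field \<delta>"
  shows "(p + q) \<otimes>\<^bsub>ore \<delta>\<^esub> r = p \<otimes>\<^bsub>ore \<delta>\<^esub> r + q \<otimes>\<^bsub>ore \<delta>\<^esub> r"
  by (induction r arbitrary: p q)
    (simp_all add: ore_mult_pCons smult_add_right times_Y_add[OF assms] algebra_simps)

lemma ore_mult_smult_right:
  "p \<otimes>\<^bsub>ore \<delta>\<^esub> Polynomial.smult x q = Polynomial.smult x (p \<otimes>\<^bsub>ore \<delta>\<^esub> q)"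
  by (induction q arbitrary: p) (simp_all add: ore_mult_pCons smult_add_right)

lemma ore_mult_times_Y:
  assumes "differential_field \<delta>"
  shows "p \<otimes>\<^bsub>ore \<delta>\<^esub> times_Y \<delta> q = times_Y \<delta> (p \<otimes>\<^bsub>ore \<delta>\<^esub> q)"
proof (induction q arbitrary: p)
  case 0
  then show ?case
    by (simp add: times_Y_def)
next
  case (pCons a q)
  then show ?case
    by (simp add: times_Y_pCons[OF assms] ore_mult_pCons ore_mult_add_right times_Y_add[OF assms]
        times_Y_smult[OF assms] algebra_simps)
qed

lemma ore_mult_assoc:
  assumes "differential_field \<delta>"
  shows "(p \<otimes>\<^bsub>ore \<delta>\<^esub> q) \<otimes>\<^bsub>ore \<delta>\<^esub> r = p \<otimes>\<^bsub>ore \<delta>\<^esub> (q \<otimes>\<^bsub>ore \<delta>\<^esub> r)"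
  by (induction r arbitrary: q)
    (simp_all add: ore_mult_pCons ore_mult_add_right ore_mult_smult_right
      flip: ore_mult_times_Y[OF assms])

lemma ore_relation:
  assumes "differential_field \<delta>"
  shows "[:x:] \<otimes>\<^bsub>ore \<delta>\<^esub> [:0, 1:] = [:0, 1:] \<otimes>\<^bsub>ore \<delta>\<^esub> [:x:] \<oplus>\<^bsub>ore \<delta>\<^esub> [:\<delta> x:]"
  by (simp add: ore_mult_pCons times_Y_pCons[OF assms]) (simp add: times_Y_def)

lemma times_Y_Ypow:
  assumes "differential_field \<delta>"
  shows "times_Y \<delta> (Ypow n) = Ypow (Suc n)"
  by (simp add: times_Y_def map_poly_monom Polynomial.monom_Suc differential_fieldD[OF assms])

lemma ore_mult_one_right: "p \<otimes>\<^bsub>ore \<delta>\<^esub> 1 = p"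
  by (simp add: ore_def)

lemma Ypow_eq_pow:
  assumes "differential_field \<delta>"
  shows "Ypow n = [:0, 1:] [^]\<^bsub>ore \<delta>\<^esub> n"
proof (induction n)
  case (Suc n)
  then show ?case
    by (simp add: ore_mult_pCons flip: times_Y_Ypow[OF assms])
qed (simp add: Polynomial.monom_0 one_pCons)

lemma ore_mult_one_left:
  assumes "differential_field \<delta>"
  shows "1 \<otimes>\<^bsub>ore \<delta>\<^esub> q = q"
proof -
  have "(times_Y \<delta> ^^ j) 1 = Ypow j" for j
    by (induction j) (simp_all add: times_Y_Ypow[OF assms])
  then show ?thesis
    by (simp add: ore_def Polynomial.smult_monom poly_as_sum_of_monoms)
qed

lemma ring_ore:
  assumes "differential_field \<delta>"
  shows "ring (ore \<delta>)"
proof (rule ringI)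
  show "abelian_group (ore \<delta>)"
  proof (rule abelian_groupI)
    fix p
    show "\<exists>q\<in>carrier (ore \<delta>). q \<oplus>\<^bsub>ore \<delta>\<^esub> p = \<zero>\<^bsub>ore \<delta>\<^esub>"
      by (auto intro: exI[of _ "- p"])
  qed (simp_all add: algebra_simps)
  show "monoid (ore \<delta>)"
    by (rule monoidI)
      (simp_all add: ore_mult_assoc[OF assms] ore_mult_one_left[OF assms] ore_mult_one_right)
qed (simp_all add: ore_mult_add_left[OF assms] ore_mult_add_right)

text \<open>The right action \<open>m \<triangleleft> u\<close> determined by \<open>m \<triangleleft> Y = \<partial>\<^sub>M(m)\<close>\<close>

definition act :: "('k::field, 'm) dspace \<Rightarrow> 'm \<Rightarrow> 'k poly \<Rightarrow> 'm" where
  "act M m u =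
     (\<Oplus>\<^bsub>M\<^esub>j\<in>{..Polynomial.degree u}. Polynomial.coeff u j \<odot>\<^bsub>M\<^esub> (der M ^^ j) m)"

definition Udual :: "('k::field \<Rightarrow> 'k) \<Rightarrow> ('k poly \<Rightarrow> 'k) set" where
  "Udual \<delta> =
     {f. (\<forall>u v. f (u \<oplus>\<^bsub>ore \<delta>\<^esub> v) = f u + f v) \<and> (\<forall>u x. f (u \<otimes>\<^bsub>ore \<delta>\<^esub> scal x) = f u * x)}"

text \<open>The right \<open>\<bbbK>\<close>-linear map with value \<open>a n\<close> at \<open>Y\<^sup>n\<close>\<close>

definition lin_ext :: "(nat \<Rightarrow> 'k::field) \<Rightarrow> 'k poly \<Rightarrow> 'k" where
  "lin_ext a u = (\<Sum>n\<le>Polynomial.degree u. a n * Polynomial.coeff u n)"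

definition eps_U :: "'k::field poly \<Rightarrow> 'k" where
  "eps_U = lin_ext (\<lambda>n. if n = 0 then 1 else 0)"

definition ustar :: "('k::field \<Rightarrow> 'k) \<Rightarrow> ('k poly \<Rightarrow> 'k) ring" where
  "ustar \<delta> =
     \<lparr>carrier = Udual \<delta>,
      monoid.mult = (\<lambda>f g. lin_ext
        (\<lambda>n. \<Sum>k\<le>n. of_nat (n choose k) * f (Ypow k) * g (Ypow (n - k)))),
      one = eps_U,
      ring.zero = (\<lambda>u. 0),
      ring.add = (\<lambda>f g u. f u + g u)\<rparr>"

definition s_ustar :: "'k::field \<Rightarrow> 'k poly \<Rightarrow> 'k" where
  "s_ustar x = (\<lambda>u. x * eps_U u)"

definition t_ustar :: "('k::field \<Rightarrow> 'k) \<Rightarrow> 'k \<Rightarrow> 'k poly \<Rightarrow> 'k" where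
  "t_ustar \<delta> y = lin_ext (\<lambda>n. (\<delta> ^^ n) y)"

definition Phi :: "('k::field poly \<Rightarrow> 'k) \<Rightarrow> nat \<Rightarrow> 'k" where
  "Phi f = (\<lambda>n. f (Ypow n))"


section \<open>The ring \<open>U\<^sup>\<circ>\<close>\<close>

text \<open>The direct sum defining \<open>U\<^sup>\<circ>\<close> ranges over the finite-dimensional differential vector spaces
  with carrier contained in the type \<^typ>\<open>'k poly\<close>. As this type is an infinite-dimensional
  \<open>\<bbbK>\<close>-vector space, every finite-dimensional differential vector space (with carrier in an arbitrary
  type) has an isomorphic copy in this universe.

  A generator \<open>(M, \<phi>, m)\<close> stands for \<open>\<phi> \<otimes> m\<close> in the summand \<open>M\<^sup>* \<otimes>\<^bsub>T_M\<^esub> M\<close>.\<close>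

type_synonym 'k triple = "('k, 'k poly) dspace \<times> ('k poly \<Rightarrow> 'k) \<times> 'k poly"

definition circ_gens :: "('k::field \<Rightarrow> 'k) \<Rightarrow> 'k triple set" where
  "circ_gens \<delta> = {(M, \<phi>, m). diff_space \<delta> M \<and> \<phi> \<in> dual M \<and> m \<in> carrier M}"

text \<open>The relations of the tensor products \<open>M\<^sup>* \<otimes>\<^bsub>T_M\<^esub> M\<close>, where \<open>T\<^sub>M\<close> acts by \<open>\<phi> f = \<phi> \<circ> f\<close> and
  \<open>f m = f(m)\<close>\<close>

definition summand_rels :: "('k::field, 'k poly) dspace \<Rightarrow> (('k poly \<Rightarrow> 'k) \<times> 'k poly) frag set" where
  "summand_rels M =
     tensor_rels (dual M) (\<lambda>\<phi> \<psi>. \<lambda>m\<in>carrier M. \<phi> m + \<psi> m) (\<lambda>\<phi> f. compose (carrier M) \<phi> f)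
       (dspace_homs M M) (carrier M) (ring.add M) (\<lambda>f m. f m)"

text \<open>The relations of all the summands present the direct sum \<open>\<Oplus>\<^sub>M M\<^sup>* \<otimes>\<^bsub>T_M\<^esub> M\<close>; the elements
  \<open>\<psi> \<otimes> f(x) - \<psi> f \<otimes> x\<close> are then divided out as well.\<close>

definition circ_rels :: "('k::field \<Rightarrow> 'k) \<Rightarrow> 'k triple frag set" where
  "circ_rels \<delta> =
     (\<Union>M\<in>{M. diff_space \<delta> M}. frag_extend (\<lambda>(\<phi>, m). frag_of (M, \<phi>, m)) ` summand_rels M) \<union>
     {frag_of (N, \<psi>, f x) - frag_of (M, compose (carrier M) \<psi> f, x) | M N \<psi> f x.
        diff_space \<delta> M \<and> diff_space \<delta> N \<and> \<psi> \<in> dual N \<and> f \<in> dspace_homs M N \<and> x \<in> carrier M}"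

abbreviation circ_class :: "('k::field \<Rightarrow> 'k) \<Rightarrow> 'k triple frag \<Rightarrow> 'k triple frag set" where
  "circ_class \<delta> \<equiv> pres_class (circ_gens \<delta>) (circ_rels \<delta>)"

text \<open>The class of \<open>\<phi> \<otimes> m\<close> for \<open>M\<close> with carrier in an arbitrary type: it is the class of
  \<open>\<phi> \<circ> g \<otimes> g\<^sup>-\<^sup>1(m)\<close> for any isomorphism \<open>g : M' \<rightarrow> M\<close> with \<open>M'\<close> in the universe. By the defining
  relations all these classes coincide, so their union is that class; for \<open>M\<close> in the universe
  it is the class of the generator \<open>(M, \<phi>, m)\<close>.\<close>

definition tclass ::
  "('k::field \<Rightarrow> 'k) \<Rightarrow> ('k, 'm) dspace \<Rightarrow> ('m \<Rightarrow> 'k) \<Rightarrow> 'm \<Rightarrow> 'k triple frag set" where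
  "tclass \<delta> M \<phi> m =
     \<Union>{circ_class \<delta> (frag_of (M', compose (carrier M') \<phi> g, m')) | M' g m'.
        diff_space \<delta> M' \<and> g \<in> dspace_isos M' M \<and> m' \<in> carrier M' \<and> g m' = m}"

text \<open>A representative of \<open>(\<psi> \<diamondop> \<phi>) \<otimes> (q \<otimes>\<^sub>\<bbbK> p)\<close>\<close>

definition circ_mult_gen :: "('k::field \<Rightarrow> 'k) \<Rightarrow> 'k triple \<Rightarrow> 'k triple \<Rightarrow> 'k triple frag" where
  "circ_mult_gen \<delta> = (\<lambda>(M, \<phi>, p) (N, \<psi>, q).
     SOME z. z \<in> tclass \<delta> (tensor_dspace N M) (diamond N M \<psi> \<phi>) (tensor_elt N M q p))"

definition s_circ :: "('k::field \<Rightarrow> 'k) \<Rightarrow> 'k \<Rightarrow> 'k triple frag set" where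
  "s_circ \<delta> k = tclass \<delta> (unit_dspace \<delta>) (\<lambda>x. k * x) 1"

definition t_circ :: "('k::field \<Rightarrow> 'k) \<Rightarrow> 'k \<Rightarrow> 'k triple frag set" where
  "t_circ \<delta> k = tclass \<delta> (unit_dspace \<delta>) (\<lambda>x. 1 * x) k"

definition ucirc :: "('k::field \<Rightarrow> 'k) \<Rightarrow> 'k triple frag set ring" where
  "ucirc \<delta> =
     \<lparr>carrier = carrier (pres (circ_gens \<delta>) (circ_rels \<delta>)),
      monoid.mult = induced2 (\<lambda>x y. circ_class \<delta> (frag_extend2 (circ_mult_gen \<delta>) x y)),
      one = s_circ \<delta> 1,
      ring.zero = monoid.one (pres (circ_gens \<delta>) (circ_rels \<delta>)),
      ring.add = monoid.mult (pres (circ_gens \<delta>) (circ_rels \<delta>))\<rparr>"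

definition der_circ :: "('k::field \<Rightarrow> 'k) \<Rightarrow> 'k triple frag set \<Rightarrow> 'k triple frag set" where
  "der_circ \<delta> =
     induced (\<lambda>x. circ_class \<delta> (frag_extend (\<lambda>(M, \<phi>, m). frag_of (M, \<phi>, der M m)) x))"

definition zeta :: "'k::field triple frag set \<Rightarrow> 'k poly \<Rightarrow> 'k" where
  "zeta = induced (\<lambda>x u. frag_sum (\<lambda>(M, \<phi>, m). \<phi> (act M m u)) x)"


section \<open>The differential vector space attached to \<open>\<alpha> \<in> \<D>lin\<close>\<close>

text \<open>\<open>f\<^sub>\<alpha> = \<Phi>\<^sup>-\<^sup>1(\<alpha>)\<close>\<close>

definition f_alpha :: "('k::field \<Rightarrow> 'k) \<Rightarrow> (nat \<Rightarrow> 'k) \<Rightarrow> 'k poly \<Rightarrow> 'k" where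
  "f_alpha \<delta> \<alpha> = inv_into (carrier (ustar \<delta>)) Phi \<alpha>"

definition annihilator :: "('k::field \<Rightarrow> 'k) \<Rightarrow> (nat \<Rightarrow> 'k) \<Rightarrow> 'k poly set" where
  "annihilator \<delta> \<alpha> =
     {u. \<forall>n. (\<Sum>i\<le>Polynomial.degree u.
          (t_hur \<delta> (Polynomial.coeff u i) \<otimes>\<^bsub>hurwitz\<^esub> (shift ^^ i) \<alpha>) n) = 0}"

definition right_ideal :: "('k::field \<Rightarrow> 'k) \<Rightarrow> 'k poly \<Rightarrow> 'k poly set" where
  "right_ideal \<delta> P = range (\<lambda>u. P \<otimes>\<^bsub>ore \<delta>\<^esub> u)"

definition P_alpha :: "('k::field \<Rightarrow> 'k) \<Rightarrow> (nat \<Rightarrow> 'k) \<Rightarrow> 'k poly" where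
  "P_alpha \<delta> \<alpha> = (THE P. Polynomial.lead_coeff P = 1 \<and> right_ideal \<delta> P = annihilator \<delta> \<alpha>)"

definition M_alpha :: "('k::field \<Rightarrow> 'k) \<Rightarrow> (nat \<Rightarrow> 'k) \<Rightarrow> ('k, 'k poly set) dspace" where
  "M_alpha \<delta> \<alpha> =
     (let I = right_ideal \<delta> (P_alpha \<delta> \<alpha>) in
      \<lparr>carrier = a_rcosets\<^bsub>ore \<delta>\<^esub> I, monoid.mult = undefined, one = undefined,
       ring.zero = I, ring.add = (\<lambda>A B. A <+>\<^bsub>ore \<delta>\<^esub> B),
       module.smult = (\<lambda>x. induced (\<lambda>u. I +>\<^bsub>ore \<delta>\<^esub> (u \<otimes>\<^bsub>ore \<delta>\<^esub> scal x))),
       der = induced (\<lambda>u. I +>\<^bsub>ore \<delta>\<^esub> (u \<otimes>\<^bsub>ore \<delta>\<^esub> Ypow 1))\<rparr>)"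

definition one_alpha :: "('k::field \<Rightarrow> 'k) \<Rightarrow> (nat \<Rightarrow> 'k) \<Rightarrow> 'k poly set" where
  "one_alpha \<delta> \<alpha> = right_ideal \<delta> (P_alpha \<delta> \<alpha>) +>\<^bsub>ore \<delta>\<^esub> \<one>\<^bsub>ore \<delta>\<^esub>"

definition f_tilde :: "('k::field \<Rightarrow> 'k) \<Rightarrow> (nat \<Rightarrow> 'k) \<Rightarrow> 'k poly set \<Rightarrow> 'k" where
  "f_tilde \<delta> \<alpha> = restrict (induced (f_alpha \<delta> \<alpha>)) (carrier (M_alpha \<delta> \<alpha>))"

end

theory Submission
  imports Defs "HOL-Library.Function_Algebras"
begin

text \<open>An element \<open>\<phi> \<otimes> m\<close> of \<open>U\<^sup>\<circ>\<close> has the same information as its orbit, the sequence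
  \<open>\<alpha> = (\<phi>(\<partial>\<^sup>n m))\<^sub>n\<close>. Let \<open>\<bbbK>\<close> act on the Hurwitz series through \<open>t\<close>, and let the shift \<open>\<N>\<close> be the
  differential. The iterated Leibniz rule for \<open>\<partial>\<^sup>n\<close> is the Hurwitz product with \<open>t(x)\<close>, so
  \<open>w \<mapsto> (\<phi>(\<partial>\<^sup>n w))\<^sub>n\<close> is a morphism of differential spaces from \<open>M\<close> onto a finite-dimensional
  shift-stable space \<open>V\<close> of Hurwitz series, under which \<open>\<phi>\<close> becomes evaluation at \<open>0\<close>
  (\<open>orbit_space\<close>). The relations of \<open>U\<^sup>\<circ>\<close> therefore identify \<open>\<phi> \<otimes> m\<close> with \<open>ev\<^sub>0 \<otimes> \<alpha>\<close>, taken in \<open>V\<close>.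
  Any other space of this kind containing \<open>\<alpha>\<close> gives the same class, since both embed into their sum.
  As \<open>ev\<^sub>0 \<otimes> \<alpha>\<close> is additive in \<open>\<alpha>\<close>, every element of \<open>U\<^sup>\<circ>\<close>, not only every generator, has this
  form (\<open>class_eq_eval0\<close>). Hence \<open>\<Phi> \<circ> \<zeta>\<close> is injective (\<open>circ_class_eq_iff\<close>), and its image consists of
  the sequences that lie in a finite-dimensional shift-stable space. These are the sequences in
  \<open>\<D>lin\<close>: in such a space the shifts of \<open>\<alpha>\<close> are linearly dependent (\<open>Dlin_if_mem_hsub\<close>), and a
  recursion of order \<open>d\<close> makes the span of the first \<open>d\<close> shifts stable (\<open>Dlin_shift_pow\<close>).

  The orbit of \<open>q \<otimes> p\<close> in a tensor product is the Hurwitz product of the orbits (\<open>orbit_diamond\<close>). So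
  \<open>\<Phi> \<circ> \<zeta>\<close> turns the operations of \<open>U\<^sup>\<circ>\<close> into those of the Hurwitz series. Injectivity then does
  double duty. It shows that the product of \<open>U\<^sup>\<circ>\<close> is well defined on classes, and it lets all laws be
  checked among Hurwitz series. The locale \<open>hurwitz_embedding\<close> packages the second point and serves
  \<open>U\<^sup>*\<close>, \<open>U\<^sup>\<circ>\<close> and \<open>\<D>lin\<close> alike.

  For the inverse, let \<open>u \<in> U\<close> act on \<open>\<alpha>\<close> by \<open>\<Sum>\<^sub>i t(u\<^sub>i) \<N>\<^sup>i(\<alpha>)\<close>. The kernel of this map is the annihilator,
  which division by an element of least degree shows to be \<open>P\<^sub>\<alpha> U\<close> (\<open>P_alpha\<close>). So \<open>M\<^sub>\<alpha>\<close> is isomorphic to a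
  shift-stable space of Hurwitz series in which the class of \<open>1\<close> corresponds to \<open>\<alpha>\<close> and \<open>f\<^sub>\<alpha>\<close> to
  evaluation at \<open>0\<close> (\<open>M_alpha_iso\<close>, \<open>f_tilde\<close>), and the orbit of \<open>f\<^sub>\<alpha> \<otimes> 1\<close> is \<open>\<alpha>\<close>.\<close>


section \<open>Groups given by generators and relations\<close>

locale presentation =
  fixes A :: "'a set" and R :: "'a frag set"
  assumes keys_rels: "r \<in> R \<Longrightarrow> Poly_Mapping.keys r \<subseteq> A"
begin

lemma pres_rel_subset: "r \<in> pres_rel A R \<Longrightarrow> Poly_Mapping.keys r \<subseteq> A"
proof -
  assume "r \<in> pres_rel A R"
  moreover have "R \<subseteq> carrier (free_Abelian_group A)"
    using keys_rels by (simp add: subset_iff)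
  ultimately have "r \<in> carrier (free_Abelian_group A)"
    using group.generate_in_carrier[OF group_free_Abelian_group] by (simp add: pres_rel_def del: carrier_free_Abelian_group_iff)
  then show ?thesis by simp
qed

lemma subgroup_pres_rel: "subgroup (pres_rel A R) (free_Abelian_group A)"
  unfolding pres_rel_def
  by (rule group.generate_is_subgroup) (use keys_rels in auto)

lemma normal_pres_rel: "pres_rel A R \<lhd> free_Abelian_group A"
  by (rule comm_group.subgroup_imp_normal[OF abelian_free_Abelian_group subgroup_pres_rel])

lemma rel_zero: "0 \<in> pres_rel A R"
  using generate.one[of "free_Abelian_group A" R] by (simp add: pres_rel_def)

lemma rel_incl: "r \<in> R \<Longrightarrow> r \<in> pres_rel A R"
  by (simp add: pres_rel_def generate.incl)

lemma rel_add: "r \<in> pres_rel A R \<Longrightarrow> r' \<in> pres_rel A R \<Longrightarrow> r + r' \<in> pres_rel A R"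
  using subgroup.m_closed[OF subgroup_pres_rel, of r r'] by simp

lemma rel_minus: "r \<in> pres_rel A R \<Longrightarrow> - r \<in> pres_rel A R"
  using subgroup.m_inv_closed[OF subgroup_pres_rel, of r] pres_rel_subset[of r] by simp

lemma rel_diff: "r \<in> pres_rel A R \<Longrightarrow> r' \<in> pres_rel A R \<Longrightarrow> r - r' \<in> pres_rel A R"
  using rel_add[OF _ rel_minus] by fastforce

lemma pres_rel_induct [consumes 1, case_names zero incl diff]:
  assumes "r \<in> pres_rel A R" and "Q 0" and "\<And>r. r \<in> R \<Longrightarrow> Q r"
    and diff: "\<And>x y. Q x \<Longrightarrow> Q y \<Longrightarrow> Q (x - y)"
  shows "Q r"
  using assms(1) unfolding pres_rel_def
proof (induction rule: generate.induct)
  case (inv h)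
  have "Q (0 - h)" by (rule diff) (use inv assms in auto)
  then show ?case using inv keys_rels by simp
next
  case (eng h1 h2)
  have "Q (h1 - (0 - h2))" by (intro diff eng assms)
  then show ?case by simp
qed (use assms in auto)

lemma pres_class_eq: "pres_class A R x = {r + x | r. r \<in> pres_rel A R}"
  by (auto simp: pres_class_def r_coset_def)

lemma mem_class_iff: "z \<in> pres_class A R x \<longleftrightarrow> z - x \<in> pres_rel A R"
proof
  assume "z - x \<in> pres_rel A R"
  then have "(z - x) + x \<in> pres_class A R x"
    unfolding pres_class_eq by blast
  then show "z \<in> pres_class A R x" by simp
qed (auto simp: pres_class_eq)

lemma self_mem_class: "x \<in> pres_class A R x"
  by (simp add: mem_class_iff rel_zero)

lemma class_eq_iff: "pres_class A R x = pres_class A R y \<longleftrightarrow> x - y \<in> pres_rel A R"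
proof
  assume xy: "x - y \<in> pres_rel A R"
  have "z - x \<in> pres_rel A R \<longleftrightarrow> z - y \<in> pres_rel A R" for z
    using rel_add[OF _ xy, of "z - x"] rel_diff[OF _ xy, of "z - y"] by auto
  then show "pres_class A R x = pres_class A R y"
    by (auto simp: mem_class_iff)
qed (metis self_mem_class mem_class_iff)

lemma carrier_pres: "carrier (pres A R) = pres_class A R ` {x. Poly_Mapping.keys x \<subseteq> A}"
  by (auto simp: pres_def pres_class_def carrier_FactGroup)

lemma keys_mem_class:
  assumes "z \<in> pres_class A R x" "Poly_Mapping.keys x \<subseteq> A"
  shows "Poly_Mapping.keys z \<subseteq> A"
proof -
  obtain r where "r \<in> pres_rel A R" "z = r + x"
    using assms by (auto simp: pres_class_eq)
  then show ?thesis
    using keys_add[of r x] pres_rel_subset assms by blast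
qed

lemma one_pres: "\<one>\<^bsub>pres A R\<^esub> = pres_class A R 0"
  by (auto simp: pres_def pres_class_eq)

lemma mult_pres:
  assumes "Poly_Mapping.keys x \<subseteq> A" "Poly_Mapping.keys y \<subseteq> A"
  shows "pres_class A R x \<otimes>\<^bsub>pres A R\<^esub> pres_class A R y = pres_class A R (x + y)"
  using normal.rcos_sum[OF normal_pres_rel, of x y] assms
  by (simp add: pres_def pres_class_def)

text \<open>An induced map takes the value that \<open>h\<close> has on any representative, once \<open>h\<close> is
  unchanged by adding relations; for additive \<open>h\<close> it suffices that \<open>h\<close> kills the relations.\<close>

lemma induced_class:
  assumes "\<And>r. r \<in> pres_rel A R \<Longrightarrow> h (r + x) = h x"
  shows "induced h (pres_class A R x) = h x"
proof -
  have "h ` pres_class A R x = {h x}"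
    using assms self_mem_class[of x] by (auto simp: pres_class_eq)
  then show ?thesis by (simp add: induced_def)
qed

lemma frag_extend_rel:
  assumes "r \<in> pres_rel A R" "presentation B S"
    and "\<And>r. r \<in> R \<Longrightarrow> frag_extend f r \<in> pres_rel B S"
  shows "frag_extend f r \<in> pres_rel B S"
  using assms(1)
  by (induction rule: pres_rel_induct)
    (simp_all add: frag_extend_diff presentation.rel_zero presentation.rel_diff assms)

lemma induced_frag_extend:
  assumes "presentation B S" and "\<And>r. r \<in> R \<Longrightarrow> frag_extend f r \<in> pres_rel B S"
  shows "induced (\<lambda>z. pres_class B S (frag_extend f z)) (pres_class A R x) =
    pres_class B S (frag_extend f x)"
  by (rule induced_class)
    (simp add: presentation.class_eq_iff[OF assms(1)] frag_extend_add frag_extend_rel assms)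

end

lemma keys_diff_subset:
  "Poly_Mapping.keys x \<subseteq> A \<Longrightarrow> Poly_Mapping.keys y \<subseteq> A \<Longrightarrow> Poly_Mapping.keys (x - y :: 'a frag) \<subseteq> A"
  using keys_diff[of x y] by blast

lemma keys_add_subset:
  "Poly_Mapping.keys x \<subseteq> A \<Longrightarrow> Poly_Mapping.keys y \<subseteq> A \<Longrightarrow> Poly_Mapping.keys (x + y :: 'a frag) \<subseteq> A"
  using keys_add[of x y] by blast

lemma keys_frag_extend_subset:
  assumes "Poly_Mapping.keys z \<subseteq> A" "\<And>a. a \<in> A \<Longrightarrow> Poly_Mapping.keys (f a) \<subseteq> B"
  shows "Poly_Mapping.keys (frag_extend f z) \<subseteq> B"
  using keys_frag_extend[of f z] assms by blast

lemma frag_extend_rel_cong: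
  assumes "presentation B S" and "Poly_Mapping.keys z \<subseteq> A"
    and "\<And>a. a \<in> A \<Longrightarrow> f a - g a \<in> pres_rel B S"
  shows "frag_extend f z - frag_extend g z \<in> pres_rel B S"
  using assms(2)
proof (induction z rule: frag_induction)
  case (diff x y)
  have "frag_extend f (x - y) - frag_extend g (x - y) =
    (frag_extend f x - frag_extend g x) - (frag_extend f y - frag_extend g y)"
    by (simp add: frag_extend_diff)
  then show ?case
    using diff presentation.rel_diff[OF assms(1)] by metis
qed (use assms presentation.rel_zero in auto)

lemma frag_extend_plus:
  "frag_extend (\<lambda>a. f a + g a) z = frag_extend f z + frag_extend g z"
  using subset_UNIV[of "Poly_Mapping.keys z"]
  by (induction z rule: frag_induction) (auto simp: frag_extend_diff)

lemma frag_sum_eq: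
  assumes "finite S" "Poly_Mapping.keys x \<subseteq> S"
  shows "frag_sum g x = (\<Sum>a\<in>S. of_int (Poly_Mapping.lookup x a) * g a)"
  unfolding frag_sum_def using assms
  by (intro sum.mono_neutral_left) (auto simp: in_keys_iff)

lemma frag_sum_diff: "frag_sum g (x - y) = frag_sum g x - frag_sum g y"
proof -
  let ?S = "Poly_Mapping.keys x \<union> Poly_Mapping.keys y"
  have "Poly_Mapping.keys (x - y) \<subseteq> ?S"
    by (rule keys_diff)
  then show ?thesis
    by (simp add: frag_sum_eq[of ?S] lookup_minus left_diff_distrib sum_subtractf)
qed

lemma frag_sum_0 [simp]: "frag_sum g 0 = 0"
  by (simp add: frag_sum_def)

lemma frag_sum_of [simp]: "frag_sum g (frag_of a) = g a"
  by (simp add: frag_sum_def)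

lemma frag_sum_add: "frag_sum g (x + y) = frag_sum g x + frag_sum g y"
  using frag_sum_diff[of g "x + y" y] by (simp add: algebra_simps)

lemma (in presentation) frag_sum_rel:
  assumes "r \<in> pres_rel A R" "\<And>r. r \<in> R \<Longrightarrow> frag_sum g r = 0"
  shows "frag_sum g r = 0"
  using assms(1) by (induction rule: pres_rel_induct) (simp_all add: frag_sum_diff assms)

locale abelian_ring_group = abelian_group G for G :: "'r ring" (structure)
begin


lemma ring_frag_sum_eq:
  assumes "finite S" "Poly_Mapping.keys x \<subseteq> S" "\<And>a. a \<in> S \<Longrightarrow> g a \<in> carrier G"
  shows "ring_frag_sum G g x = (\<Oplus>a\<in>S. [Poly_Mapping.lookup x a] \<cdot> g a)"
proof -
  have "[(0::int)] \<cdot> a = \<zero>" for a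
    by (simp add: add_pow_def int_pow_def)
  then show ?thesis
    unfolding ring_frag_sum_def
    by (intro add.finprod_mono_neutral_cong_left) (use assms in \<open>auto simp: in_keys_iff\<close>)
qed

lemma ring_frag_sum_closed:
  "(\<And>a. a \<in> Poly_Mapping.keys x \<Longrightarrow> g a \<in> carrier G) \<Longrightarrow> ring_frag_sum G g x \<in> carrier G"
  unfolding ring_frag_sum_def by (rule finsum_closed) auto

lemma ring_frag_sum_add:
  assumes g: "\<And>a. g a \<in> carrier G"
  shows "ring_frag_sum G g (x + y) = ring_frag_sum G g x \<oplus> ring_frag_sum G g y"
proof -
  let ?S = "Poly_Mapping.keys x \<union> Poly_Mapping.keys y"
  have "Poly_Mapping.keys (x + y) \<subseteq> ?S"
    by (rule keys_add)
  then show ?thesis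
    by (simp add: ring_frag_sum_eq[of ?S] g lookup_add add.int_pow_mult finsum_addf Pi_def)
qed

lemma ring_frag_sum_of [simp]: "g a \<in> carrier G \<Longrightarrow> ring_frag_sum G g (frag_of a) = g a"
  by (simp add: ring_frag_sum_def)

lemma ring_frag_sum_0 [simp]: "ring_frag_sum G g 0 = \<zero>"
  by (simp add: ring_frag_sum_def)

lemma ring_frag_sum_diff:
  assumes g: "\<And>a. g a \<in> carrier G"
  shows "ring_frag_sum G g (x - y) = ring_frag_sum G g x \<ominus> ring_frag_sum G g y"
  using ring_frag_sum_add[of g "x - y" y] ring_frag_sum_closed[of _ g] g
  by (simp add: minus_eq a_assoc r_neg)

end

lemma frag_extend_minus_fun:
  "frag_extend (\<lambda>a. f a - g a) z = frag_extend f z - frag_extend g z"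
  using frag_extend_plus[of "\<lambda>a. f a - g a" g z] by simp

lemma frag_extend2_diff_left:
  "frag_extend2 g (x - x') y = frag_extend2 g x y - frag_extend2 g x' y"
  by (simp add: frag_extend2_def frag_extend_diff)

lemma frag_extend2_diff_right:
  "frag_extend2 g x (y - y') = frag_extend2 g x y - frag_extend2 g x y'"
  by (simp add: frag_extend2_def frag_extend_diff frag_extend_minus_fun)

lemma frag_extend2_of_right: "frag_extend2 g x (frag_of b) = frag_extend (\<lambda>a. g a b) x"
  by (simp add: frag_extend2_def)

lemma frag_extend2_0 [simp]: "frag_extend2 g 0 y = 0" "frag_extend2 g x 0 = 0"
  using frag_extend2_diff_right[of g x 0 0] by (simp_all add: frag_extend2_def)

lemma frag_extend2_of [simp]: "frag_extend2 g (frag_of a) (frag_of b) = g a b"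
  by (simp add: frag_extend2_def)

lemma frag_extend2_swap: "frag_extend2 g x y = frag_extend2 (\<lambda>b a. g a b) y x"
  using subset_UNIV[of "Poly_Mapping.keys x"]
proof (induction x rule: frag_induction)
  case (one a)
  show ?case by (simp add: frag_extend2_of_right) (simp add: frag_extend2_def)
qed (simp_all add: frag_extend2_diff_left frag_extend2_diff_right)

text \<open>Both sides of a biadditive identity are determined by their values on pairs of generators.\<close>

lemma frag_extend2_induct:
  assumes "Poly_Mapping.keys x \<subseteq> A" "Poly_Mapping.keys y \<subseteq> B"
    and "\<And>y. P 0 y" "\<And>x. P x 0"
    and "\<And>x x' y. P x y \<Longrightarrow> P x' y \<Longrightarrow> P (x - x') y"
    and "\<And>x y y'. P x y \<Longrightarrow> P x y' \<Longrightarrow> P x (y - y')"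
    and "\<And>a b. a \<in> A \<Longrightarrow> b \<in> B \<Longrightarrow> P (frag_of a) (frag_of b)"
  shows "P x y"
  using assms(1)
proof (induction x rule: frag_induction)
  case (one a)
  from assms(2) show ?case
    by (induction y rule: frag_induction) (use one assms in auto)
qed (use assms in auto)

lemma induced2_eqI:
  assumes "z \<in> Z" "w \<in> W" "\<And>z w. z \<in> Z \<Longrightarrow> w \<in> W \<Longrightarrow> h z w = c"
  shows "induced2 h Z W = c"
proof -
  have "case_prod h ` (Z \<times> W) = {c}"
    using assms by force
  then show ?thesis by (simp add: induced2_def)
qed


section \<open>Algebras over the tensor product of a field with itself\<close>

lemma ring_of_type_algebra_simps [simp]:
  "carrier ring_of_type_algebra = UNIV" "x \<otimes>\<^bsub>ring_of_type_algebra\<^esub> y = x * y"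
  "x \<oplus>\<^bsub>ring_of_type_algebra\<^esub> y = x + y" "\<one>\<^bsub>ring_of_type_algebra\<^esub> = 1"
  "\<zero>\<^bsub>ring_of_type_algebra\<^esub> = 0"
  by (simp_all add: ring_of_type_algebra_def)

interpretation kk: presentation UNIV "kk_rels \<delta>" for \<delta> :: "'k::field \<Rightarrow> 'k"
  by standard simp

abbreviation kk_gen_mult :: "'k::field \<times> 'k \<Rightarrow> 'k \<times> 'k \<Rightarrow> ('k \<times> 'k) frag" where
  "kk_gen_mult \<equiv> \<lambda>(x, y) (x', y'). frag_of (x * x', y * y')"

lemma kk_rels_cases:
  assumes "r \<in> kk_rels \<delta>"
  obtains (add_left) a a' b where "r = frag_of (a + a', b) - frag_of (a, b) - frag_of (a', b)"
  | (add_right) a b b' where "r = frag_of (a, b + b') - frag_of (a, b) - frag_of (a, b')"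
  | (balance) a c b where "c \<in> constants \<delta>" "r = frag_of (a * c, b) - frag_of (a, c * b)"
  using assms unfolding kk_rels_def tensor_rels_def by blast

lemma kk_relI:
  "frag_of (a + a', b) - frag_of (a, b) - frag_of (a', b) \<in> kk_rels \<delta>"
  "frag_of (a, b + b') - frag_of (a, b) - frag_of (a, b') \<in> kk_rels \<delta>"
  "c \<in> constants \<delta> \<Longrightarrow> frag_of (a * c, b) - frag_of (a, c * b) \<in> kk_rels \<delta>"
  unfolding kk_rels_def tensor_rels_def by blast+

text \<open>The relations of \<open>\<bbbK> \<otimes> \<bbbK>\<close> form an ideal of the monoid ring of \<open>\<bbbK>
  \<times> \<bbbK>\<close>, because multiplying a relation by a generator gives a relation of the same kind.\<close>

lemma kk_mult_rel_left:
  assumes "r \<in> pres_rel UNIV (kk_rels \<delta>)"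
  shows "frag_extend2 kk_gen_mult r w \<in> pres_rel UNIV (kk_rels \<delta>)"
  using subset_UNIV[of "Poly_Mapping.keys w"]
proof (induction w rule: frag_induction)
  case (one b)
  obtain x y where b: "b = (x, y)" by force
  show ?case
    unfolding frag_extend2_of_right
  proof (rule kk.frag_extend_rel[OF assms kk.presentation_axioms])
    fix r assume "r \<in> kk_rels \<delta>"
    then show "frag_extend (\<lambda>a. kk_gen_mult a b) r \<in> pres_rel UNIV (kk_rels \<delta>)"
    proof (cases rule: kk_rels_cases)
      case (add_left a a' c)
      then show ?thesis
        using kk.rel_incl[OF kk_relI(1)[of "a * x" "a' * x" "c * y" \<delta>]]
        unfolding add_left by (simp add: b frag_extend_diff distrib_right)
    next
      case (add_right a c c')
      then show ?thesis
        using kk.rel_incl[OF kk_relI(2)[of "a * x" "c * y" "c' * y" \<delta>]]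
        unfolding add_right by (simp add: b frag_extend_diff distrib_right)
    next
      case (balance a d c)
      then show ?thesis
        using kk.rel_incl[OF kk_relI(3)[of d \<delta> "a * x" "c * y"]]
        unfolding balance(2) using balance(1) by (simp add: b frag_extend_diff mult_ac)
    qed
  qed
qed (simp_all add: kk.rel_zero kk.rel_diff frag_extend2_diff_right)

lemma kk_mult_rel_right:
  assumes "r \<in> pres_rel UNIV (kk_rels \<delta>)"
  shows "frag_extend2 kk_gen_mult z r \<in> pres_rel UNIV (kk_rels \<delta>)"
proof -
  have "frag_extend2 (\<lambda>b a. kk_gen_mult a b) r z = frag_extend2 kk_gen_mult r z"
    by (rule arg_cong[of _ _ "\<lambda>g. frag_extend2 g r z"]) (auto simp: fun_eq_iff mult.commute)
  then have "frag_extend2 kk_gen_mult z r = frag_extend2 kk_gen_mult r z"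
    by (simp only: frag_extend2_swap[of _ z r])
  then show ?thesis
    using kk_mult_rel_left[OF assms, of z] by simp
qed

lemma kk_ring_simps:
  "carrier (kk_ring \<delta>) = range (pres_class UNIV (kk_rels \<delta>))"
  "\<one>\<^bsub>kk_ring \<delta>\<^esub> = pres_class UNIV (kk_rels \<delta>) (frag_of (1, 1))"
  "pres_class UNIV (kk_rels \<delta>) z \<oplus>\<^bsub>kk_ring \<delta>\<^esub> pres_class UNIV (kk_rels \<delta>) w =
    pres_class UNIV (kk_rels \<delta>) (z + w)"
  by (simp_all add: kk_ring_def kk.carrier_pres kk.mult_pres)

lemma kk_ring_mult:
  "pres_class UNIV (kk_rels \<delta>) z \<otimes>\<^bsub>kk_ring \<delta>\<^esub> pres_class UNIV (kk_rels \<delta>) w =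
    pres_class UNIV (kk_rels \<delta>) (frag_extend2 kk_gen_mult z w)"
  unfolding kk_ring_def monoid.simps
proof (rule induced2_eqI[OF kk.self_mem_class kk.self_mem_class])
  fix z' w'
  assume z': "z' \<in> pres_class UNIV (kk_rels \<delta>) z" and w': "w' \<in> pres_class UNIV (kk_rels \<delta>) w"
  have "frag_extend2 kk_gen_mult z' w' - frag_extend2 kk_gen_mult z w =
      frag_extend2 kk_gen_mult (z' - z) w' + frag_extend2 kk_gen_mult z (w' - w)"
    by (simp add: frag_extend2_diff_left frag_extend2_diff_right)
  then show "pres_class UNIV (kk_rels \<delta>) (frag_extend2 kk_gen_mult z' w') =
      pres_class UNIV (kk_rels \<delta>) (frag_extend2 kk_gen_mult z w)"
    using kk_mult_rel_left[of "z' - z" \<delta> w'] kk_mult_rel_right[of "w' - w" \<delta> z] z' w'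
    by (simp only: kk.class_eq_iff kk.mem_class_iff kk.rel_add)
qed

text \<open>The condition on the constants is what makes \<open>x \<otimes> y \<mapsto> s(x) t(y)\<close> respect the
  balancing relation.\<close>

locale source_target_pair = cring R for R :: "'r ring" (structure) +
  fixes \<delta> :: "'k::field \<Rightarrow> 'k" and s t :: "'k \<Rightarrow> 'r"
  assumes s_hom: "s \<in> ring_hom ring_of_type_algebra R"
    and t_hom: "t \<in> ring_hom ring_of_type_algebra R"
    and agree: "c \<in> constants \<delta> \<Longrightarrow> s c = t c"
begin

lemma st_closed [simp]: "s x \<in> carrier R" "t x \<in> carrier R"
  using ring_hom_closed[OF s_hom] ring_hom_closed[OF t_hom] by simp_all

lemma st_simps:
  "s (x + y) = s x \<oplus> s y" "t (x + y) = t x \<oplus> t y"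
  "s (x * y) = s x \<otimes> s y" "t (x * y) = t x \<otimes> t y"
  "s 1 = \<one>" "t 1 = \<one>"
  using ring_hom_add[OF s_hom] ring_hom_add[OF t_hom] ring_hom_mult[OF s_hom]
    ring_hom_mult[OF t_hom] ring_hom_one[OF s_hom] ring_hom_one[OF t_hom] by simp_all

abbreviation st_gen :: "'k \<times> 'k \<Rightarrow> 'r" where
  "st_gen \<equiv> \<lambda>(x, y). s x \<otimes> t y"

lemma st_gen_closed: "st_gen a \<in> carrier R"
  by (auto split: prod.split)

sublocale abelian_ring_group R ..

lemmas st_sum = ring_frag_sum_add[of st_gen, OF st_gen_closed]
  ring_frag_sum_diff[of st_gen, OF st_gen_closed]

lemma st_sum_closed [simp]: "ring_frag_sum R st_gen z \<in> carrier R"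
  by (rule ring_frag_sum_closed) (rule st_gen_closed)

lemma st_sum_of [simp]: "ring_frag_sum R st_gen (frag_of (x, y)) = s x \<otimes> t y"
  by (subst ring_frag_sum_of) (auto split: prod.split)

lemma minus_minus_cancel:
  "a \<in> carrier R \<Longrightarrow> b \<in> carrier R \<Longrightarrow> (a \<oplus> b) \<ominus> a \<ominus> b = \<zero>"
  by algebra

lemma st_sum_rel:
  assumes "r \<in> pres_rel UNIV (kk_rels \<delta>)"
  shows "ring_frag_sum R st_gen r = \<zero>"
  using assms
proof (induction rule: kk.pres_rel_induct)
  case (incl r)
  then show ?case
  proof (cases rule: kk_rels_cases)
    case (add_left a a' b)
    then show ?thesis
      by (simp add: st_sum st_simps l_distr minus_minus_cancel)
  next
    case (add_right a b b')
    then show ?thesis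
      by (simp add: st_sum st_simps r_distr minus_minus_cancel)
  next
    case (balance a c b)
    then show ?thesis
      by (simp add: st_sum st_simps agree m_assoc r_right_minus_eq)
  qed
qed (simp_all add: st_sum)

lemma source_target_class:
  "source_target R s t (pres_class UNIV (kk_rels \<delta>) z) = ring_frag_sum R st_gen z"
  unfolding source_target_def
  by (rule kk.induced_class) (simp add: st_sum st_sum_rel)

lemma st_sum_mult:
  "ring_frag_sum R st_gen (frag_extend2 kk_gen_mult z w) =
    ring_frag_sum R st_gen z \<otimes> ring_frag_sum R st_gen w"
proof (rule frag_extend2_induct[of z UNIV w UNIV])
  fix a b :: "'k \<times> 'k"
  obtain x y x' y' where "a = (x, y)" "b = (x', y')" by force
  moreover have "s x \<otimes> s x' \<otimes> (t y \<otimes> t y') = (s x \<otimes> t y) \<otimes> (s x' \<otimes> t y')"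
    by (simp add: m_ac)
  ultimately show "ring_frag_sum R st_gen (frag_extend2 kk_gen_mult (frag_of a) (frag_of b)) =
      ring_frag_sum R st_gen (frag_of a) \<otimes> ring_frag_sum R st_gen (frag_of b)"
    by (simp add: st_simps)
qed (simp_all add: frag_extend2_diff_left frag_extend2_diff_right st_sum minus_eq l_distr r_distr
    l_minus r_minus)

lemma kk_algebra_source_target: "kk_algebra \<delta> R (source_target R s t)"
  unfolding kk_algebra_def
proof (intro conjI)
  show "source_target R s t \<in> ring_hom (kk_ring \<delta>) R"
    by (rule ring_hom_memI)
      (auto simp: kk_ring_simps kk_ring_mult source_target_class st_sum_mult st_sum st_simps)
qed (rule cring_axioms)

lemma kk_algebra_hom_source_target:
  assumes "source_target_pair R' \<delta> s' t'" "f \<in> ring_hom R R'"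
    and "\<And>x. f (s x) = s' x" "\<And>x. f (t x) = t' x"
  shows "kk_algebra_hom \<delta> R (source_target R s t) R' (source_target R' s' t') f"
proof -
  interpret R': source_target_pair R' \<delta> s' t' by fact
  interpret f: ring_hom_ring R R' f
    by (rule ring_hom_ringI2) (use assms ring_axioms R'.ring_axioms in auto)
  have "f (ring_frag_sum R st_gen z) = ring_frag_sum R' R'.st_gen z" for z
    using subset_UNIV[of "Poly_Mapping.keys z"]
  proof (induction z rule: frag_induction)
    case (one a)
    then show ?case
      by (cases a) (simp add: assms)
  qed (simp_all add: st_sum R'.st_sum minus_eq R'.minus_eq)
  then show ?thesis
    unfolding kk_algebra_hom_def
    using kk_algebra_source_target R'.kk_algebra_source_target assms(2)
    by (auto simp: kk_ring_simps source_target_class R'.source_target_class)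
qed

end


section \<open>Hurwitz series\<close>

abbreviation hmul :: "(nat \<Rightarrow> 'k::field) \<Rightarrow> (nat \<Rightarrow> 'k) \<Rightarrow> nat \<Rightarrow> 'k" (infixl "\<star>" 70) where
  "\<alpha> \<star> \<beta> \<equiv> \<alpha> \<otimes>\<^bsub>hurwitz\<^esub> \<beta>"

lemma hurwitz_simps [simp]:
  "carrier hurwitz = UNIV" "\<alpha> \<oplus>\<^bsub>hurwitz\<^esub> \<beta> = \<alpha> + \<beta>" "\<zero>\<^bsub>hurwitz\<^esub> = 0"
  "\<one>\<^bsub>hurwitz\<^esub> = s_hur 1"
  by (auto simp: hurwitz_def s_hur_def)

lemma shift_simps [simp]:
  "shift \<alpha> n = \<alpha> (Suc n)" "shift (\<alpha> + \<beta>) = shift \<alpha> + shift \<beta>" "shift (- \<alpha>) = - shift \<alpha>"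
  "shift (\<alpha> - \<beta>) = shift \<alpha> - shift \<beta>" "shift 0 = 0"
  for \<alpha> \<beta> :: "nat \<Rightarrow> 'k::field"
  by (simp_all add: shift_def fun_eq_iff)

lemma funpow_shift: "(shift ^^ i) \<alpha> n = \<alpha> (n + i)"
  by (induction i arbitrary: \<alpha> n) (simp_all add: shift_def)

lemma hmul_0 [simp]: "(\<alpha> \<star> \<beta>) 0 = \<alpha> 0 * \<beta> 0"
  by (simp add: hurwitz_def)

text \<open>Pascal's rule. Together with the value at \<open>0\<close>, this derivation rule determines the product, so
  identities of Hurwitz products are proved below by induction on the index, for all series simultaneously.\<close>

lemma hmul_Suc: "(\<alpha> \<star> \<beta>) (Suc n) = (shift \<alpha> \<star> \<beta>) n + (\<alpha> \<star> shift \<beta>) n"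
proof -
  have "(\<alpha> \<star> \<beta>) (Suc n) = \<alpha> 0 * \<beta> (Suc n) +
      (\<Sum>k\<le>n. of_nat ((n choose k) + (n choose Suc k)) * \<alpha> (Suc k) * \<beta> (n - k))"
    unfolding hurwitz_def monoid.simps
    by (subst sum.atMost_Suc_shift) (simp only: binomial_Suc_Suc binomial_n_0 diff_Suc_Suc diff_zero of_nat_1 mult_1)
  also have "\<dots> = (\<Sum>k\<le>n. of_nat (n choose k) * \<alpha> (Suc k) * \<beta> (n - k)) +
      (\<alpha> 0 * \<beta> (Suc n) + (\<Sum>k\<le>n. of_nat (n choose Suc k) * \<alpha> (Suc k) * \<beta> (Suc n - Suc k)))"
    by (simp add: algebra_simps sum.distrib)
  also have "\<alpha> 0 * \<beta> (Suc n) + (\<Sum>k\<le>n. of_nat (n choose Suc k) * \<alpha> (Suc k) * \<beta> (Suc n - Suc k)) =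
      (\<Sum>k\<le>Suc n. of_nat (n choose k) * \<alpha> k * \<beta> (Suc n - k))"
    by (subst sum.atMost_Suc_shift) simp
  also have "\<dots> = (\<Sum>k\<le>n. of_nat (n choose k) * \<alpha> k * \<beta> (Suc (n - k)))"
    by (simp add: Suc_diff_le binomial_eq_0)
  finally show ?thesis
    by (simp add: hurwitz_def)
qed

lemma hmul_add_left: "(\<alpha> + \<beta>) \<star> \<gamma> = \<alpha> \<star> \<gamma> + \<beta> \<star> \<gamma>"
  by (simp add: hurwitz_def fun_eq_iff algebra_simps sum.distrib)

lemma hmul_commute: "\<alpha> \<star> \<beta> = \<beta> \<star> \<alpha>"
proof
  fix n show "(\<alpha> \<star> \<beta>) n = (\<beta> \<star> \<alpha>) n"
    by (induction n arbitrary: \<alpha> \<beta>) (simp_all add: hmul_Suc mult.commute add.commute)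
qed

lemma hmul_add_right: "\<gamma> \<star> (\<alpha> + \<beta>) = \<gamma> \<star> \<alpha> + \<gamma> \<star> \<beta>"
  by (simp add: hmul_commute[of \<gamma>] hmul_add_left)

lemma shift_hmul: "shift (\<alpha> \<star> \<beta>) = shift \<alpha> \<star> \<beta> + \<alpha> \<star> shift \<beta>"
  by (simp add: fun_eq_iff hmul_Suc)

lemma hmul_assoc: "(\<alpha> \<star> \<beta>) \<star> \<gamma> = \<alpha> \<star> (\<beta> \<star> \<gamma>)"
proof
  fix n show "((\<alpha> \<star> \<beta>) \<star> \<gamma>) n = (\<alpha> \<star> (\<beta> \<star> \<gamma>)) n"
    by (induction n arbitrary: \<alpha> \<beta> \<gamma>)
      (simp_all add: hmul_Suc shift_hmul hmul_add_left hmul_add_right mult.assoc)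
qed

text \<open>Multiplication by \<open>s(x)\<close> is the pointwise action of \<open>x\<close>. It differs from the action
  through \<open>t\<close> unless \<open>x\<close> is a constant.\<close>

lemma s_hur_mult: "s_hur x \<star> \<alpha> = (\<lambda>n. x * \<alpha> n)"
proof
  fix n
  have 0: "(s_hur 0 \<star> \<alpha>) n = 0" for \<alpha> :: "nat \<Rightarrow> 'k::field" and n
    by (simp add: hurwitz_def s_hur_def)
  have 1: "shift (s_hur x) = s_hur 0"
    by (simp add: fun_eq_iff s_hur_def)
  show "(s_hur x \<star> \<alpha>) n = x * \<alpha> n"
    by (induction n arbitrary: \<alpha>) (simp_all add: hmul_Suc 0 1, simp add: s_hur_def)
qed

lemma shift_s_hur: "shift (s_hur x) = 0"
  by (simp add: fun_eq_iff s_hur_def)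

lemma cring_hurwitz: "cring (hurwitz :: (nat \<Rightarrow> 'k::field) ring)"
proof (rule cringI)
  show "abelian_group (hurwitz :: (nat \<Rightarrow> 'k) ring)"
  proof (rule abelian_groupI)
    fix \<alpha> :: "nat \<Rightarrow> 'k"
    show "\<exists>\<beta>\<in>carrier hurwitz. \<beta> \<oplus>\<^bsub>hurwitz\<^esub> \<alpha> = \<zero>\<^bsub>hurwitz\<^esub>"
      by (intro bexI[of _ "- \<alpha>"]) simp_all
  qed (simp_all add: add_ac)
  show "comm_monoid (hurwitz :: (nat \<Rightarrow> 'k) ring)"
    by (rule comm_monoidI)
      (simp_all add: hmul_assoc s_hur_mult, rule hmul_commute)
qed (simp add: hmul_add_left)

lemma s_hur_hom: "s_hur \<in> ring_hom ring_of_type_algebra (hurwitz :: (nat \<Rightarrow> 'k::field) ring)"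
  by (rule ring_hom_memI) (simp_all add: s_hur_mult, auto simp: s_hur_def fun_eq_iff)

locale diff_field =
  fixes \<delta> :: "'k::field \<Rightarrow> 'k"
  assumes diff_field: "differential_field \<delta>"
begin

lemmas d_add = differential_fieldD(1)[OF diff_field]
  and d_mult = differential_fieldD(2)[OF diff_field]
  and d_0 [simp] = differential_fieldD(3)[OF diff_field]
  and d_1 [simp] = differential_fieldD(4)[OF diff_field]

abbreviation t :: "'k \<Rightarrow> nat \<Rightarrow> 'k" where
  "t \<equiv> t_hur \<delta>"

lemma t_at_0 [simp]: "t x 0 = x"
  by (simp add: t_hur_def)

lemma shift_t [simp]: "shift (t x) = t (\<delta> x)"
  by (simp add: t_hur_def fun_eq_iff funpow_swap1)

lemma t_Suc: "t x (Suc n) = t (\<delta> x) n"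
  by (simp add: t_hur_def funpow_swap1)

lemma t_add: "t (x + y) = t x + t y"
proof
  fix n show "t (x + y) n = (t x + t y) n"
    by (induction n arbitrary: x y) (simp_all add: t_Suc d_add)
qed

lemma t_mult: "t (x * y) = t x \<star> t y"
proof
  fix n show "t (x * y) n = (t x \<star> t y) n"
    by (induction n arbitrary: x y) (simp_all add: t_Suc hmul_Suc d_mult t_add)
qed

lemma t_const: "c \<in> constants \<delta> \<Longrightarrow> t c = s_hur c"
proof
  fix n assume "c \<in> constants \<delta>"
  moreover have "t 0 n = 0" for n
    by (induction n) (simp_all add: t_Suc)
  ultimately show "t c n = s_hur c n"
    by (cases n) (auto simp: t_Suc s_hur_def constants_def)
qed

lemma t_1: "t 1 = s_hur 1"
  by (rule t_const) (simp add: constants_def)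

lemma t_0 [simp]: "t 0 = 0"
  using t_const[of 0] by (simp add: constants_def s_hur_def fun_eq_iff)

lemma t_hom: "t \<in> ring_hom ring_of_type_algebra hurwitz"
  by (rule ring_hom_memI) (simp_all add: t_mult t_add t_1)

sublocale hurwitz: source_target_pair hurwitz \<delta> s_hur t
  by (intro source_target_pair.intro source_target_pair_axioms.intro cring_hurwitz s_hur_hom t_hom)
    (simp add: t_const)

text \<open>The action through \<open>t\<close> makes the Hurwitz series a vector space, so that spans and linear dependence
  are available.\<close>

sublocale H: vector_space "\<lambda>x \<alpha>. t x \<star> \<alpha>"
  by standard
    (simp_all add: hmul_add_left hmul_add_right t_add t_mult hmul_assoc t_1 s_hur_mult)

end

section \<open>Differential vector spaces\<close>

text \<open>Generation of the vector space by \<open>B\<close>, stated through closed subsets instead of linear combinations: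
  images under linear maps and tensor products then require no manipulation of finite sums.\<close>

definition spans :: "('k::field, 'm) dspace \<Rightarrow> 'm set \<Rightarrow> bool" where
  "spans M B \<longleftrightarrow> (\<forall>S \<subseteq> carrier M. B \<subseteq> S \<longrightarrow> \<zero>\<^bsub>M\<^esub> \<in> S \<longrightarrow> (\<forall>x\<in>S. \<forall>y\<in>S. x \<oplus>\<^bsub>M\<^esub> y \<in> S) \<longrightarrow>
     (\<forall>c. \<forall>x\<in>S. c \<odot>\<^bsub>M\<^esub> x \<in> S) \<longrightarrow> carrier M \<subseteq> S)"

text \<open>The linear combinations of \<open>B\<close> form a closed subset that contains \<open>B\<close>, and by induction
  on the number of summands every closed subset that contains \<open>B\<close> contains them.\<close>

lemma finite_dimensional_iff_spans:
  fixes M :: "('k::field, 'm) dspace"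
  assumes "Module.module (ring_of_type_algebra :: 'k ring) M"
  shows "finite_dimensional M \<longleftrightarrow> (\<exists>B. finite B \<and> B \<subseteq> carrier M \<and> spans M B)"
proof -
  interpret M: Module.module "ring_of_type_algebra :: 'k ring" M by fact
  have laws: "x \<odot>\<^bsub>M\<^esub> m \<in> carrier M" "(x + y) \<odot>\<^bsub>M\<^esub> m = x \<odot>\<^bsub>M\<^esub> m \<oplus>\<^bsub>M\<^esub> y \<odot>\<^bsub>M\<^esub> m" "(x * y) \<odot>\<^bsub>M\<^esub> m = x \<odot>\<^bsub>M\<^esub> (y \<odot>\<^bsub>M\<^esub> m)"
    "1 \<odot>\<^bsub>M\<^esub> m = m" "0 \<odot>\<^bsub>M\<^esub> m = \<zero>\<^bsub>M\<^esub>" if "m \<in> carrier M" for m x y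
    using that M.smult_closed[of x m] M.smult_l_distr[of x y m] M.smult_assoc1[of x y m]
      M.smult_one[of m] M.smult_l_null[of m] by simp_all
  have "(\<forall>v\<in>carrier M. \<exists>c. v = (\<Oplus>\<^bsub>M\<^esub>b\<in>B. c b \<odot>\<^bsub>M\<^esub> b)) \<longleftrightarrow> spans M B"
    if B: "finite B" "B \<subseteq> carrier M" for B
  proof
    assume *: "\<forall>v\<in>carrier M. \<exists>c. v = (\<Oplus>\<^bsub>M\<^esub>b\<in>B. c b \<odot>\<^bsub>M\<^esub> b)"
    show "spans M B"
      unfolding spans_def
    proof (intro allI impI)
      fix S assume S: "S \<subseteq> carrier M" "B \<subseteq> S" "\<zero>\<^bsub>M\<^esub> \<in> S" "\<forall>x\<in>S. \<forall>y\<in>S. x \<oplus>\<^bsub>M\<^esub> y \<in> S"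
        "\<forall>c. \<forall>x\<in>S. c \<odot>\<^bsub>M\<^esub> x \<in> S"
      have "(\<Oplus>\<^bsub>M\<^esub>b\<in>F. c b \<odot>\<^bsub>M\<^esub> b) \<in> S" if "finite F" "F \<subseteq> B" for c F
        using that
      proof (induction F rule: finite_induct)
        case (insert x F)
        then have "(\<Oplus>\<^bsub>M\<^esub>b\<in>insert x F. c b \<odot>\<^bsub>M\<^esub> b) = c x \<odot>\<^bsub>M\<^esub> x \<oplus>\<^bsub>M\<^esub> (\<Oplus>\<^bsub>M\<^esub>b\<in>F. c b \<odot>\<^bsub>M\<^esub> b)"
          using B by (intro M.M.finsum_insert) auto
        then show ?case
          using insert S by auto
      qed (use S in simp)
      from this[OF B(1) subset_refl] show "carrier M \<subseteq> S"
        using * by (metis subsetI)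
    qed
  next
    assume *: "spans M B"
    let ?S = "{v. \<exists>c. v = (\<Oplus>\<^bsub>M\<^esub>b\<in>B. c b \<odot>\<^bsub>M\<^esub> b)}"
    have cl: "(\<lambda>b. c b \<odot>\<^bsub>M\<^esub> b) \<in> B \<rightarrow> carrier M" for c :: "'m \<Rightarrow> 'k"
      using B by (auto simp: laws)
    have "carrier M \<subseteq> ?S"
    proof (rule *[unfolded spans_def, rule_format, of ?S])
      show "?S \<subseteq> carrier M"
        using M.M.finsum_closed[OF cl] by auto
      show "B \<subseteq> ?S"
      proof
        fix v assume v: "v \<in> B"
        have "(\<Oplus>\<^bsub>M\<^esub>b\<in>B. (if b = v then 1 else 0) \<odot>\<^bsub>M\<^esub> b) = (\<Oplus>\<^bsub>M\<^esub>b\<in>B. if v = b then b else \<zero>\<^bsub>M\<^esub>)"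
          using B by (intro M.M.finsum_cong') (auto simp: laws)
        also have "\<dots> = v"
          using B v by (subst M.M.add.finprod_singleton) auto
        finally show "v \<in> ?S"
          by (intro CollectI exI[of _ "\<lambda>b. if b = v then 1 else 0"]) (rule sym)
      qed
      have "(\<Oplus>\<^bsub>M\<^esub>b\<in>B. 0 \<odot>\<^bsub>M\<^esub> b) = \<zero>\<^bsub>M\<^esub>"
        using B by (intro M.M.add.finprod_one_eqI) (auto simp: laws)
      then show "\<zero>\<^bsub>M\<^esub> \<in> ?S"
        by (intro CollectI exI[of _ "\<lambda>b. 0"]) (rule sym)
    next
      fix x y assume "x \<in> ?S" "y \<in> ?S"
      then obtain c d where "x = (\<Oplus>\<^bsub>M\<^esub>b\<in>B. c b \<odot>\<^bsub>M\<^esub> b)" "y = (\<Oplus>\<^bsub>M\<^esub>b\<in>B. d b \<odot>\<^bsub>M\<^esub> b)" by auto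
      then have "x \<oplus>\<^bsub>M\<^esub> y = (\<Oplus>\<^bsub>M\<^esub>b\<in>B. c b \<odot>\<^bsub>M\<^esub> b \<oplus>\<^bsub>M\<^esub> d b \<odot>\<^bsub>M\<^esub> b)"
        by (simp add: M.M.finsum_addf[OF cl cl])
      also have "\<dots> = (\<Oplus>\<^bsub>M\<^esub>b\<in>B. (c b + d b) \<odot>\<^bsub>M\<^esub> b)"
        using B by (intro M.M.finsum_cong') (auto simp: laws)
      finally show "x \<oplus>\<^bsub>M\<^esub> y \<in> ?S"
        by (intro CollectI exI[of _ "\<lambda>b. c b + d b"])
    next
      fix x a assume "x \<in> ?S"
      then obtain c where x: "x = (\<Oplus>\<^bsub>M\<^esub>b\<in>B. c b \<odot>\<^bsub>M\<^esub> b)" by auto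
      have "a \<odot>\<^bsub>M\<^esub> x = (\<Oplus>\<^bsub>M\<^esub>b\<in>B. a \<odot>\<^bsub>M\<^esub> (c b \<odot>\<^bsub>M\<^esub> b))"
        unfolding x using M.finsum_smult_ldistr[OF B(1), of a "\<lambda>b. c b \<odot>\<^bsub>M\<^esub> b"] cl by simp
      also have "\<dots> = (\<Oplus>\<^bsub>M\<^esub>b\<in>B. (a * c b) \<odot>\<^bsub>M\<^esub> b)"
        using B by (intro M.M.finsum_cong') (auto simp: laws)
      finally show "a \<odot>\<^bsub>M\<^esub> x \<in> ?S"
        by (intro CollectI exI[of _ "\<lambda>b. a * c b"])
    qed
    then show "\<forall>v\<in>carrier M. \<exists>c. v = (\<Oplus>\<^bsub>M\<^esub>b\<in>B. c b \<odot>\<^bsub>M\<^esub> b)"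
      by (simp add: subset_iff)
  qed
  then show ?thesis
    unfolding finite_dimensional_def by (intro iff_exI conj_cong refl)
qed

locale diff_module = diff_field \<delta> + M: Module.module "ring_of_type_algebra :: 'k ring" M
  for \<delta> :: "'k::field \<Rightarrow> 'k" and M :: "('k, 'm) dspace" (structure) +
  assumes der_closed [simp]: "m \<in> carrier M \<Longrightarrow> der M m \<in> carrier M"
    and der_add: "m \<in> carrier M \<Longrightarrow> m' \<in> carrier M \<Longrightarrow> der M (m \<oplus> m') = der M m \<oplus> der M m'"
    and der_smult: "m \<in> carrier M \<Longrightarrow> der M (x \<odot> m) = x \<odot> der M m \<oplus> \<delta> x \<odot> m"
begin

lemma smult_closed' [simp]: "m \<in> carrier M \<Longrightarrow> x \<odot> m \<in> carrier M"
  by simp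

lemma smult_laws:
  "m \<in> carrier M \<Longrightarrow> (x + y) \<odot> m = x \<odot> m \<oplus> y \<odot> m"
  "m \<in> carrier M \<Longrightarrow> m' \<in> carrier M \<Longrightarrow> x \<odot> (m \<oplus> m') = x \<odot> m \<oplus> x \<odot> m'"
  "m \<in> carrier M \<Longrightarrow> (x * y) \<odot> m = x \<odot> (y \<odot> m)"
  "m \<in> carrier M \<Longrightarrow> 1 \<odot> m = m"
  "m \<in> carrier M \<Longrightarrow> 0 \<odot> m = \<zero>"
  using M.smult_l_distr[of x y m] M.smult_r_distr[of x m m'] M.smult_assoc1[of x y m]
    M.smult_one[of m] M.smult_l_null[of m] by simp_all

lemma der_pow_closed [simp]: "m \<in> carrier M \<Longrightarrow> (der M ^^ n) m \<in> carrier M"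
  by (induction n) simp_all

end

context diff_field
begin

lemma diff_space_iff: "diff_space \<delta> M \<longleftrightarrow> diff_module \<delta> M \<and> finite_dimensional M"
proof
  assume "diff_space \<delta> M"
  then show "diff_module \<delta> M \<and> finite_dimensional M"
    unfolding diff_space_def diff_module_def diff_module_axioms_def
    using diff_field_axioms by (simp add: Pi_iff)
next
  assume *: "diff_module \<delta> M \<and> finite_dimensional M"
  interpret diff_module \<delta> M
    using * by simp
  show "diff_space \<delta> M"
    unfolding diff_space_def
    using * M.module_axioms by (simp add: der_add der_smult constants_def smult_laws)
qed

lemma diff_spaceD: "diff_space \<delta> M \<Longrightarrow> diff_module \<delta> M"
  by (simp add: diff_space_iff)

text \<open>The preimage of a closed subset under a linear map is closed.\<close>

lemma spans_image:
  assumes "diff_module \<delta> M" "diff_module \<delta> N" "spans M B" "B \<subseteq> carrier M" "f \<in> dspace_homs M N"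
    and "f ` carrier M = carrier N"
  shows "spans N (f ` B)"
  unfolding spans_def
proof (intro allI impI)
  interpret M: diff_module \<delta> M by fact
  interpret N: diff_module \<delta> N by fact
  fix S assume S: "S \<subseteq> carrier N" "f ` B \<subseteq> S" "\<zero>\<^bsub>N\<^esub> \<in> S" "\<forall>x\<in>S. \<forall>y\<in>S. x \<oplus>\<^bsub>N\<^esub> y \<in> S"
    "\<forall>c. \<forall>x\<in>S. c \<odot>\<^bsub>N\<^esub> x \<in> S"
  have f: "f x \<in> carrier N" "y \<in> carrier M \<Longrightarrow> f (x \<oplus>\<^bsub>M\<^esub> y) = f x \<oplus>\<^bsub>N\<^esub> f y"
    "f (c \<odot>\<^bsub>M\<^esub> x) = c \<odot>\<^bsub>N\<^esub> f x" if "x \<in> carrier M" for x y c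
    using assms(5) that by (auto simp: dspace_homs_def)
  have f0: "f \<zero>\<^bsub>M\<^esub> = \<zero>\<^bsub>N\<^esub>"
    using f(3)[OF M.M.zero_closed, of 0] f(1)[OF M.M.zero_closed]
    by (simp add: M.smult_laws N.smult_laws)
  have "carrier M \<subseteq> {x \<in> carrier M. f x \<in> S}"
  proof (rule assms(3)[unfolded spans_def, rule_format])
    show "B \<subseteq> {x \<in> carrier M. f x \<in> S}"
      using S assms(4) by blast
    show "\<zero>\<^bsub>M\<^esub> \<in> {x \<in> carrier M. f x \<in> S}"
      using S(3) by (simp add: f0)
    show "x \<oplus>\<^bsub>M\<^esub> y \<in> {x \<in> carrier M. f x \<in> S}"
      if "x \<in> {x \<in> carrier M. f x \<in> S}" "y \<in> {x \<in> carrier M. f x \<in> S}" for x y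
      using that S(4) by (simp add: f)
    show "c \<odot>\<^bsub>M\<^esub> x \<in> {x \<in> carrier M. f x \<in> S}"
      if "x \<in> {x \<in> carrier M. f x \<in> S}" for c x
      using that S(5) by (simp add: f)
  qed blast
  then show "carrier N \<subseteq> S"
    by (auto simp flip: assms(6))
qed

end

context diff_field
begin

lemma dspace_homsD:
  assumes "f \<in> dspace_homs M N"
  shows "m \<in> carrier M \<Longrightarrow> f m \<in> carrier N"
    "m \<in> carrier M \<Longrightarrow> m' \<in> carrier M \<Longrightarrow> f (m \<oplus>\<^bsub>M\<^esub> m') = f m \<oplus>\<^bsub>N\<^esub> f m'"
    "m \<in> carrier M \<Longrightarrow> f (x \<odot>\<^bsub>M\<^esub> m) = x \<odot>\<^bsub>N\<^esub> f m"
    "m \<in> carrier M \<Longrightarrow> f (der M m) = der N (f m)"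
  using assms by (auto simp: dspace_homs_def)

lemma dspace_homsI:
  assumes "\<And>m. m \<in> carrier M \<Longrightarrow> f m \<in> carrier N"
    "\<And>m m'. m \<in> carrier M \<Longrightarrow> m' \<in> carrier M \<Longrightarrow> f (m \<oplus>\<^bsub>M\<^esub> m') = f m \<oplus>\<^bsub>N\<^esub> f m'"
    "\<And>m x. m \<in> carrier M \<Longrightarrow> f (x \<odot>\<^bsub>M\<^esub> m) = x \<odot>\<^bsub>N\<^esub> f m"
    "\<And>m. m \<in> carrier M \<Longrightarrow> f (der M m) = der N (f m)"
  shows "f \<in> dspace_homs M N"
  using assms by (auto simp: dspace_homs_def)

lemma dspace_homs_comp:
  assumes "f \<in> dspace_homs M N" "g \<in> dspace_homs N P"
  shows "g \<circ> f \<in> dspace_homs M P"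
  by (rule dspace_homsI) (simp_all add: dspace_homsD[OF assms(1)] dspace_homsD[OF assms(2)])

lemma dspace_isos_inv:
  assumes "diff_module \<delta> M" "g \<in> dspace_isos M N"
  shows "inv_into (carrier M) g \<in> dspace_isos N M"
proof -
  interpret M: diff_module \<delta> M by fact
  let ?h = "inv_into (carrier M) g"
  have g: "g \<in> dspace_homs M N" "bij_betw g (carrier M) (carrier N)"
    using assms by (auto simp: dspace_isos_def)
  have h: "n \<in> carrier N \<Longrightarrow> ?h n \<in> carrier M" "n \<in> carrier N \<Longrightarrow> g (?h n) = n" for n
    using bij_betw_apply[OF bij_betw_inv_into[OF g(2)]] bij_betw_inv_into_right[OF g(2)] by auto
  have eq: "?h n = m" if "m \<in> carrier M" "g m = n" for m n
    using bij_betw_inv_into_left[OF g(2)] that by auto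
  have "?h \<in> dspace_homs N M"
    by (rule dspace_homsI) (auto simp: h dspace_homsD[OF g(1)] intro!: eq)
  then show ?thesis
    using bij_betw_inv_into[OF g(2)] by (simp add: dspace_isos_def)
qed

text \<open>Every law holds in \<open>M\<close> because the injective map \<open>h\<close> carries it to the same law in
  \<open>N\<close>. This is used both to move a space into another type and to recognise \<open>M\<^sub>\<alpha>\<close>
  among the spaces of Hurwitz series.\<close>

lemma diff_space_transport:
  fixes M :: "('k, 'm) dspace" and N :: "('k, 'n) dspace"
  assumes N: "diff_space \<delta> N" and bij: "bij_betw h (carrier M) (carrier N)"
    and zero: "\<zero>\<^bsub>M\<^esub> \<in> carrier M" "h \<zero>\<^bsub>M\<^esub> = \<zero>\<^bsub>N\<^esub>"
    and add: "\<And>x y. x \<in> carrier M \<Longrightarrow> y \<in> carrier M \<Longrightarrow> x \<oplus>\<^bsub>M\<^esub> y \<in> carrier M"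
      "\<And>x y. x \<in> carrier M \<Longrightarrow> y \<in> carrier M \<Longrightarrow> h (x \<oplus>\<^bsub>M\<^esub> y) = h x \<oplus>\<^bsub>N\<^esub> h y"
    and smult: "\<And>c x. x \<in> carrier M \<Longrightarrow> c \<odot>\<^bsub>M\<^esub> x \<in> carrier M"
      "\<And>c x. x \<in> carrier M \<Longrightarrow> h (c \<odot>\<^bsub>M\<^esub> x) = c \<odot>\<^bsub>N\<^esub> h x"
    and der: "\<And>x. x \<in> carrier M \<Longrightarrow> der M x \<in> carrier M"
      "\<And>x. x \<in> carrier M \<Longrightarrow> h (der M x) = der N (h x)"
  shows "diff_space \<delta> M" "h \<in> dspace_isos M N"
proof -
  interpret N: diff_module \<delta> N by (rule diff_spaceD[OF N])
  have h: "x \<in> carrier M \<Longrightarrow> h x \<in> carrier N" for x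
    using bij bij_betw_apply by fastforce
  have eqI: "x = y" if "x \<in> carrier M" "y \<in> carrier M" "h x = h y" for x y
    using bij that by (auto simp: bij_betw_def dest: inj_onD)
  have surj: "\<exists>x\<in>carrier M. h x = y" if "y \<in> carrier N" for y
    using that unfolding bij_betw_imp_surj_on[OF bij, symmetric] by auto
  note [simp] = zero add smult der h
  interpret M: diff_module \<delta> M
  proof (intro diff_module.intro diff_module_axioms.intro diff_field_axioms moduleI)
    show "abelian_group M"
    proof (rule abelian_groupI)
      fix x assume x: "x \<in> carrier M"
      obtain y where "y \<in> carrier M" "h y = \<ominus>\<^bsub>N\<^esub> h x"
        using surj[of "\<ominus>\<^bsub>N\<^esub> h x"] x by auto
      then show "\<exists>y\<in>carrier M. y \<oplus>\<^bsub>M\<^esub> x = \<zero>\<^bsub>M\<^esub>"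
        using x by (intro bexI[of _ y] eqI) (simp_all add: N.M.l_neg)
      show "\<zero>\<^bsub>M\<^esub> \<oplus>\<^bsub>M\<^esub> x = x"
        by (rule eqI) (simp_all add: x)
    next
      fix x y assume xy: "x \<in> carrier M" "y \<in> carrier M"
      show "x \<oplus>\<^bsub>M\<^esub> y = y \<oplus>\<^bsub>M\<^esub> x"
        by (rule eqI) (simp_all add: xy N.M.a_comm)
      fix z assume z: "z \<in> carrier M"
      show "x \<oplus>\<^bsub>M\<^esub> y \<oplus>\<^bsub>M\<^esub> z = x \<oplus>\<^bsub>M\<^esub> (y \<oplus>\<^bsub>M\<^esub> z)"
        by (rule eqI) (simp_all add: xy z N.M.a_assoc)
    qed simp_all
  next
    fix m m' x assume m: "m \<in> carrier M" "m' \<in> carrier M"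
    show "der M (m \<oplus>\<^bsub>M\<^esub> m') = der M m \<oplus>\<^bsub>M\<^esub> der M m'"
      by (rule eqI) (simp_all add: m N.der_add)
    show "der M (x \<odot>\<^bsub>M\<^esub> m) = x \<odot>\<^bsub>M\<^esub> der M m \<oplus>\<^bsub>M\<^esub> \<delta> x \<odot>\<^bsub>M\<^esub> m" if "m \<in> carrier M" for m x
      by (rule eqI) (simp_all add: that N.der_smult)
  next
    fix x y :: 'k and m m' assume m: "m \<in> carrier M"
    show "(x \<oplus>\<^bsub>ring_of_type_algebra\<^esub> y) \<odot>\<^bsub>M\<^esub> m = x \<odot>\<^bsub>M\<^esub> m \<oplus>\<^bsub>M\<^esub> y \<odot>\<^bsub>M\<^esub> m"
      by (rule eqI) (simp_all add: m N.smult_laws)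
    show "(x \<otimes>\<^bsub>ring_of_type_algebra\<^esub> y) \<odot>\<^bsub>M\<^esub> m = x \<odot>\<^bsub>M\<^esub> (y \<odot>\<^bsub>M\<^esub> m)"
      by (rule eqI) (simp_all add: m N.smult_laws)
    show "\<one>\<^bsub>ring_of_type_algebra\<^esub> \<odot>\<^bsub>M\<^esub> m = m"
      by (rule eqI) (simp_all add: m N.smult_laws)
    assume m': "m' \<in> carrier M"
    show "x \<odot>\<^bsub>M\<^esub> (m \<oplus>\<^bsub>M\<^esub> m') = x \<odot>\<^bsub>M\<^esub> m \<oplus>\<^bsub>M\<^esub> x \<odot>\<^bsub>M\<^esub> m'"
      by (rule eqI) (simp_all add: m m' N.smult_laws)
  qed (auto intro: cring_from_type_algebra)
  show iso: "h \<in> dspace_isos M N"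
    using bij by (auto simp: dspace_isos_def intro: dspace_homsI)
  let ?g = "inv_into (carrier M) h"
  have g: "?g \<in> dspace_homs N M" "?g ` carrier N = carrier M"
    using dspace_isos_inv[OF M.diff_module_axioms iso] by (auto simp: dspace_isos_def bij_betw_def)
  obtain B where "finite B" "B \<subseteq> carrier N" "spans N B"
    using N finite_dimensional_iff_spans[OF N.M.module_axioms] by (auto simp: diff_space_iff)
  then have "spans M (?g ` B)" "finite (?g ` B)" "?g ` B \<subseteq> carrier M"
    using spans_image[OF N.diff_module_axioms M.diff_module_axioms _ _ g] g(2) by auto
  then show "diff_space \<delta> M"
    using finite_dimensional_iff_spans[OF M.M.module_axioms] M.diff_module_axioms
    by (auto simp: diff_space_iff)
qed

text \<open>Choose coefficients of every vector with respect to a finite generating set. They determine the vector, so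
  storing them in a polynomial injects the carrier into the type of polynomials, and the structure is transported along this
  injection.\<close>

lemma exists_copy:
  fixes M :: "('k, 'm) dspace"
  assumes M: "diff_space \<delta> M"
  obtains M' :: "('k, 'k poly) dspace" and g where "diff_space \<delta> M'" "g \<in> dspace_isos M' M"
proof -
  interpret M: diff_module \<delta> M by (rule diff_spaceD[OF M])
  obtain B where B: "finite B" "B \<subseteq> carrier M" "\<forall>v\<in>carrier M. \<exists>c. v = (\<Oplus>\<^bsub>M\<^esub>b\<in>B. c b \<odot>\<^bsub>M\<^esub> b)"
    using M unfolding diff_space_def finite_dimensional_def by auto
  then obtain c where c: "v = (\<Oplus>\<^bsub>M\<^esub>b\<in>B. c v b \<odot>\<^bsub>M\<^esub> b)" if "v \<in> carrier M" for v
    by metis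
  obtain e :: "'m \<Rightarrow> nat" where e: "inj_on e B"
    using finite_imp_inj_to_nat_seg[OF B(1)] by metis
  define j where "j v = (\<Sum>b\<in>B. Polynomial.monom (c v b) (e b))" for v
  have coeff_j: "Polynomial.coeff (j v) (e b) = c v b" if "b \<in> B" for v b
  proof -
    have "Polynomial.coeff (j v) (e b) = (\<Sum>b'\<in>B. if b' = b then c v b' else 0)"
      using e that by (auto simp: j_def coeff_sum inj_on_def intro!: sum.cong)
    then show ?thesis using B that by simp
  qed
  have inj: "inj_on j (carrier M)"
  proof (rule inj_onI)
    fix v w assume vw: "v \<in> carrier M" "w \<in> carrier M" "j v = j w"
    then have "c v b = c w b" if "b \<in> B" for b
      using coeff_j[OF that, of v] coeff_j[OF that, of w] by simp
    then have "(\<Oplus>\<^bsub>M\<^esub>b\<in>B. c v b \<odot>\<^bsub>M\<^esub> b) = (\<Oplus>\<^bsub>M\<^esub>b\<in>B. c w b \<odot>\<^bsub>M\<^esub> b)"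
      using B(2) by (intro M.M.finsum_cong') auto
    then show "v = w"
      using c vw by metis
  qed
  \<comment> \<open>the operations on the image of \<open>j\<close> are those of \<open>M\<close>, read through \<open>g\<close>\<close>
  define g where "g = inv_into (carrier M) j"
  have g: "bij_betw g (j ` carrier M) (carrier M)"
    unfolding g_def by (rule bij_betw_inv_into) (use inj in \<open>simp add: bij_betw_def\<close>)
  have gj: "g (j v) = v" if "v \<in> carrier M" for v
    using inj that by (simp add: g_def)
  define M' :: "('k, 'k poly) dspace" where "M' = \<lparr>carrier = j ` carrier M, monoid.mult = undefined,
    one = undefined, ring.zero = j \<zero>\<^bsub>M\<^esub>, ring.add = (\<lambda>a b. j (g a \<oplus>\<^bsub>M\<^esub> g b)),
    module.smult = (\<lambda>x a. j (x \<odot>\<^bsub>M\<^esub> g a)), der = (\<lambda>a. j (der M (g a)))\<rparr>"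
  have "diff_space \<delta> M'" "g \<in> dspace_isos M' M"
    by (rule diff_space_transport[OF M, of g], auto simp: M'_def g gj)+
  then show thesis by (rule that)
qed

lemma dualD:
  assumes "\<phi> \<in> dual M"
  shows "m \<in> carrier M \<Longrightarrow> m' \<in> carrier M \<Longrightarrow> \<phi> (m \<oplus>\<^bsub>M\<^esub> m') = \<phi> m + \<phi> m'"
    "m \<in> carrier M \<Longrightarrow> \<phi> (x \<odot>\<^bsub>M\<^esub> m) = x * \<phi> m"
    "\<phi> \<in> extensional (carrier M)"
  using assms by (auto simp: dual_def)

lemma dual_comp:
  assumes "diff_module \<delta> M" "f \<in> dspace_homs M N" "\<psi> \<in> dual N"
  shows "compose (carrier M) \<psi> f \<in> dual M"
proof -
  interpret M: diff_module \<delta> M by fact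
  show ?thesis
    by (auto simp: dual_def compose_def dspace_homsD[OF assms(2)] dualD[OF assms(3)])
qed

lemma dual_add:
  assumes "diff_module \<delta> M" "\<phi> \<in> dual M" "\<psi> \<in> dual M"
  shows "(\<lambda>m\<in>carrier M. \<phi> m + \<psi> m) \<in> dual M"
proof -
  interpret M: diff_module \<delta> M by fact
  show ?thesis
    by (auto simp: dual_def dualD[OF assms(2)] dualD[OF assms(3)] algebra_simps)
qed

end


section \<open>Classes in the ring of the finite dual\<close>

context diff_field
begin

lemma circ_relI_add:
  assumes "diff_space \<delta> M" "\<phi> \<in> dual M" "m \<in> carrier M" "m' \<in> carrier M"
  shows "frag_of (M, \<phi>, m \<oplus>\<^bsub>M\<^esub> m') - frag_of (M, \<phi>, m) - frag_of (M, \<phi>, m') \<in> circ_rels \<delta>"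
proof -
  have "frag_of (\<phi>, m \<oplus>\<^bsub>M\<^esub> m') - frag_of (\<phi>, m) - frag_of (\<phi>, m') \<in> summand_rels M"
    unfolding summand_rels_def tensor_rels_def using assms by blast
  then have "frag_extend (\<lambda>(\<phi>, m). frag_of (M, \<phi>, m))
      (frag_of (\<phi>, m \<oplus>\<^bsub>M\<^esub> m') - frag_of (\<phi>, m) - frag_of (\<phi>, m')) \<in> circ_rels \<delta>"
    unfolding circ_rels_def using assms(1) by (intro UnI1 UN_I imageI) auto
  then show ?thesis by (simp add: frag_extend_diff)
qed

lemma circ_relI_hom:
  assumes "diff_space \<delta> M" "diff_space \<delta> N" "\<psi> \<in> dual N" "f \<in> dspace_homs M N" "x \<in> carrier M"
  shows "frag_of (N, \<psi>, f x) - frag_of (M, compose (carrier M) \<psi> f, x) \<in> circ_rels \<delta>"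
  unfolding circ_rels_def using assms by blast

lemma circ_rels_cases:
  assumes "r \<in> circ_rels \<delta>"
  obtains (add_left) M \<phi> \<psi> m where "diff_space \<delta> M" "\<phi> \<in> dual M" "\<psi> \<in> dual M" "m \<in> carrier M"
      "r = frag_of (M, \<lambda>m\<in>carrier M. \<phi> m + \<psi> m, m) - frag_of (M, \<phi>, m) - frag_of (M, \<psi>, m)"
  | (add_right) M \<phi> m m' where "diff_space \<delta> M" "\<phi> \<in> dual M" "m \<in> carrier M" "m' \<in> carrier M"
      "r = frag_of (M, \<phi>, m \<oplus>\<^bsub>M\<^esub> m') - frag_of (M, \<phi>, m) - frag_of (M, \<phi>, m')"
  | (balance) M \<phi> f m where "diff_space \<delta> M" "\<phi> \<in> dual M" "f \<in> dspace_homs M M" "m \<in> carrier M"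
      "r = frag_of (M, compose (carrier M) \<phi> f, m) - frag_of (M, \<phi>, f m)"
  | (hom) M N \<psi> f x where "diff_space \<delta> M" "diff_space \<delta> N" "\<psi> \<in> dual N" "f \<in> dspace_homs M N"
      "x \<in> carrier M" "r = frag_of (N, \<psi>, f x) - frag_of (M, compose (carrier M) \<psi> f, x)"
proof -
  consider (1) M r' where "diff_space \<delta> M" "r' \<in> summand_rels M"
      "r = frag_extend (\<lambda>(\<phi>, m). frag_of (M, \<phi>, m)) r'"
    | (2) M N \<psi> f x where "diff_space \<delta> M" "diff_space \<delta> N" "\<psi> \<in> dual N" "f \<in> dspace_homs M N"
      "x \<in> carrier M" "r = frag_of (N, \<psi>, f x) - frag_of (M, compose (carrier M) \<psi> f, x)"
    using assms unfolding circ_rels_def by blast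
  then show thesis
  proof cases
    case 1
    from 1(2) consider
        \<phi> \<psi> m where "\<phi> \<in> dual M" "\<psi> \<in> dual M" "m \<in> carrier M"
          "r' = frag_of (\<lambda>m\<in>carrier M. \<phi> m + \<psi> m, m) - frag_of (\<phi>, m) - frag_of (\<psi>, m)"
      | \<phi> m m' where "\<phi> \<in> dual M" "m \<in> carrier M" "m' \<in> carrier M"
          "r' = frag_of (\<phi>, m \<oplus>\<^bsub>M\<^esub> m') - frag_of (\<phi>, m) - frag_of (\<phi>, m')"
      | \<phi> f m where "\<phi> \<in> dual M" "f \<in> dspace_homs M M" "m \<in> carrier M"
          "r' = frag_of (compose (carrier M) \<phi> f, m) - frag_of (\<phi>, f m)"
      unfolding summand_rels_def tensor_rels_def by blast
    then show thesis
    proof cases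
      case 1
      then show thesis
        using add_left[of M] \<open>diff_space \<delta> M\<close> \<open>r = _\<close> by (simp add: frag_extend_diff)
    next
      case 2
      then show thesis
        using add_right[of M] \<open>diff_space \<delta> M\<close> \<open>r = _\<close> by (simp add: frag_extend_diff)
    next
      case 3
      then show thesis
        using balance[of M] \<open>diff_space \<delta> M\<close> \<open>r = _\<close> by (simp add: frag_extend_diff)
    qed
  qed (rule hom)
qed

sublocale circ: presentation "circ_gens \<delta>" "circ_rels \<delta>"
proof
  fix r assume "r \<in> circ_rels \<delta>"
  then show "Poly_Mapping.keys r \<subseteq> circ_gens \<delta>"
  proof (cases rule: circ_rels_cases)
    case (add_left M \<phi> \<psi> m)
    then show ?thesis
      unfolding add_left(5) using dual_add[OF diff_spaceD]
      by (intro keys_diff_subset) (simp_all add: circ_gens_def)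
  next
    case (add_right M \<phi> m m')
    interpret M: diff_module \<delta> M by (rule diff_spaceD) fact
    show ?thesis
      unfolding add_right(5) using add_right
      by (intro keys_diff_subset) (simp_all add: circ_gens_def)
  next
    case (balance M \<phi> f m)
    then show ?thesis
      unfolding balance(5) using dual_comp[OF diff_spaceD] dspace_homsD(1)[OF balance(3)]
      by (intro keys_diff_subset) (simp_all add: circ_gens_def)
  next
    case (hom M N \<psi> f x)
    then show ?thesis
      unfolding hom(6) using dual_comp[OF diff_spaceD] dspace_homsD(1)[OF hom(4)]
      by (intro keys_diff_subset) (simp_all add: circ_gens_def)
  qed
qed

lemma circ_class_hom:
  assumes "diff_space \<delta> M" "diff_space \<delta> N" "\<psi> \<in> dual N" "f \<in> dspace_homs M N" "x \<in> carrier M"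
  shows "circ_class \<delta> (frag_of (N, \<psi>, f x)) =
    circ_class \<delta> (frag_of (M, compose (carrier M) \<psi> f, x))"
  by (simp add: circ.class_eq_iff circ.rel_incl circ_relI_hom assms)

text \<open>The inverse of the isomorphism \<open>g'\<close> turns \<open>g\<close> into a morphism \<open>M \<rightarrow>
  M'\<close>, and a defining relation for this morphism equates the two classes.\<close>

lemma circ_class_copies:
  fixes N :: "('k, 'n) dspace"
  assumes M: "diff_space \<delta> M" "g \<in> dspace_homs M N" "m \<in> carrier M"
    and M': "diff_space \<delta> M'" "g' \<in> dspace_isos M' N" "m' \<in> carrier M'"
    and \<phi>: "\<phi> \<in> dual N" "g m = g' m'"
  shows "circ_class \<delta> (frag_of (M, compose (carrier M) \<phi> g, m)) =
    circ_class \<delta> (frag_of (M', compose (carrier M') \<phi> g', m'))"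
proof -
  let ?h = "inv_into (carrier M') g' \<circ> g"
  have g': "g' \<in> dspace_homs M' N" "bij_betw g' (carrier M') (carrier N)"
    using M' by (simp_all add: dspace_isos_def)
  have h: "?h \<in> dspace_homs M M'"
    using dspace_isos_inv[OF diff_spaceD[OF M'(1)] M'(2)] M(2)
    by (intro dspace_homs_comp[of _ M N]) (simp_all add: dspace_isos_def)
  have "?h m = m'"
    using bij_betw_inv_into_left[OF g'(2) M'(3)] \<phi>(2) by simp
  moreover have "compose (carrier M) (compose (carrier M') \<phi> g') ?h = compose (carrier M) \<phi> g"
    using dspace_homsD(1)[OF h] dspace_homsD(1)[OF M(2)] bij_betw_inv_into_right[OF g'(2)]
    by (auto simp: compose_def fun_eq_iff)
  ultimately show ?thesis
    using circ_class_hom[OF M(1) M'(1) dual_comp[OF diff_spaceD[OF M'(1)] g'(1) \<phi>(1)] h M(3)]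
    by simp
qed

text \<open>The union in the definition of \<^const>\<open>tclass\<close> is over a single class.\<close>

lemma tclass_eq:
  fixes M :: "('k, 'm) dspace"
  assumes "diff_space \<delta> M'" "g \<in> dspace_isos M' M" "m \<in> carrier M'" "\<phi> \<in> dual M"
  shows "tclass \<delta> M \<phi> (g m) = circ_class \<delta> (frag_of (M', compose (carrier M') \<phi> g, m))"
proof -
  have "{circ_class \<delta> (frag_of (M'', compose (carrier M'') \<phi> g', m')) | M'' g' m'.
      diff_space \<delta> M'' \<and> g' \<in> dspace_isos M'' M \<and> m' \<in> carrier M'' \<and> g' m' = g m} =
    {circ_class \<delta> (frag_of (M', compose (carrier M') \<phi> g, m))}" (is "?A = {?c}")
  proof (intro equalityI subsetI)
    fix Z assume "Z \<in> ?A"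
    then obtain M'' g' m' where *: "diff_space \<delta> M''" "g' \<in> dspace_isos M'' M" "m' \<in> carrier M''"
      "g' m' = g m" "Z = circ_class \<delta> (frag_of (M'', compose (carrier M'') \<phi> g', m'))"
      by blast
    then show "Z \<in> {?c}"
      using circ_class_copies[of M'' g' M m' M' g m \<phi>] assms by (simp add: dspace_isos_def)
  qed (use assms in blast)
  then show ?thesis by (simp add: tclass_def)
qed

lemma tclass_obtain:
  fixes M :: "('k, 'm) dspace"
  assumes "diff_space \<delta> M" "m \<in> carrier M"
  obtains M' :: "('k, 'k poly) dspace" and g m' where "diff_space \<delta> M'" "g \<in> dspace_isos M' M"
    "m' \<in> carrier M'" "g m' = m"
    "\<forall>\<phi>\<in>dual M. tclass \<delta> M \<phi> m = circ_class \<delta> (frag_of (M', compose (carrier M') \<phi> g, m'))"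
proof -
  obtain M' :: "('k, 'k poly) dspace" and g where g: "diff_space \<delta> M'" "g \<in> dspace_isos M' M"
    using exists_copy[OF assms(1)] .
  then have "m \<in> g ` carrier M'"
    using assms(2) by (simp add: dspace_isos_def bij_betw_def)
  then obtain m' where m': "m' \<in> carrier M'" "g m' = m"
    by blast
  then show thesis
    using that[OF g m'] tclass_eq[OF g m'(1)] by blast
qed

text \<open>The defining relation of \<open>U\<^sup>\<circ>\<close>, extended from the universe of polynomials to spaces over
  arbitrary types. It lets spaces of Hurwitz series, tensor products and \<open>M\<^sub>\<alpha>\<close> be compared
  directly.\<close>

lemma tclass_hom:
  fixes M :: "('k, 'm) dspace" and N :: "('k, 'n) dspace"
  assumes M: "diff_space \<delta> M" and N: "diff_space \<delta> N" and \<psi>: "\<psi> \<in> dual N"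
    and f: "f \<in> dspace_homs M N" and x: "x \<in> carrier M"
  shows "tclass \<delta> N \<psi> (f x) = tclass \<delta> M (compose (carrier M) \<psi> f) x"
proof -
  obtain M' :: "('k, 'k poly) dspace" and g x' where M': "diff_space \<delta> M'" "g \<in> dspace_isos M' M"
    "x' \<in> carrier M'" "g x' = x"
    "\<forall>\<phi>\<in>dual M. tclass \<delta> M \<phi> x = circ_class \<delta> (frag_of (M', compose (carrier M') \<phi> g, x'))"
    using tclass_obtain[OF M x] .
  obtain N' :: "('k, 'k poly) dspace" and h y where N': "diff_space \<delta> N'" "h \<in> dspace_isos N' N"
    "y \<in> carrier N'" "h y = f x"
    "\<forall>\<phi>\<in>dual N. tclass \<delta> N \<phi> (f x) = circ_class \<delta> (frag_of (N', compose (carrier N') \<phi> h, y))"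
    using tclass_obtain[OF N dspace_homsD(1)[OF f x]] .
  have g: "g \<in> dspace_homs M' M"
    using M' by (simp add: dspace_isos_def)
  have "tclass \<delta> N \<psi> (f x) = circ_class \<delta> (frag_of (N', compose (carrier N') \<psi> h, y))"
    by (rule N'(5)[rule_format, OF \<psi>])
  also have "\<dots> = circ_class \<delta> (frag_of (M', compose (carrier M') \<psi> (f \<circ> g), x'))"
    using M' N' dspace_homs_comp[OF g f] \<psi> by (intro circ_class_copies[symmetric]) simp_all
  also have "compose (carrier M') \<psi> (f \<circ> g) =
      compose (carrier M') (compose (carrier M) \<psi> f) g"
    using dspace_homsD(1)[OF g] by (auto simp: compose_def fun_eq_iff)
  also have "circ_class \<delta> (frag_of (M', \<dots>, x')) = tclass \<delta> M (compose (carrier M) \<psi> f) x"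
    by (rule M'(5)[rule_format, OF dual_comp[OF diff_spaceD[OF M] f \<psi>], symmetric])
  finally show ?thesis .
qed

lemma tclass_diff:
  fixes M :: "('k, 'm) dspace"
  assumes M: "diff_space \<delta> M" and \<phi>: "\<phi> \<in> dual M" and m: "m \<in> carrier M" "m' \<in> carrier M"
    and x: "circ_class \<delta> x = tclass \<delta> M \<phi> m" and y: "circ_class \<delta> y = tclass \<delta> M \<phi> m'"
  shows "circ_class \<delta> (x - y) = tclass \<delta> M \<phi> (m \<ominus>\<^bsub>M\<^esub> m')"
proof -
  interpret M: diff_module \<delta> M by (rule diff_spaceD[OF M])
  obtain N :: "('k, 'k poly) dspace" and g where g: "diff_space \<delta> N" "g \<in> dspace_isos N M"
    using exists_copy[OF M] .
  interpret N: diff_module \<delta> N by (rule diff_spaceD[OF g(1)])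
  have g': "g \<in> dspace_homs N M" "g ` carrier N = carrier M"
    using g(2) by (auto simp: dspace_isos_def bij_betw_def)
  have "m \<ominus>\<^bsub>M\<^esub> m' \<in> g ` carrier N" "m' \<in> g ` carrier N"
    using m by (simp_all add: g'(2))
  then obtain a b where ab: "a \<in> carrier N" "b \<in> carrier N" "g a = m \<ominus>\<^bsub>M\<^esub> m'" "g b = m'"
    by force
  have "g (a \<oplus>\<^bsub>N\<^esub> b) = m \<ominus>\<^bsub>M\<^esub> m' \<oplus>\<^bsub>M\<^esub> m'"
    using ab by (simp add: dspace_homsD[OF g'(1)])
  also have "\<dots> = m"
    using m by (simp add: M.M.minus_eq M.M.a_assoc M.M.l_neg)
  finally have gab: "g (a \<oplus>\<^bsub>N\<^esub> b) = m" .
  define \<psi> where "\<psi> = compose (carrier N) \<phi> g"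
  have \<psi>: "\<psi> \<in> dual N"
    unfolding \<psi>_def by (rule dual_comp[OF N.diff_module_axioms g'(1) \<phi>])
  have tcl: "tclass \<delta> M \<phi> (g c) = circ_class \<delta> (frag_of (N, \<psi>, c))" if "c \<in> carrier N" for c
    unfolding \<psi>_def by (rule tclass_eq[OF g that \<phi>])
  have 1: "x - frag_of (N, \<psi>, a \<oplus>\<^bsub>N\<^esub> b) \<in> pres_rel (circ_gens \<delta>) (circ_rels \<delta>)"
    using tcl[of "a \<oplus>\<^bsub>N\<^esub> b"] ab x unfolding gab by (simp flip: circ.class_eq_iff)
  have 2: "y - frag_of (N, \<psi>, b) \<in> pres_rel (circ_gens \<delta>) (circ_rels \<delta>)"
    using tcl[of b] ab y by (simp flip: circ.class_eq_iff)
  have 3: "frag_of (N, \<psi>, a \<oplus>\<^bsub>N\<^esub> b) - frag_of (N, \<psi>, a) - frag_of (N, \<psi>, b)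
      \<in> pres_rel (circ_gens \<delta>) (circ_rels \<delta>)"
    by (intro circ.rel_incl circ_relI_add g \<psi> ab)
  have "(x - frag_of (N, \<psi>, a \<oplus>\<^bsub>N\<^esub> b)) - (y - frag_of (N, \<psi>, b)) +
      (frag_of (N, \<psi>, a \<oplus>\<^bsub>N\<^esub> b) - frag_of (N, \<psi>, a) - frag_of (N, \<psi>, b))
      \<in> pres_rel (circ_gens \<delta>) (circ_rels \<delta>)"
    by (rule circ.rel_add[OF circ.rel_diff[OF 1 2] 3])
  then have "(x - y) - frag_of (N, \<psi>, a) \<in> pres_rel (circ_gens \<delta>) (circ_rels \<delta>)"
    by (simp add: algebra_simps)
  then show ?thesis
    using tcl[OF ab(1)] ab by (simp add: circ.class_eq_iff)
qed

end

text \<open>The sequence that the isomorphism of the theorem attaches to the class of \<open>\<phi> \<otimes>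
  m\<close>.\<close>

definition orbit :: "('k::field, 'm) dspace \<Rightarrow> ('m \<Rightarrow> 'k) \<Rightarrow> 'm \<Rightarrow> nat \<Rightarrow> 'k" where
  "orbit M \<phi> m = (\<lambda>n. \<phi> ((der M ^^ n) m))"

lemma orbit_simps [simp]: "orbit M \<phi> m 0 = \<phi> m"
  by (simp add: orbit_def)

lemma orbit_Suc: "orbit M \<phi> m (Suc n) = orbit M \<phi> (der M m) n"
  by (simp add: orbit_def funpow_swap1)

lemma shift_orbit: "shift (orbit M \<phi> m) = orbit M \<phi> (der M m)"
  by (simp add: fun_eq_iff orbit_Suc)

lemma (in diff_module) orbit_add:
  assumes "\<phi> \<in> dual M" "m \<in> carrier M" "m' \<in> carrier M"
  shows "orbit M \<phi> (m \<oplus> m') = orbit M \<phi> m + orbit M \<phi> m'"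
proof
  fix n show "orbit M \<phi> (m \<oplus> m') n = (orbit M \<phi> m + orbit M \<phi> m') n"
    using assms(2-3)
    by (induction n arbitrary: m m') (simp_all add: orbit_Suc der_add dualD[OF assms(1)])
qed

lemma (in diff_module) orbit_smult:
  assumes "\<phi> \<in> dual M" "m \<in> carrier M"
  shows "orbit M \<phi> (x \<odot> m) = t x \<star> orbit M \<phi> m"
proof
  fix n show "orbit M \<phi> (x \<odot> m) n = (t x \<star> orbit M \<phi> m) n"
    using assms(2)
    by (induction n arbitrary: m x)
      (simp_all add: orbit_Suc der_smult hmul_Suc shift_orbit orbit_add[OF assms(1)]
        dualD[OF assms(1)])
qed

context diff_field
begin

lemma orbit_hom:
  assumes "diff_module \<delta> M" "f \<in> dspace_homs M N" "m \<in> carrier M"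
  shows "orbit M (compose (carrier M) \<psi> f) m = orbit N \<psi> (f m)"
proof
  interpret M: diff_module \<delta> M by fact
  fix n show "orbit M (compose (carrier M) \<psi> f) m n = orbit N \<psi> (f m) n"
    using assms(3)
    by (induction n arbitrary: m) (simp_all add: orbit_Suc compose_def dspace_homsD[OF assms(2)])
qed

lemma orbit_dual_add:
  assumes "diff_module \<delta> M" "m \<in> carrier M"
  shows "orbit M (\<lambda>m\<in>carrier M. \<phi> m + \<psi> m) m = orbit M \<phi> m + orbit M \<psi> m"
proof -
  interpret M: diff_module \<delta> M by fact
  show ?thesis using assms by (simp add: orbit_def fun_eq_iff)
qed

lemma hmul_zero_left [simp]: "0 \<star> \<alpha> = (0 :: nat \<Rightarrow> 'k)"
  using H.scale_zero_left[of \<alpha>] by simp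

text \<open>The composite of \<^const>\<open>zeta\<close> and \<^const>\<open>Phi\<close>, on representatives.\<close>

definition circ_seq :: "'k triple frag \<Rightarrow> nat \<Rightarrow> 'k" where
  "circ_seq x = (\<lambda>n. frag_sum (\<lambda>(M, \<phi>, m). orbit M \<phi> m n) x)"

lemma circ_seq_simps [simp]:
  "circ_seq 0 = 0" "circ_seq (x - y) = circ_seq x - circ_seq y"
  "circ_seq (x + y) = circ_seq x + circ_seq y"
  "circ_seq (frag_of (M, \<phi>, m)) = orbit M \<phi> m"
  by (simp_all add: circ_seq_def fun_eq_iff frag_sum_add frag_sum_diff)

text \<open>The orbit of \<open>m\<close> under \<open>\<phi>\<close> is biadditive, and a morphism can be moved from one
  argument to the other since it commutes with the differentials.\<close>

lemma circ_seq_rel: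
  assumes "r \<in> pres_rel (circ_gens \<delta>) (circ_rels \<delta>)"
  shows "circ_seq r = 0"
  using assms
proof (induction rule: circ.pres_rel_induct)
  case (incl r)
  then show ?case
  proof (cases rule: circ_rels_cases)
    case (add_left M \<phi> \<psi> m)
    then show ?thesis by (simp add: orbit_dual_add diff_spaceD)
  next
    case (add_right M \<phi> m m')
    then show ?thesis by (simp add: diff_module.orbit_add[OF diff_spaceD])
  next
    case (balance M \<phi> f m)
    then show ?thesis by (simp add: orbit_hom[where N = M] diff_spaceD)
  next
    case (hom M N \<psi> f x)
    then show ?thesis by (simp add: orbit_hom[where N = N] diff_spaceD)
  qed
qed simp_all


section \<open>Spaces of Hurwitz series\<close>

text \<open>The scalars act through \<open>t\<close>, and not pointwise: this is the structure for which orbit maps are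
  morphisms of differential spaces.\<close>

definition hspace :: "(nat \<Rightarrow> 'k) set \<Rightarrow> ('k, nat \<Rightarrow> 'k) dspace" where
  "hspace V = \<lparr>carrier = V, monoid.mult = undefined, one = undefined, ring.zero = 0,
     ring.add = (+), module.smult = (\<lambda>x \<alpha>. t x \<star> \<alpha>), der = shift\<rparr>"

definition eval0 :: "(nat \<Rightarrow> 'k) set \<Rightarrow> (nat \<Rightarrow> 'k) \<Rightarrow> 'k" where
  "eval0 V = (\<lambda>\<alpha>\<in>V. \<alpha> 0)"

abbreviation hsub :: "(nat \<Rightarrow> 'k) set \<Rightarrow> bool" where
  "hsub V \<equiv> diff_space \<delta> (hspace V)"

lemma hspace_simps [simp]:
  "carrier (hspace V) = V" "\<zero>\<^bsub>hspace V\<^esub> = 0" "\<alpha> \<oplus>\<^bsub>hspace V\<^esub> \<beta> = \<alpha> + \<beta>"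
  "x \<odot>\<^bsub>hspace V\<^esub> \<alpha> = t x \<star> \<alpha>" "der (hspace V) \<alpha> = shift \<alpha>"
  by (simp_all add: hspace_def)

lemma der_hspace: "der (hspace V) = shift"
  by (simp add: fun_eq_iff)

lemma spans_hspace: "H.subspace V \<Longrightarrow> B \<subseteq> V \<Longrightarrow> spans (hspace V) B \<longleftrightarrow> V = H.span B"
proof
  assume V: "H.subspace V" "B \<subseteq> V" and "spans (hspace V) B"
  have "V \<subseteq> H.span B"
    using \<open>spans (hspace V) B\<close>[unfolded spans_def, rule_format, of "H.span B"] V
    by (simp add: H.span_minimal H.span_superset H.span_zero H.span_add H.span_scale)
  then show "V = H.span B"
    using H.span_minimal[OF V(2,1)] by blast
next
  assume V: "H.subspace V" "B \<subseteq> V" and eq: "V = H.span B"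
  show "spans (hspace V) B"
    unfolding spans_def
  proof (intro allI impI)
    fix S assume S: "S \<subseteq> carrier (hspace V)" "B \<subseteq> S" "\<zero>\<^bsub>hspace V\<^esub> \<in> S"
      "\<forall>x\<in>S. \<forall>y\<in>S. x \<oplus>\<^bsub>hspace V\<^esub> y \<in> S" "\<forall>c. \<forall>x\<in>S. c \<odot>\<^bsub>hspace V\<^esub> x \<in> S"
    then have "H.subspace S"
      by (simp add: H.subspace_def)
    then show "carrier (hspace V) \<subseteq> S"
      using S(2) H.span_minimal[of B S] by (simp add: eq)
  qed
qed

lemma diff_module_hspace_iff:
  "diff_module \<delta> (hspace V) \<longleftrightarrow> H.subspace V \<and> (\<forall>\<alpha>\<in>V. shift \<alpha> \<in> V)"
proof
  assume "diff_module \<delta> (hspace V)"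
  then interpret V: diff_module \<delta> "hspace V" .
  show "H.subspace V \<and> (\<forall>\<alpha>\<in>V. shift \<alpha> \<in> V)"
    using V.M.M.zero_closed V.M.M.a_closed V.smult_closed' V.der_closed
    by (simp add: H.subspace_def)
next
  assume V: "H.subspace V \<and> (\<forall>\<alpha>\<in>V. shift \<alpha> \<in> V)"
  note [simp] = H.subspace_0[of V] H.subspace_add[of V] H.subspace_scale[of V] H.subspace_neg[of V]
  show "diff_module \<delta> (hspace V)"
  proof (intro diff_module.intro diff_module_axioms.intro diff_field_axioms moduleI)
    show "abelian_group (hspace V)"
    proof (rule abelian_groupI)
      fix \<alpha> assume "\<alpha> \<in> carrier (hspace V)"
      then show "\<exists>\<beta>\<in>carrier (hspace V). \<beta> \<oplus>\<^bsub>hspace V\<^esub> \<alpha> = \<zero>\<^bsub>hspace V\<^esub>"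
        using V by (intro bexI[of _ "- \<alpha>"]) simp_all
    qed (use V in \<open>simp_all add: add_ac\<close>)
  qed (use V in \<open>auto intro: cring_from_type_algebra simp: shift_hmul add.commute
      H.scale_left_distrib H.scale_right_distrib\<close>)
qed

lemma hsub_iff: "hsub V \<longleftrightarrow> (\<exists>B. finite B \<and> V = H.span B) \<and> (\<forall>\<alpha>\<in>V. shift \<alpha> \<in> V)"
proof
  assume V: "hsub V"
  interpret V: diff_module \<delta> "hspace V" by (rule diff_spaceD[OF V])
  have sub: "H.subspace V" "\<forall>\<alpha>\<in>V. shift \<alpha> \<in> V"
    using V.diff_module_axioms by (auto simp: diff_module_hspace_iff)
  obtain B where "finite B" "B \<subseteq> V" "spans (hspace V) B"
    using V finite_dimensional_iff_spans[OF V.M.module_axioms] by (auto simp: diff_space_iff)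
  then show "(\<exists>B. finite B \<and> V = H.span B) \<and> (\<forall>\<alpha>\<in>V. shift \<alpha> \<in> V)"
    using sub spans_hspace by blast
next
  assume "(\<exists>B. finite B \<and> V = H.span B) \<and> (\<forall>\<alpha>\<in>V. shift \<alpha> \<in> V)"
  then obtain B where B: "finite B" "V = H.span B" and V: "\<forall>\<alpha>\<in>V. shift \<alpha> \<in> V" by blast
  have "H.subspace V" "B \<subseteq> V"
    by (simp_all add: B H.span_superset)
  then have "diff_module \<delta> (hspace V)" "spans (hspace V) B"
    using V B by (simp_all add: diff_module_hspace_iff spans_hspace)
  then show "hsub V"
    using B(1) \<open>B \<subseteq> V\<close> finite_dimensional_iff_spans[of "hspace V"]
    by (auto simp: diff_space_iff diff_module_def)
qed

text \<open>By the derivation rule for the shift, stability under the shift passes from a generating set to its span.\<close>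

lemma hsub_span:
  assumes "finite B" "\<And>\<beta>. \<beta> \<in> B \<Longrightarrow> shift \<beta> \<in> H.span B"
  shows "hsub (H.span B)"
  unfolding hsub_iff
proof (intro conjI ballI)
  fix \<alpha> assume "\<alpha> \<in> H.span B"
  then show "shift \<alpha> \<in> H.span B"
  proof (induction rule: H.span_induct_alt)
    case (step c \<beta> \<gamma>)
    have "shift (t c \<star> \<beta> + \<gamma>) = (t (\<delta> c) \<star> \<beta> + t c \<star> shift \<beta>) + shift \<gamma>"
      by (simp only: shift_simps shift_hmul shift_t)
    also have "\<dots> \<in> H.span B"
      by (intro H.span_add H.span_scale H.span_base step assms(2))
    finally show ?case .
  qed (simp only: shift_simps H.span_zero)
qed (use assms in blast)

text \<open>The sum of two such spaces serves.\<close>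

lemma hsub_join:
  assumes "hsub V" "hsub W"
  obtains S where "hsub S" "V \<subseteq> S" "W \<subseteq> S"
proof -
  obtain B C where B: "finite B" "V = H.span B" "finite C" "W = H.span C"
    using assms unfolding hsub_iff by blast
  have sub: "V \<subseteq> H.span (B \<union> C)" "W \<subseteq> H.span (B \<union> C)"
    by (simp_all add: B H.span_mono)
  have "hsub (H.span (B \<union> C))"
  proof (rule hsub_span)
    fix \<beta> assume "\<beta> \<in> B \<union> C"
    then have "\<beta> \<in> V \<or> \<beta> \<in> W"
      by (auto simp: B H.span_base)
    then show "shift \<beta> \<in> H.span (B \<union> C)"
      using assms sub unfolding hsub_iff by blast
  qed (simp add: B)
  then show thesis
    using that sub by blast
qed

lemma eval0_dual: "hsub V \<Longrightarrow> eval0 V \<in> dual (hspace V)"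
  using diff_spaceD[of "hspace V"]
  by (auto simp: dual_def eval0_def diff_module_hspace_iff H.subspace_add H.subspace_scale)

lemma orbit_eval0:
  assumes "hsub V" "\<alpha> \<in> V"
  shows "orbit (hspace V) (eval0 V) \<alpha> = \<alpha>"
proof
  interpret V: diff_module \<delta> "hspace V" by (rule diff_spaceD) fact
  fix n
  have "(shift ^^ n) \<alpha> \<in> V"
    using V.der_pow_closed[of \<alpha> n] assms by (simp add: der_hspace)
  then show "orbit (hspace V) (eval0 V) \<alpha> n = \<alpha> n"
    by (simp add: orbit_def eval0_def der_hspace funpow_shift)
qed

text \<open>The orbit map sends \<open>M\<close> onto a space of Hurwitz series and turns \<open>\<phi>\<close> into
  evaluation at \<open>0\<close>. It is linear by the iterated Leibniz rule, and it commutes with the differentials since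
  applying \<open>\<partial>\<close> to \<open>m\<close> shifts its orbit.\<close>

lemma orbit_space:
  assumes M: "diff_space \<delta> M" and \<phi>: "\<phi> \<in> dual M"
  defines "V \<equiv> orbit M \<phi> ` carrier M"
  shows "diff_space \<delta> (hspace V)" "orbit M \<phi> \<in> dspace_homs M (hspace V)" "compose (carrier M) (eval0 V) (orbit M \<phi>) = \<phi>"
proof -
  interpret M: diff_module \<delta> M by (rule diff_spaceD[OF M])
  show hom: "orbit M \<phi> \<in> dspace_homs M (hspace V)"
    by (rule dspace_homsI) (auto simp: V_def M.orbit_add[OF \<phi>] M.orbit_smult[OF \<phi>] shift_orbit)
  have dmod: "diff_module \<delta> (hspace V)"
    unfolding diff_module_hspace_iff H.subspace_def
  proof (intro conjI ballI allI)
    have "orbit M \<phi> (0 \<odot>\<^bsub>M\<^esub> \<zero>\<^bsub>M\<^esub>) = 0"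
      using M.orbit_smult[OF \<phi> M.M.M.zero_closed, of 0] by simp
    moreover have "0 \<odot>\<^bsub>M\<^esub> \<zero>\<^bsub>M\<^esub> \<in> carrier M"
      by simp
    ultimately show "0 \<in> V"
      unfolding V_def by (metis imageI)
  next
    fix x \<alpha> assume "\<alpha> \<in> V"
    then show "t x \<star> \<alpha> \<in> V"
      by (auto simp: V_def simp flip: M.orbit_smult[OF \<phi>])
  next
    fix \<alpha> \<beta> assume "\<alpha> \<in> V" "\<beta> \<in> V"
    then show "\<alpha> + \<beta> \<in> V"
      by (auto simp: V_def simp flip: M.orbit_add[OF \<phi>])
  next
    fix \<alpha> assume "\<alpha> \<in> V"
    then show "shift \<alpha> \<in> V"
      by (auto simp: V_def shift_orbit)
  qed
  interpret V: diff_module \<delta> "hspace V" by (rule dmod)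
  obtain B where B: "finite B" "B \<subseteq> carrier M" "spans M B"
    using M finite_dimensional_iff_spans[OF M.M.module_axioms] by (auto simp: diff_space_iff)
  have "spans (hspace V) (orbit M \<phi> ` B)"
    by (rule spans_image[OF M.diff_module_axioms dmod B(3,2) hom]) (simp add: V_def)
  moreover have "finite (orbit M \<phi> ` B)" "orbit M \<phi> ` B \<subseteq> carrier (hspace V)"
    using B by (auto simp: V_def)
  ultimately show "hsub V"
    using finite_dimensional_iff_spans[OF V.M.module_axioms] dmod by (auto simp: diff_space_iff)
  show "compose (carrier M) (eval0 V) (orbit M \<phi>) = \<phi>"
    using dualD(3)[OF \<phi>] by (auto simp: compose_def eval0_def V_def fun_eq_iff extensional_def)
qed

lemma tclass_orbit:
  fixes M :: "('k, 'm) dspace"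
  assumes M: "diff_space \<delta> M" and \<phi>: "\<phi> \<in> dual M" and m: "m \<in> carrier M"
  obtains V where "hsub V" "orbit M \<phi> m \<in> V"
    "tclass \<delta> M \<phi> m = tclass \<delta> (hspace V) (eval0 V) (orbit M \<phi> m)"
proof -
  let ?V = "orbit M \<phi> ` carrier M"
  show thesis
    using that[of ?V] orbit_space[OF M \<phi>] m
      tclass_hom[OF M orbit_space(1)[OF M \<phi>] eval0_dual[OF orbit_space(1)[OF M \<phi>]]
        orbit_space(2)[OF M \<phi>] m] by simp
qed

text \<open>The inclusion is a morphism of differential spaces.\<close>

lemma tclass_eval0_mono:
  assumes "hsub V" "hsub W" "V \<subseteq> W" "\<alpha> \<in> V"
  shows "tclass \<delta> (hspace W) (eval0 W) \<alpha> = tclass \<delta> (hspace V) (eval0 V) \<alpha>"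
proof -
  have "(\<lambda>\<beta>. \<beta>) \<in> dspace_homs (hspace V) (hspace W)"
    using assms by (intro dspace_homsI) auto
  moreover have "compose V (eval0 W) (\<lambda>\<beta>. \<beta>) = eval0 V"
    using assms by (auto simp: compose_def eval0_def fun_eq_iff)
  ultimately show ?thesis
    using tclass_hom[OF assms(1,2) eval0_dual[OF assms(2)], of "\<lambda>\<beta>. \<beta>" \<alpha>] assms by simp
qed

lemma tclass_eval0_unique:
  assumes "hsub V" "hsub W" "\<alpha> \<in> V" "\<alpha> \<in> W"
  shows "tclass \<delta> (hspace V) (eval0 V) \<alpha> = tclass \<delta> (hspace W) (eval0 W) \<alpha>"
proof -
  obtain S where "hsub S" "V \<subseteq> S" "W \<subseteq> S"
    using hsub_join[OF assms(1,2)] .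
  then show ?thesis
    using tclass_eval0_mono[of V S \<alpha>] tclass_eval0_mono[of W S \<alpha>] assms by simp
qed

lemma circ_gens_iff:
  "(M, \<phi>, m) \<in> circ_gens \<delta> \<longleftrightarrow> diff_space \<delta> M \<and> \<phi> \<in> dual M \<and> m \<in> carrier M"
  by (simp add: circ_gens_def)

lemma tclass_self:
  assumes "diff_space \<delta> M" "\<phi> \<in> dual M" "m \<in> carrier M"
  shows "tclass \<delta> M \<phi> m = circ_class \<delta> (frag_of (M, \<phi>, m))"
proof -
  have "(\<lambda>x. x) \<in> dspace_isos M M"
    by (auto simp: dspace_isos_def dspace_homs_def bij_betw_def inj_on_def)
  moreover have "compose (carrier M) \<phi> (\<lambda>x. x) = \<phi>"
    using dualD(3)[OF assms(2)] by (auto simp: compose_def fun_eq_iff extensional_def)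
  ultimately show ?thesis
    using tclass_eq[OF assms(1) _ assms(3,2), of "\<lambda>x. x"] by simp
qed

lemma tclass_rep:
  fixes M :: "('k, 'm) dspace"
  assumes "diff_space \<delta> M" "\<phi> \<in> dual M" "m \<in> carrier M"
  obtains a where "a \<in> circ_gens \<delta>" "tclass \<delta> M \<phi> m = circ_class \<delta> (frag_of a)"
    "circ_seq (frag_of a) = orbit M \<phi> m"
proof -
  obtain M' :: "('k, 'k poly) dspace" and g m' where M': "diff_space \<delta> M'" "g \<in> dspace_isos M' M"
    "m' \<in> carrier M'" "g m' = m"
    "\<forall>\<phi>\<in>dual M. tclass \<delta> M \<phi> m = circ_class \<delta> (frag_of (M', compose (carrier M') \<phi> g, m'))"
    using tclass_obtain[OF assms(1,3)] .
  have g: "g \<in> dspace_homs M' M"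
    using M'(2) by (simp add: dspace_isos_def)
  show thesis
    using that[of "(M', compose (carrier M') \<phi> g, m')"] M' assms
      dual_comp[OF diff_spaceD[OF M'(1)] g assms(2)] orbit_hom[OF diff_spaceD[OF M'(1)] g M'(3), of \<phi>]
    by (simp add: circ_gens_iff)
qed

lemma hsub_0: "hsub {0}"
  using hsub_span[of "{}"] by simp

text \<open>The normal form in \<open>U\<^sup>\<circ>\<close>. Generators are handled by their orbit maps; for a difference,
  both normal forms are first moved into a common space of Hurwitz series, where \<open>ev\<^sub>0 \<otimes> \<alpha>\<close>
  is additive in \<open>\<alpha>\<close>.\<close>

lemma class_eq_eval0:
  assumes "Poly_Mapping.keys x \<subseteq> circ_gens \<delta>"
  shows "\<exists>V. hsub V \<and> circ_seq x \<in> V \<and> circ_class \<delta> x = tclass \<delta> (hspace V) (eval0 V) (circ_seq x)"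
  using assms
proof (induction x rule: frag_induction)
  case zero
  obtain a where a: "tclass \<delta> (hspace {0}) (eval0 {0}) 0 = circ_class \<delta> (frag_of a)"
    using tclass_rep[OF hsub_0 eval0_dual[OF hsub_0], of 0] by (metis hspace_simps(1) singletonI)
  interpret V: diff_module \<delta> "hspace {0}" by (rule diff_spaceD[OF hsub_0])
  have "0 \<ominus>\<^bsub>hspace {0}\<^esub> 0 = 0"
    using V.M.M.minus_closed[of 0 0] by simp
  then have "circ_class \<delta> 0 = tclass \<delta> (hspace {0}) (eval0 {0}) 0"
    using tclass_diff[OF hsub_0 eval0_dual[OF hsub_0] _ _ a[symmetric] a[symmetric]] by simp
  then show ?case
    using hsub_0 by (metis circ_seq_simps(1) singletonI)
next
  case (one a)
  obtain M \<phi> m where a: "a = (M, \<phi>, m)" by (cases a)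
  then have "diff_space \<delta> M" "\<phi> \<in> dual M" "m \<in> carrier M"
    using one by (auto simp: circ_gens_iff)
  from tclass_orbit[OF this] tclass_self[OF this] show ?case
    unfolding a circ_seq_simps by metis
next
  case (diff x y)
  then obtain V W where V: "hsub V" "circ_seq x \<in> V"
      "circ_class \<delta> x = tclass \<delta> (hspace V) (eval0 V) (circ_seq x)"
    and W: "hsub W" "circ_seq y \<in> W"
      "circ_class \<delta> y = tclass \<delta> (hspace W) (eval0 W) (circ_seq y)"
    by blast
  obtain S where S: "hsub S" "V \<subseteq> S" "W \<subseteq> S"
    using hsub_join[OF V(1) W(1)] .
  then have cX: "circ_seq x \<in> S" "circ_seq y \<in> S"
    using V W by auto
  interpret S: diff_module \<delta> "hspace S" by (rule diff_spaceD[OF S(1)])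
  have "\<ominus>\<^bsub>hspace S\<^esub> circ_seq y = - circ_seq y"
    using S.M.M.l_neg[of "circ_seq y"] cX by (simp add: eq_neg_iff_add_eq_0)
  then have eq: "circ_seq x \<ominus>\<^bsub>hspace S\<^esub> circ_seq y = circ_seq x - circ_seq y"
    by (simp add: S.M.M.minus_eq)
  have "circ_seq x - circ_seq y \<in> S"
    using S.M.M.minus_closed[of "circ_seq x" "circ_seq y"] cX by (simp add: eq)
  moreover have "circ_class \<delta> x = tclass \<delta> (hspace S) (eval0 S) (circ_seq x)"
    using tclass_eval0_mono[OF V(1) S(1,2) V(2)] V(3) by simp
  moreover have "circ_class \<delta> y = tclass \<delta> (hspace S) (eval0 S) (circ_seq y)"
    using tclass_eval0_mono[OF W(1) S(1,3) W(2)] W(3) by simp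
  ultimately show ?case
    using tclass_diff[OF S(1) eval0_dual[OF S(1)], of "circ_seq x" "circ_seq y" x y] S(1) cX
    unfolding circ_seq_simps eq hspace_simps by blast
qed

text \<open>Injectivity of the isomorphism: by the normal form, a class depends on its sequence alone.\<close>

lemma circ_class_eq_iff:
  assumes "Poly_Mapping.keys x \<subseteq> circ_gens \<delta>" "Poly_Mapping.keys y \<subseteq> circ_gens \<delta>"
  shows "circ_class \<delta> x = circ_class \<delta> y \<longleftrightarrow> circ_seq x = circ_seq y"
proof
  assume "circ_class \<delta> x = circ_class \<delta> y"
  then have "circ_seq (x - y) = 0"
    using circ_seq_rel by (simp only: circ.class_eq_iff)
  then show "circ_seq x = circ_seq y" by simp
next
  assume eq: "circ_seq x = circ_seq y"
  show "circ_class \<delta> x = circ_class \<delta> y"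
    using class_eq_eval0[OF assms(1)] class_eq_eval0[OF assms(2)] tclass_eval0_unique
    unfolding eq by metis
qed


section \<open>Differentially recursive sequences\<close>

lemma sum_fun_apply: "(\<Sum>i\<in>A. f i) n = (\<Sum>i\<in>A. f i n)" for f :: "'i \<Rightarrow> nat \<Rightarrow> 'k"
  by (induction A rule: infinite_finite_induct) simp_all

lemma Dlin_iff:
  "\<alpha> \<in> Dlin \<delta> \<longleftrightarrow> (\<exists>d c. c d \<noteq> 0 \<and> (\<Sum>i\<le>d. t (c i) \<star> (shift ^^ i) \<alpha>) = 0)"
  by (simp add: Dlin_def fun_eq_iff sum_fun_apply)

text \<open>A recursion of order \<open>d\<close> can be solved for \<open>\<N>\<^sup>d(\<alpha>)\<close>, because
  \<open>\<bbbK>\<close> is a field and \<open>t\<close> is a ring homomorphism. So the span of the first \<open>d\<close>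
  shifts is stable.\<close>

lemma Dlin_shift_pow:
  assumes "\<alpha> \<in> Dlin \<delta>"
  obtains B where "finite B" "hsub (H.span B)" "\<alpha> \<in> H.span B" "B \<subseteq> range (\<lambda>i. (shift ^^ i) \<alpha>)"
proof -
  obtain d c where c: "c d \<noteq> 0" "(\<Sum>i\<le>d. t (c i) \<star> (shift ^^ i) \<alpha>) = 0"
    using assms by (auto simp: Dlin_iff)
  define B where "B = (\<lambda>i. (shift ^^ i) \<alpha>) ` {..<d}"
  have "{..d} = insert d {..<d}" by auto
  then have "t (c d) \<star> (shift ^^ d) \<alpha> + (\<Sum>i<d. t (c i) \<star> (shift ^^ i) \<alpha>) = 0"
    using c(2) by simp
  \<comment> \<open>solve the recursion for the \<open>d\<close>-th shift\<close>
  then have "t (inverse (c d)) \<star> (t (c d) \<star> (shift ^^ d) \<alpha>) =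
      t (inverse (c d)) \<star> - (\<Sum>i<d. t (c i) \<star> (shift ^^ i) \<alpha>)"
    by (intro arg_cong[of _ _ "\<lambda>\<beta>. t (inverse (c d)) \<star> \<beta>"]) (simp only: eq_neg_iff_add_eq_0)
  then have "(shift ^^ d) \<alpha> = t (inverse (c d)) \<star> - (\<Sum>i<d. t (c i) \<star> (shift ^^ i) \<alpha>)"
    by (simp only: H.scale_scale left_inverse[OF c(1)] H.scale_one)
  also have "\<dots> \<in> H.span B"
    by (intro H.span_scale H.span_neg H.span_sum H.span_base) (simp add: B_def)
  finally have d: "(shift ^^ d) \<alpha> \<in> H.span B" .
  have le: "(shift ^^ i) \<alpha> \<in> H.span B" if "i \<le> d" for i
    using that d by (cases "i = d") (auto simp: B_def intro: H.span_base)
  have "hsub (H.span B)"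
  proof (rule hsub_span)
    fix \<beta> assume "\<beta> \<in> B"
    then obtain i where "i < d" "\<beta> = (shift ^^ i) \<alpha>"
      by (auto simp: B_def)
    then show "shift \<beta> \<in> H.span B"
      using le[of "Suc i"] by simp
  qed (simp add: B_def)
  then show thesis
    using that[of B] le[of 0] by (auto simp: B_def)
qed

text \<open>More shifts of \<open>\<alpha>\<close> than the dimension of \<open>V\<close> satisfy a linear relation; its last
  nonzero coefficient is the leading coefficient of a recursion.\<close>

lemma Dlin_if_mem_hsub:
  assumes "hsub V" "\<alpha> \<in> V"
  shows "\<alpha> \<in> Dlin \<delta>"
proof -
  obtain B where B: "finite B" "V = H.span B" and sh: "\<forall>\<alpha>\<in>V. shift \<alpha> \<in> V"
    using assms by (auto simp: hsub_iff)
  have pow: "(shift ^^ i) \<alpha> \<in> V" for i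
    by (induction i) (use assms sh in \<open>simp_all del: shift_simps(1)\<close>)
  define n where "n = card B"
  let ?f = "\<lambda>i. (shift ^^ i) \<alpha>"
  have "\<exists>c. (\<exists>i\<le>n. c i \<noteq> 0) \<and> (\<Sum>i\<le>n. t (c i) \<star> ?f i) = 0"
  proof (cases "inj_on ?f {..n}")
    case True
    have "H.dependent (?f ` {..n})"
    proof (rule ccontr)
      assume "\<not> H.dependent (?f ` {..n})"
      then have "card (?f ` {..n}) \<le> card B"
        using H.independent_span_bound[OF B(1), of "?f ` {..n}"] pow B by auto
      then show False
        using True by (simp add: card_image n_def)
    qed
    then obtain u where u: "\<exists>v\<in>?f ` {..n}. u v \<noteq> 0" "(\<Sum>v\<in>?f ` {..n}. t (u v) \<star> v) = 0"
      using H.dependent_finite[of "?f ` {..n}"] by auto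
    then show ?thesis
      by (intro exI[of _ "\<lambda>i. u (?f i)"]) (use True in \<open>auto simp: sum.reindex\<close>)
  next
    \<comment> \<open>two equal shifts already satisfy a relation, with coefficients \<open>1\<close> and \<open>-1\<close>\<close>
    case False
    then obtain i j where ij: "i \<le> n" "j \<le> n" "i \<noteq> j" "?f i = ?f j"
      by (auto simp: inj_on_def)
    let ?c = "\<lambda>k. if k = i then 1 else if k = j then - 1 else 0 :: 'k"
    have "(\<Sum>k\<le>n. t (?c k) \<star> ?f k) = (\<Sum>k\<in>{i, j}. t (?c k) \<star> ?f k)"
      using ij by (intro sum.mono_neutral_right) auto
    also have "\<dots> = 0"
      using ij(3,4) H.scale_minus_left[of 1 "?f j"] by simp
    finally show ?thesis
      using ij by (intro exI[of _ ?c]) auto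
  qed
  then obtain c where c: "\<exists>i\<le>n. c i \<noteq> 0" "(\<Sum>i\<le>n. t (c i) \<star> ?f i) = 0"
    by blast
  \<comment> \<open>cut the relation off at its last nonzero coefficient\<close>
  define d where "d = Max {i. i \<le> n \<and> c i \<noteq> 0}"
  have d: "d \<in> {i. i \<le> n \<and> c i \<noteq> 0}"
    unfolding d_def using c(1) by (intro Max_in) auto
  have max: "c i = 0" if "i \<le> n" "d < i" for i
    using Max_ge[of "{i. i \<le> n \<and> c i \<noteq> 0}" i] that by (fastforce simp: d_def)
  have "(\<Sum>i\<le>d. t (c i) \<star> ?f i) = (\<Sum>i\<le>n. t (c i) \<star> ?f i)"
    using d max by (intro sum.mono_neutral_left) auto
  then show ?thesis
    unfolding Dlin_iff using d c(2) by auto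
qed

lemma circ_seq_Dlin: "Poly_Mapping.keys x \<subseteq> circ_gens \<delta> \<Longrightarrow> circ_seq x \<in> Dlin \<delta>"
  using class_eq_eval0 Dlin_if_mem_hsub by blast

lemma Dlin_circ_seq:
  assumes "\<alpha> \<in> Dlin \<delta>"
  obtains x where "Poly_Mapping.keys x \<subseteq> circ_gens \<delta>" "circ_seq x = \<alpha>"
proof -
  obtain V where V: "hsub V" "\<alpha> \<in> V"
    using Dlin_shift_pow[OF assms] by metis
  obtain a where "a \<in> circ_gens \<delta>" "circ_seq (frag_of a) = \<alpha>"
    using tclass_rep[OF V(1) eval0_dual[OF V(1)], of \<alpha>] V
    by (metis hspace_simps(1) orbit_eval0)
  then show thesis
    using that[of "frag_of a"] by simp
qed

end

section \<open>Tensor products of differential vector spaces\<close>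

lemma frag_extend_frag_extend:
  "frag_extend f (frag_extend g z) = frag_extend (\<lambda>a. frag_extend f (g a)) z"
  using subset_UNIV[of "Poly_Mapping.keys z"]
  by (induction z rule: frag_induction) (simp_all add: frag_extend_diff)

locale diff_tensor = N: diff_module \<delta> N + M: diff_module \<delta> M
  for \<delta> :: "'k::field \<Rightarrow> 'k" and N :: "('k, 'n) dspace" and M :: "('k, 'm) dspace"
begin

abbreviation "TA \<equiv> carrier N \<times> carrier M"
abbreviation "TR \<equiv> tensor_dspace_rels N M"
abbreviation "T \<equiv> tensor_dspace N M"

lemma tensor_rels_cases:
  assumes "r \<in> TR"
  obtains (add_left) q q' p where "q \<in> carrier N" "q' \<in> carrier N" "p \<in> carrier M"
      "r = frag_of (q \<oplus>\<^bsub>N\<^esub> q', p) - frag_of (q, p) - frag_of (q', p)"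
  | (add_right) q p p' where "q \<in> carrier N" "p \<in> carrier M" "p' \<in> carrier M"
      "r = frag_of (q, p \<oplus>\<^bsub>M\<^esub> p') - frag_of (q, p) - frag_of (q, p')"
  | (balance) q y p where "q \<in> carrier N" "p \<in> carrier M"
      "r = frag_of (y \<odot>\<^bsub>N\<^esub> q, p) - frag_of (q, y \<odot>\<^bsub>M\<^esub> p)"
  using assms unfolding tensor_dspace_rels_def tensor_rels_def
  by (elim UnE CollectE exE conjE) (rule add_left add_right balance; assumption)+

lemma tensor_relI:
  "q \<in> carrier N \<Longrightarrow> q' \<in> carrier N \<Longrightarrow> p \<in> carrier M \<Longrightarrow>
    frag_of (q \<oplus>\<^bsub>N\<^esub> q', p) - frag_of (q, p) - frag_of (q', p) \<in> TR"
  "q \<in> carrier N \<Longrightarrow> p \<in> carrier M \<Longrightarrow> p' \<in> carrier M \<Longrightarrow>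
    frag_of (q, p \<oplus>\<^bsub>M\<^esub> p') - frag_of (q, p) - frag_of (q, p') \<in> TR"
  "q \<in> carrier N \<Longrightarrow> p \<in> carrier M \<Longrightarrow>
    frag_of (y \<odot>\<^bsub>N\<^esub> q, p) - frag_of (q, y \<odot>\<^bsub>M\<^esub> p) \<in> TR"
  unfolding tensor_dspace_rels_def tensor_rels_def by blast+

sublocale T: presentation TA TR
proof
  fix r assume "r \<in> TR"
  then show "Poly_Mapping.keys r \<subseteq> TA"
    by (cases rule: tensor_rels_cases) (simp_all add: keys_diff_subset)
qed

abbreviation tcl :: "('n \<times> 'm) frag \<Rightarrow> ('n \<times> 'm) frag set" where
  "tcl \<equiv> pres_class TA TR"

abbreviation gen_smult :: "'k \<Rightarrow> 'n \<times> 'm \<Rightarrow> ('n \<times> 'm) frag" where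
  "gen_smult x \<equiv> \<lambda>(q, p). frag_of (x \<odot>\<^bsub>N\<^esub> q, p)"

abbreviation gen_der :: "'n \<times> 'm \<Rightarrow> ('n \<times> 'm) frag" where
  "gen_der \<equiv> \<lambda>(q, p). frag_of (der N q, p) + frag_of (q, der M p)"

lemma gen_smult_rel:
  assumes "r \<in> TR"
  shows "frag_extend (gen_smult x) r \<in> pres_rel TA TR"
  using assms
proof (cases rule: tensor_rels_cases)
  case (add_left q q' p)
  then show ?thesis
    using T.rel_incl[OF tensor_relI(1)[of "x \<odot>\<^bsub>N\<^esub> q" "x \<odot>\<^bsub>N\<^esub> q'" p]]
    by (simp add: frag_extend_diff N.smult_laws)
next
  case (add_right q p p')
  then show ?thesis
    using T.rel_incl[OF tensor_relI(2)[of "x \<odot>\<^bsub>N\<^esub> q" p p']]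
    by (simp add: frag_extend_diff)
next
  case (balance q y p)
  then have "x \<odot>\<^bsub>N\<^esub> (y \<odot>\<^bsub>N\<^esub> q) = y \<odot>\<^bsub>N\<^esub> (x \<odot>\<^bsub>N\<^esub> q)"
    by (simp add: mult.commute flip: N.smult_laws(3))
  then show ?thesis
    using balance T.rel_incl[OF tensor_relI(3)[of "x \<odot>\<^bsub>N\<^esub> q" p y]]
    by (simp add: frag_extend_diff)
qed

text \<open>Only the sum of the two halves of the differential respects the balancing relation: the
  Leibniz rule produces the term \<open>\<delta> y\<close> once on each side of the tensor sign.\<close>

lemma gen_der_rel:
  assumes "r \<in> TR"
  shows "frag_extend gen_der r \<in> pres_rel TA TR"
  using assms
proof (cases rule: tensor_rels_cases)
  case (add_left q q' p)
  have "frag_extend gen_der r =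
      (frag_of (der N q \<oplus>\<^bsub>N\<^esub> der N q', p) - frag_of (der N q, p) - frag_of (der N q', p)) +
      (frag_of (q \<oplus>\<^bsub>N\<^esub> q', der M p) - frag_of (q, der M p) - frag_of (q', der M p))"
    using add_left by (simp add: frag_extend_diff N.der_add)
  also have "\<dots> \<in> pres_rel TA TR"
    using add_left by (intro T.rel_add[OF T.rel_incl T.rel_incl] tensor_relI) simp_all
  finally show ?thesis .
next
  case (add_right q p p')
  have "frag_extend gen_der r =
      (frag_of (der N q, p \<oplus>\<^bsub>M\<^esub> p') - frag_of (der N q, p) - frag_of (der N q, p')) +
      (frag_of (q, der M p \<oplus>\<^bsub>M\<^esub> der M p') - frag_of (q, der M p) - frag_of (q, der M p'))"
    using add_right by (simp add: frag_extend_diff M.der_add)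
  also have "\<dots> \<in> pres_rel TA TR"
    using add_right by (intro T.rel_add[OF T.rel_incl T.rel_incl] tensor_relI) simp_all
  finally show ?thesis .
next
  case (balance q y p)
  let ?a = "y \<odot>\<^bsub>N\<^esub> der N q" and ?b = "\<delta> y \<odot>\<^bsub>N\<^esub> q"
  let ?c = "y \<odot>\<^bsub>M\<^esub> der M p" and ?d = "\<delta> y \<odot>\<^bsub>M\<^esub> p"
  have 1: "frag_of (?a \<oplus>\<^bsub>N\<^esub> ?b, p) - frag_of (?a, p) - frag_of (?b, p) \<in> pres_rel TA TR"
    using balance by (intro T.rel_incl tensor_relI) auto
  have 2: "frag_of (q, ?c \<oplus>\<^bsub>M\<^esub> ?d) - frag_of (q, ?c) - frag_of (q, ?d) \<in> pres_rel TA TR"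
    using balance by (intro T.rel_incl tensor_relI) auto
  have 3: "frag_of (?a, p) - frag_of (der N q, y \<odot>\<^bsub>M\<^esub> p) \<in> pres_rel TA TR"
    using balance by (intro T.rel_incl tensor_relI) auto
  have 4: "frag_of (?b, p) - frag_of (q, ?d) \<in> pres_rel TA TR"
    using balance by (intro T.rel_incl tensor_relI) auto
  have 5: "frag_of (y \<odot>\<^bsub>N\<^esub> q, der M p) - frag_of (q, ?c) \<in> pres_rel TA TR"
    using balance by (intro T.rel_incl tensor_relI) auto
  have "frag_extend gen_der r = frag_of (?a \<oplus>\<^bsub>N\<^esub> ?b, p) + frag_of (y \<odot>\<^bsub>N\<^esub> q, der M p) -
      (frag_of (der N q, y \<odot>\<^bsub>M\<^esub> p) + frag_of (q, ?c \<oplus>\<^bsub>M\<^esub> ?d))"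
    using balance by (simp add: frag_extend_diff N.der_smult M.der_smult)
  also have "\<dots> = (frag_of (?a \<oplus>\<^bsub>N\<^esub> ?b, p) - frag_of (?a, p) - frag_of (?b, p)) -
      (frag_of (q, ?c \<oplus>\<^bsub>M\<^esub> ?d) - frag_of (q, ?c) - frag_of (q, ?d)) +
      (frag_of (?a, p) - frag_of (der N q, y \<odot>\<^bsub>M\<^esub> p)) + (frag_of (?b, p) - frag_of (q, ?d)) +
      (frag_of (y \<odot>\<^bsub>N\<^esub> q, der M p) - frag_of (q, ?c))"
    by (simp add: algebra_simps)
  also have "\<dots> \<in> pres_rel TA TR"
    by (rule T.rel_add[OF T.rel_add[OF T.rel_add[OF T.rel_diff[OF 1 2] 3] 4] 5])
  finally show ?thesis .
qed

lemma keys_gen_smult: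
  assumes "Poly_Mapping.keys z \<subseteq> TA"
  shows "Poly_Mapping.keys (frag_extend (gen_smult x) z) \<subseteq> TA"
  by (rule keys_frag_extend_subset[OF assms]) auto

lemma keys_gen_der:
  assumes "Poly_Mapping.keys z \<subseteq> TA"
  shows "Poly_Mapping.keys (frag_extend gen_der z) \<subseteq> TA"
proof (rule keys_frag_extend_subset[OF assms])
  fix a assume "a \<in> TA"
  then show "Poly_Mapping.keys (gen_der a) \<subseteq> TA"
    by (cases a) (simp add: keys_add_subset)
qed

lemma tensor_simps:
  "carrier T = tcl ` {z. Poly_Mapping.keys z \<subseteq> TA}" "\<zero>\<^bsub>T\<^esub> = tcl 0"
  "Poly_Mapping.keys z \<subseteq> TA \<Longrightarrow> Poly_Mapping.keys w \<subseteq> TA \<Longrightarrow> tcl z \<oplus>\<^bsub>T\<^esub> tcl w = tcl (z + w)"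
  "x \<odot>\<^bsub>T\<^esub> tcl z = tcl (frag_extend (gen_smult x) z)"
  "der T (tcl z) = tcl (frag_extend gen_der z)"
  using T.induced_frag_extend[OF T.presentation_axioms gen_smult_rel]
    T.induced_frag_extend[OF T.presentation_axioms gen_der_rel]
  by (simp_all add: tensor_dspace_def Let_def T.carrier_pres T.one_pres T.mult_pres)

lemma tcl_closed: "Poly_Mapping.keys z \<subseteq> TA \<Longrightarrow> tcl z \<in> carrier T"
  by (auto simp: tensor_simps)

lemma tcl_eqI:
  assumes "Poly_Mapping.keys z \<subseteq> TA" "\<And>q p. q \<in> carrier N \<Longrightarrow> p \<in> carrier M \<Longrightarrow>
    f (q, p) - g (q, p) \<in> pres_rel TA TR"
  shows "tcl (frag_extend f z) = tcl (frag_extend g z)"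
  unfolding T.class_eq_iff
  by (rule frag_extend_rel_cong[OF T.presentation_axioms assms(1)]) (use assms(2) in auto)

lemma abelian_group_tensor: "abelian_group T"
proof (rule abelian_groupI)
  fix Z assume "Z \<in> carrier T"
  then obtain z where z: "Z = tcl z" "Poly_Mapping.keys z \<subseteq> TA"
    by (auto simp: tensor_simps)
  then show "\<zero>\<^bsub>T\<^esub> \<oplus>\<^bsub>T\<^esub> Z = Z"
    by (simp add: tensor_simps)
  show "\<exists>W\<in>carrier T. W \<oplus>\<^bsub>T\<^esub> Z = \<zero>\<^bsub>T\<^esub>"
    using z by (intro bexI[of _ "tcl (- z)"]) (simp_all add: tensor_simps)
  fix W assume "W \<in> carrier T"
  then obtain w where w: "W = tcl w" "Poly_Mapping.keys w \<subseteq> TA"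
    by (auto simp: tensor_simps)
  show "Z \<oplus>\<^bsub>T\<^esub> W \<in> carrier T"
    using z w by (simp add: tensor_simps(3) tcl_closed keys_add_subset)
  show "Z \<oplus>\<^bsub>T\<^esub> W = W \<oplus>\<^bsub>T\<^esub> Z"
    using z w by (simp add: tensor_simps add.commute)
  fix V assume "V \<in> carrier T"
  then obtain v where v: "V = tcl v" "Poly_Mapping.keys v \<subseteq> TA"
    by (auto simp: tensor_simps)
  show "Z \<oplus>\<^bsub>T\<^esub> W \<oplus>\<^bsub>T\<^esub> V = Z \<oplus>\<^bsub>T\<^esub> (W \<oplus>\<^bsub>T\<^esub> V)"
    using z w v by (simp add: tensor_simps keys_add_subset add.assoc)
qed (auto simp: tensor_simps)

lemma diff_module_tensor: "diff_module \<delta> T"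
proof (intro diff_module.intro diff_module_axioms.intro N.diff_field_axioms moduleI)
  fix x y :: 'k and Z assume "Z \<in> carrier T"
  then obtain z where z: "Z = tcl z" "Poly_Mapping.keys z \<subseteq> TA"
    by (auto simp: tensor_simps)
  note keys = keys_gen_smult[OF z(2)] keys_gen_der[OF z(2)]
  show "x \<odot>\<^bsub>T\<^esub> Z \<in> carrier T"
    using z keys by (simp add: tensor_simps(4) tcl_closed)
  show "(x \<oplus>\<^bsub>ring_of_type_algebra\<^esub> y) \<odot>\<^bsub>T\<^esub> Z = x \<odot>\<^bsub>T\<^esub> Z \<oplus>\<^bsub>T\<^esub> y \<odot>\<^bsub>T\<^esub> Z"
  proof -
    have "tcl (frag_extend (gen_smult (x + y)) z) = tcl (frag_extend (\<lambda>a. gen_smult x a + gen_smult y a) z)"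
    proof (rule tcl_eqI[OF z(2)])
      fix q p assume "q \<in> carrier N" "p \<in> carrier M"
      then show "gen_smult (x + y) (q, p) - (gen_smult x (q, p) + gen_smult y (q, p)) \<in> pres_rel TA TR"
        using T.rel_incl[OF tensor_relI(1)[of "x \<odot>\<^bsub>N\<^esub> q" "y \<odot>\<^bsub>N\<^esub> q" p]]
        by (simp add: N.smult_laws diff_diff_eq)
    qed
    then show ?thesis
      using keys by (simp add: z tensor_simps frag_extend_plus)
  qed
  show "(x \<otimes>\<^bsub>ring_of_type_algebra\<^esub> y) \<odot>\<^bsub>T\<^esub> Z = x \<odot>\<^bsub>T\<^esub> (y \<odot>\<^bsub>T\<^esub> Z)"
  proof -
    have "tcl (frag_extend (gen_smult (x * y)) z) = tcl (frag_extend (\<lambda>a. frag_extend (gen_smult x) (gen_smult y a)) z)"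
      by (rule tcl_eqI[OF z(2)]) (simp add: N.smult_laws T.rel_zero)
    then show ?thesis
      by (simp add: z tensor_simps frag_extend_frag_extend)
  qed
  show "\<one>\<^bsub>ring_of_type_algebra\<^esub> \<odot>\<^bsub>T\<^esub> Z = Z"
  proof -
    have "tcl (frag_extend (gen_smult 1) z) = tcl (frag_extend frag_of z)"
      by (rule tcl_eqI[OF z(2)]) (simp add: N.smult_laws T.rel_zero)
    then show ?thesis
      by (simp add: z tensor_simps flip: frag_expansion)
  qed
  fix W assume "W \<in> carrier T"
  then obtain w where w: "W = tcl w" "Poly_Mapping.keys w \<subseteq> TA"
    by (auto simp: tensor_simps)
  show "x \<odot>\<^bsub>T\<^esub> (Z \<oplus>\<^bsub>T\<^esub> W) = x \<odot>\<^bsub>T\<^esub> Z \<oplus>\<^bsub>T\<^esub> x \<odot>\<^bsub>T\<^esub> W"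
    using keys keys_gen_smult[OF w(2)] by (simp add: z w tensor_simps frag_extend_add)
next
  fix x and Z assume "Z \<in> carrier T"
  then obtain z where z: "Z = tcl z" "Poly_Mapping.keys z \<subseteq> TA"
    by (auto simp: tensor_simps)
  note keys = keys_gen_smult[OF z(2)] keys_gen_der[OF z(2)]
  show "der T Z \<in> carrier T"
    using z keys by (simp add: tensor_simps(5) tcl_closed)
  have "tcl (frag_extend (\<lambda>a. frag_extend gen_der (gen_smult x a)) z) =
      tcl (frag_extend (\<lambda>a. frag_extend (gen_smult x) (gen_der a) + gen_smult (\<delta> x) a) z)"
  proof (rule tcl_eqI[OF z(2)])
    fix q p assume "q \<in> carrier N" "p \<in> carrier M"
    then show "frag_extend gen_der (gen_smult x (q, p)) - (frag_extend (gen_smult x) (gen_der (q, p)) + gen_smult (\<delta> x) (q, p))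
        \<in> pres_rel TA TR"
      using T.rel_incl[OF tensor_relI(1)[of "x \<odot>\<^bsub>N\<^esub> der N q" "\<delta> x \<odot>\<^bsub>N\<^esub> q" p]]
      by (simp add: N.der_smult frag_extend_add diff_diff_eq add_ac)
  qed
  then show "der T (x \<odot>\<^bsub>T\<^esub> Z) = x \<odot>\<^bsub>T\<^esub> der T Z \<oplus>\<^bsub>T\<^esub> \<delta> x \<odot>\<^bsub>T\<^esub> Z"
    using keys keys_gen_smult[OF keys_gen_der[OF z(2)]]
    by (simp add: z tensor_simps frag_extend_frag_extend frag_extend_plus)
next
  fix Z W assume "Z \<in> carrier T" "W \<in> carrier T"
  then obtain z w where z: "Z = tcl z" "Poly_Mapping.keys z \<subseteq> TA"
      and w: "W = tcl w" "Poly_Mapping.keys w \<subseteq> TA"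
    by (auto simp: tensor_simps)
  then show "der T (Z \<oplus>\<^bsub>T\<^esub> W) = der T Z \<oplus>\<^bsub>T\<^esub> der T W"
    using keys_gen_der[OF z(2)] keys_gen_der[OF w(2)] by (simp add: tensor_simps frag_extend_add)
qed (rule cring_from_type_algebra abelian_group_tensor)+

sublocale TM: diff_module \<delta> T
  by (rule diff_module_tensor)

abbreviation "ten \<equiv> tensor_elt N M"

lemma ten_simps:
  "q \<in> carrier N \<Longrightarrow> p \<in> carrier M \<Longrightarrow> ten q p \<in> carrier T"
  "q \<in> carrier N \<Longrightarrow> q' \<in> carrier N \<Longrightarrow> p \<in> carrier M \<Longrightarrow> ten (q \<oplus>\<^bsub>N\<^esub> q') p = ten q p \<oplus>\<^bsub>T\<^esub> ten q' p"
  "q \<in> carrier N \<Longrightarrow> p \<in> carrier M \<Longrightarrow> p' \<in> carrier M \<Longrightarrow> ten q (p \<oplus>\<^bsub>M\<^esub> p') = ten q p \<oplus>\<^bsub>T\<^esub> ten q p'"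
  "q \<in> carrier N \<Longrightarrow> p \<in> carrier M \<Longrightarrow> ten (x \<odot>\<^bsub>N\<^esub> q) p = x \<odot>\<^bsub>T\<^esub> ten q p"
  "q \<in> carrier N \<Longrightarrow> p \<in> carrier M \<Longrightarrow> ten q (x \<odot>\<^bsub>M\<^esub> p) = x \<odot>\<^bsub>T\<^esub> ten q p"
  "q \<in> carrier N \<Longrightarrow> p \<in> carrier M \<Longrightarrow> der T (ten q p) = ten (der N q) p \<oplus>\<^bsub>T\<^esub> ten q (der M p)"
proof -
  show ten_smult: "ten (x \<odot>\<^bsub>N\<^esub> q) p = x \<odot>\<^bsub>T\<^esub> ten q p" for x q p
    by (simp add: tensor_elt_def tensor_simps)
  assume q: "q \<in> carrier N"
  {
    fix q' p assume q': "q' \<in> carrier N" and p: "p \<in> carrier M"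
    show "ten (q \<oplus>\<^bsub>N\<^esub> q') p = ten q p \<oplus>\<^bsub>T\<^esub> ten q' p"
      using T.rel_incl[OF tensor_relI(1)[OF q q' p]] q q' p
      by (simp add: tensor_elt_def tensor_simps T.class_eq_iff diff_diff_eq)
  next
    fix p p' assume p: "p \<in> carrier M" and p': "p' \<in> carrier M"
    show "ten q (p \<oplus>\<^bsub>M\<^esub> p') = ten q p \<oplus>\<^bsub>T\<^esub> ten q p'"
      using T.rel_incl[OF tensor_relI(2)[OF q p p']] q p p'
      by (simp add: tensor_elt_def tensor_simps T.class_eq_iff diff_diff_eq)
  next
    assume p: "p \<in> carrier M"
    show "ten q p \<in> carrier T"
      using q p by (simp add: tensor_elt_def tcl_closed)
    have "tcl (frag_of (x \<odot>\<^bsub>N\<^esub> q, p)) = tcl (frag_of (q, x \<odot>\<^bsub>M\<^esub> p))"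
      using T.rel_incl[OF tensor_relI(3)[OF q p]] by (simp only: T.class_eq_iff)
    then show "ten q (x \<odot>\<^bsub>M\<^esub> p) = x \<odot>\<^bsub>T\<^esub> ten q p"
      by (simp add: tensor_elt_def tensor_simps)
    show "der T (ten q p) = ten (der N q) p \<oplus>\<^bsub>T\<^esub> ten q (der M p)"
      using q p by (simp add: tensor_elt_def tensor_simps)
  }
qed

lemma tensor_induct [consumes 1]:
  assumes Z: "Z \<in> carrier T" and P: "P \<zero>\<^bsub>T\<^esub>" "\<And>q p. q \<in> carrier N \<Longrightarrow> p \<in> carrier M \<Longrightarrow> P (ten q p)"
    "\<And>Z W. Z \<in> carrier T \<Longrightarrow> W \<in> carrier T \<Longrightarrow> P Z \<Longrightarrow> P W \<Longrightarrow> P (Z \<oplus>\<^bsub>T\<^esub> W)"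
    "\<And>x Z. Z \<in> carrier T \<Longrightarrow> P Z \<Longrightarrow> P (x \<odot>\<^bsub>T\<^esub> Z)"
  shows "P Z"
proof -
  obtain z where z: "Z = tcl z" "Poly_Mapping.keys z \<subseteq> TA"
    using Z by (auto simp: tensor_simps)
  have "Poly_Mapping.keys z \<subseteq> TA \<and> P (tcl z)"
    using z(2)
  proof (induction z rule: frag_induction)
    case zero
    then show ?case using P(1) by (simp add: tensor_simps)
  next
    case (one a)
    then show ?case using P(2)[of "fst a" "snd a"] by (auto simp: tensor_elt_def)
  next
    case (diff z w)
    have neg: "tcl (- w) = (- 1) \<odot>\<^bsub>T\<^esub> tcl w"
    proof -
      have w: "tcl w \<in> carrier T" "tcl (- w) \<in> carrier T"
        using diff by (simp_all add: tcl_closed)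
      have "((- 1) + 1) \<odot>\<^bsub>T\<^esub> tcl w = \<zero>\<^bsub>T\<^esub>"
        using w by (simp add: TM.smult_laws)
      then have "(- 1) \<odot>\<^bsub>T\<^esub> tcl w \<oplus>\<^bsub>T\<^esub> tcl w = \<zero>\<^bsub>T\<^esub>"
        using w by (simp only: TM.smult_laws)
      moreover have "tcl (- w) \<oplus>\<^bsub>T\<^esub> tcl w = \<zero>\<^bsub>T\<^esub>"
        using diff by (simp add: tensor_simps)
      ultimately show ?thesis
        using w by (metis TM.M.M.minus_equality TM.smult_closed')
    qed
    have "tcl (z - w) = tcl z \<oplus>\<^bsub>T\<^esub> tcl (- w)"
      using diff by (simp add: tensor_simps)
    then show ?case
      using diff P(3)[of "tcl z" "tcl (- w)"] P(4)[of "tcl w" "- 1"] tcl_closed[of z]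
        tcl_closed[of "- w"] tcl_closed[of w]
      by (simp add: neg keys_diff_subset)
  qed
  then show ?thesis by (simp add: z)
qed

text \<open>A closed set that contains the tensors of generators contains \<open>q \<otimes> p\<close> for \<open>p\<close> a
  generator and \<open>q\<close> arbitrary, since \<open>q \<otimes> p\<close> is linear in \<open>q\<close>; then it
  contains all \<open>q \<otimes> p\<close>, since this is linear in \<open>p\<close>.\<close>

lemma finite_dimensional_tensor:
  assumes "finite_dimensional N" "finite_dimensional M"
  shows "finite_dimensional T"
proof -
  obtain B where B: "finite B" "B \<subseteq> carrier N" "spans N B"
    using assms(1) finite_dimensional_iff_spans[OF N.M.module_axioms] by blast
  obtain C where C: "finite C" "C \<subseteq> carrier M" "spans M C"
    using assms(2) finite_dimensional_iff_spans[OF M.M.module_axioms] by blast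
  let ?D = "case_prod ten ` (B \<times> C)"
  have "spans T ?D"
    unfolding spans_def
  proof (intro allI impI)
    fix S assume S: "S \<subseteq> carrier T" "?D \<subseteq> S" "\<zero>\<^bsub>T\<^esub> \<in> S" "\<forall>x\<in>S. \<forall>y\<in>S. x \<oplus>\<^bsub>T\<^esub> y \<in> S"
      "\<forall>c. \<forall>x\<in>S. c \<odot>\<^bsub>T\<^esub> x \<in> S"
    have ten0: "p \<in> carrier M \<Longrightarrow> ten \<zero>\<^bsub>N\<^esub> p = \<zero>\<^bsub>T\<^esub>"
      "q \<in> carrier N \<Longrightarrow> ten q \<zero>\<^bsub>M\<^esub> = \<zero>\<^bsub>T\<^esub>" for p q
      using ten_simps(4)[of "\<zero>\<^bsub>N\<^esub>" p 0] ten_simps(5)[of q "\<zero>\<^bsub>M\<^esub>" 0] ten_simps(1)[of q "\<zero>\<^bsub>M\<^esub>"]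
        ten_simps(1)[of "\<zero>\<^bsub>N\<^esub>" p]
      by (simp_all add: N.smult_laws M.smult_laws TM.smult_laws)
    have 1: "ten q p \<in> S" if p: "p \<in> C" and q: "q \<in> carrier N" for p q
    proof -
      have p': "p \<in> carrier M" using p C by auto
      have "carrier N \<subseteq> {q \<in> carrier N. ten q p \<in> S}"
      proof (rule B(3)[unfolded spans_def, rule_format])
        show "B \<subseteq> {q \<in> carrier N. ten q p \<in> S}"
          using B(2) S(2) p by auto
      qed (use p' S(3-5) in \<open>auto simp: ten0 ten_simps\<close>)
      then show ?thesis using q by auto
    qed
    have 2: "ten q p \<in> S" if p: "p \<in> carrier M" and q: "q \<in> carrier N" for p q
    proof -
      have "carrier M \<subseteq> {p \<in> carrier M. ten q p \<in> S}"
      proof (rule C(3)[unfolded spans_def, rule_format])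
        show "C \<subseteq> {p \<in> carrier M. ten q p \<in> S}"
          using C(2) 1 q by auto
      qed (use q S(3-5) in \<open>auto simp: ten0 ten_simps\<close>)
      then show ?thesis using p by auto
    qed
    show "carrier T \<subseteq> S"
    proof
      fix Z assume "Z \<in> carrier T"
      then show "Z \<in> S"
        by (induction rule: tensor_induct) (use S(3-5) 2 in auto)
    qed
  qed
  moreover have "finite ?D" "?D \<subseteq> carrier T"
    using B C by (auto intro!: ten_simps(1))
  ultimately show ?thesis
    using finite_dimensional_iff_spans[OF TM.M.module_axioms] by blast
qed

context
  fixes \<psi> \<phi>
  assumes \<psi>: "\<psi> \<in> dual N" and \<phi>: "\<phi> \<in> dual M"
begin

abbreviation "dval \<equiv> \<lambda>(q, p). \<phi> (\<psi> q \<odot>\<^bsub>M\<^esub> p)"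

lemma dval_rel:
  assumes "r \<in> TR"
  shows "frag_sum dval r = 0"
  using assms
  by (cases rule: tensor_rels_cases)
    (simp_all add: frag_sum_diff N.dualD[OF \<psi>] N.dualD[OF \<phi>] distrib_left distrib_right mult.left_commute)

lemma diamond_tcl:
  assumes "Poly_Mapping.keys z \<subseteq> TA"
  shows "diamond N M \<psi> \<phi> (tcl z) = frag_sum dval z"
proof -
  have "induced (frag_sum dval) (tcl z) = frag_sum dval z"
    by (rule T.induced_class) (simp add: frag_sum_add T.frag_sum_rel dval_rel)
  then show ?thesis
    using tcl_closed[OF assms] by (simp add: diamond_def)
qed

lemma diamond_dual: "diamond N M \<psi> \<phi> \<in> dual T"
  unfolding dual_def
proof (intro CollectI conjI ballI allI)
  show "diamond N M \<psi> \<phi> \<in> extensional (carrier T)"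
    by (simp add: diamond_def)
  fix Z assume "Z \<in> carrier T"
  then obtain z where z: "Z = tcl z" "Poly_Mapping.keys z \<subseteq> TA"
    by (auto simp: tensor_simps)
  have "frag_sum dval (frag_extend (gen_smult x) z) = frag_sum dval z * x" for x
    using z(2)
    by (induction z rule: frag_induction)
      (auto simp: frag_extend_diff frag_sum_diff N.dualD[OF \<psi>] N.dualD[OF \<phi>] algebra_simps)
  then show "diamond N M \<psi> \<phi> (x \<odot>\<^bsub>T\<^esub> Z) = diamond N M \<psi> \<phi> Z * x" for x
    using z keys_gen_smult[OF z(2)] by (simp add: tensor_simps diamond_tcl)
  fix W assume "W \<in> carrier T"
  then obtain w where w: "W = tcl w" "Poly_Mapping.keys w \<subseteq> TA"
    by (auto simp: tensor_simps)
  show "diamond N M \<psi> \<phi> (Z \<oplus>\<^bsub>T\<^esub> W) = diamond N M \<psi> \<phi> Z + diamond N M \<psi> \<phi> W"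
    using z w by (simp add: tensor_simps diamond_tcl keys_add_subset frag_sum_add)
qed

lemma diamond_ten: "q \<in> carrier N \<Longrightarrow> p \<in> carrier M \<Longrightarrow> diamond N M \<psi> \<phi> (ten q p) = \<psi> q * \<phi> p"
  by (simp add: tensor_elt_def diamond_tcl N.dualD[OF \<phi>])

text \<open>Evaluating a tensor product along the powers of the differential is the Hurwitz product:
  both sides satisfy the Leibniz rule.\<close>

lemma orbit_diamond:
  assumes "q \<in> carrier N" "p \<in> carrier M"
  shows "orbit T (diamond N M \<psi> \<phi>) (ten q p) = orbit N \<psi> q \<star> orbit M \<phi> p"
proof
  fix n show "orbit T (diamond N M \<psi> \<phi>) (ten q p) n = (orbit N \<psi> q \<star> orbit M \<phi> p) n"
    using assms
  proof (induction n arbitrary: q p)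
    case 0
    then show ?case by (simp add: diamond_ten)
  next
    case (Suc n)
    then show ?case
      using TM.orbit_add[OF diamond_dual, of "ten (der N q) p" "ten q (der M p)"]
      by (simp add: orbit_Suc hmul_Suc shift_orbit ten_simps)
  qed
qed

end

end

section \<open>Rings embedded in the Hurwitz series\<close>

text \<open>A structure with operations that \<open>f\<close> maps injectively and compatibly to Hurwitz series. The ring
  laws of \<open>R\<close> follow by applying \<open>f\<close>. The maps \<open>s\<close> and \<open>tt\<close> are the
  source and the target of \<open>R\<close>.\<close>

locale hurwitz_embedding = diff_field \<delta>
  for \<delta> :: "'k::field \<Rightarrow> 'k" +
  fixes R :: "'r ring" (structure) and f :: "'r \<Rightarrow> nat \<Rightarrow> 'k" and s tt :: "'k \<Rightarrow> 'r"
  assumes inj: "inj_on f (carrier R)"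
    and one: "\<one> \<in> carrier R" "f \<one> = s_hur 1"
    and zero: "\<zero> \<in> carrier R" "f \<zero> = 0"
    and add: "a \<in> carrier R \<Longrightarrow> b \<in> carrier R \<Longrightarrow> a \<oplus> b \<in> carrier R"
      "a \<in> carrier R \<Longrightarrow> b \<in> carrier R \<Longrightarrow> f (a \<oplus> b) = f a + f b"
    and mult: "a \<in> carrier R \<Longrightarrow> b \<in> carrier R \<Longrightarrow> a \<otimes> b \<in> carrier R"
      "a \<in> carrier R \<Longrightarrow> b \<in> carrier R \<Longrightarrow> f (a \<otimes> b) = f a \<star> f b"
    and neg: "a \<in> carrier R \<Longrightarrow> \<exists>b\<in>carrier R. f b = - f a"
    and source: "s x \<in> carrier R" "f (s x) = s_hur x"
    and target: "tt x \<in> carrier R" "f (tt x) = t x"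
begin

lemma eqI: "a \<in> carrier R \<Longrightarrow> b \<in> carrier R \<Longrightarrow> f a = f b \<Longrightarrow> a = b"
  using inj by (rule inj_onD)

lemma cring_R: "cring R"
proof (rule cringI)
  show "abelian_group R"
  proof (rule abelian_groupI)
    fix a assume a: "a \<in> carrier R"
    obtain b where b: "b \<in> carrier R" "f b = - f a"
      using neg[OF a] by blast
    have "b \<oplus> a = \<zero>"
      by (rule eqI) (simp_all only: a b add zero left_minus)
    then show "\<exists>b\<in>carrier R. b \<oplus> a = \<zero>"
      using b(1) by blast
    show "\<zero> \<oplus> a = a"
      by (rule eqI) (simp_all only: a add zero add_0_left)
    fix b assume b: "b \<in> carrier R"
    show "a \<oplus> b = b \<oplus> a"
      by (rule eqI) (simp_all only: a b add add.commute)
    fix c assume c: "c \<in> carrier R"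
    show "a \<oplus> b \<oplus> c = a \<oplus> (b \<oplus> c)"
      by (rule eqI) (simp_all only: a b c add add.assoc)
  qed (simp_all only: add zero)
  show "comm_monoid R"
  proof (rule comm_monoidI)
    fix a assume a: "a \<in> carrier R"
    show "\<one> \<otimes> a = a"
      by (rule eqI) (simp_all only: a one mult, simp add: s_hur_mult)
    fix b assume b: "b \<in> carrier R"
    show "a \<otimes> b = b \<otimes> a"
      by (rule eqI) (simp_all only: a b mult, rule hmul_commute)
    fix c assume c: "c \<in> carrier R"
    show "a \<otimes> b \<otimes> c = a \<otimes> (b \<otimes> c)"
      by (rule eqI) (simp_all only: a b c mult hmul_assoc)
  qed (simp_all only: mult one)
next
  fix a b c assume abc: "a \<in> carrier R" "b \<in> carrier R" "c \<in> carrier R"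
  show "(a \<oplus> b) \<otimes> c = a \<otimes> c \<oplus> b \<otimes> c"
    by (rule eqI) (simp_all only: abc add mult hmul_add_left)
qed

sublocale cring R
  by (rule cring_R)

lemma s_hom: "s \<in> ring_hom ring_of_type_algebra R"
proof (rule ring_hom_memI)
  fix x y
  show "s (x \<otimes>\<^bsub>ring_of_type_algebra\<^esub> y) = s x \<otimes> s y"
    using hurwitz.st_simps(3)[of x y] by (intro eqI) (simp_all add: source mult)
  show "s (x \<oplus>\<^bsub>ring_of_type_algebra\<^esub> y) = s x \<oplus> s y"
    using hurwitz.st_simps(1)[of x y] by (intro eqI) (simp_all add: source add)
qed (auto intro: eqI simp: source one)

lemma t_hom: "tt \<in> ring_hom ring_of_type_algebra R"
proof (rule ring_hom_memI)
  fix x y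
  show "tt (x \<otimes>\<^bsub>ring_of_type_algebra\<^esub> y) = tt x \<otimes> tt y"
    by (intro eqI) (simp_all add: target mult t_mult)
  show "tt (x \<oplus>\<^bsub>ring_of_type_algebra\<^esub> y) = tt x \<oplus> tt y"
    by (intro eqI) (simp_all add: target add t_add)
qed (auto intro: eqI simp: target one t_1)

sublocale source_target_pair R \<delta> s tt
proof
  fix c assume "c \<in> constants \<delta>"
  then show "s c = tt c"
    by (intro eqI) (simp_all add: source target t_const)
qed (rule s_hom t_hom)+

lemma embedding_hom: "f \<in> ring_hom R hurwitz"
  by (rule ring_hom_memI) (simp_all add: add mult one)

text \<open>The shift is a derivation of the Hurwitz series that vanishes on the image of the source map, hence it is linear
  over it.\<close>

lemma differential_algebra_embedded:
  assumes d: "\<And>a. a \<in> carrier R \<Longrightarrow> d a \<in> carrier R" "\<And>a. a \<in> carrier R \<Longrightarrow> f (d a) = shift (f a)"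
  shows "differential_algebra R s d"
  unfolding differential_algebra_def
proof (intro conjI ballI allI)
  fix a b assume ab: "a \<in> carrier R" "b \<in> carrier R"
  show "d (a \<oplus> b) = d a \<oplus> d b"
    by (rule eqI) (simp_all only: ab add d shift_simps)
  show "d (a \<otimes> b) = d a \<otimes> b \<oplus> a \<otimes> d b"
    by (rule eqI) (simp_all only: ab add mult d shift_hmul)
next
  fix x a assume a: "a \<in> carrier R"
  \<comment> \<open>the term with \<open>\<N>(s(x)) = 0\<close> drops out\<close>
  have "shift (s_hur x \<star> f a) = s_hur x \<star> shift (f a)"
    by (simp only: shift_hmul shift_s_hur hmul_zero_left add_0_left)
  then show "d (s x \<otimes> a) = s x \<otimes> d a"
    by (intro eqI) (simp_all only: a source mult d)
qed (use d cring_R s_hom in auto)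

end

context diff_field
begin

section \<open>The dual of the ring of differential operators\<close>

lemma lin_ext_eq:
  assumes "Polynomial.degree u \<le> n"
  shows "lin_ext a u = (\<Sum>i\<le>n. a i * Polynomial.coeff u i)"
  unfolding lin_ext_def using assms by (intro sum.mono_neutral_left) (auto simp: coeff_eq_0)

lemma lin_ext_add_right: "lin_ext a (u + v) = lin_ext a u + lin_ext a v"
proof -
  let ?n = "max (Polynomial.degree u) (Polynomial.degree v)"
  have "Polynomial.degree (u + v) \<le> ?n"
    by (rule degree_add_le) simp_all
  then show ?thesis
    by (simp add: lin_ext_eq[of _ ?n] algebra_simps sum.distrib)
qed

lemma lin_ext_smult_right: "lin_ext a (Polynomial.smult x u) = lin_ext a u * x"
  using degree_smult_le[of x u]
  by (simp add: lin_ext_eq[of _ "Polynomial.degree u"] sum_distrib_left mult_ac)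

lemma lin_ext_fun:
  "lin_ext (a - b) u = lin_ext a u - lin_ext b u" "lin_ext 0 u = 0"
  "lin_ext (a + b) u = lin_ext a u + lin_ext b u"
  by (simp_all add: lin_ext_def algebra_simps sum.distrib sum_subtractf)

lemma lin_ext_Ypow: "lin_ext a (Ypow n) = a n"
proof -
  have "a i * Polynomial.coeff (Ypow n) i = (if i = n then a i else 0)" for i
    by simp
  then show ?thesis
    using lin_ext_eq[OF degree_monom_le, of a 1 n] by simp
qed

lemma ore_mult_scal: "u \<otimes>\<^bsub>ore \<delta>\<^esub> scal x = Polynomial.smult x u"
  by (simp add: ore_mult_pCons)

lemma Udual_iff:
  "f \<in> Udual \<delta> \<longleftrightarrow> (\<forall>u v. f (u + v) = f u + f v) \<and> (\<forall>u x. f (Polynomial.smult x u) = f u * x)"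
  by (simp add: Udual_def ore_mult_scal)

lemma lin_ext_Udual: "lin_ext a \<in> Udual \<delta>"
  by (simp add: Udual_iff lin_ext_add_right lin_ext_smult_right)

lemma Phi_lin_ext [simp]: "Phi (lin_ext a) = a"
  by (simp add: Phi_def lin_ext_Ypow)

text \<open>A right \<open>\<bbbK>\<close>-linear map is determined by its values on the powers of \<open>Y\<close>.\<close>

lemma lin_ext_Phi:
  assumes "f \<in> Udual \<delta>"
  shows "lin_ext (Phi f) = f"
proof
  fix u
  have add: "f (u + v) = f u + f v" and smult: "f (Polynomial.smult x u) = f u * x" for u v x
    using assms by (auto simp: Udual_iff)
  have f0: "f 0 = 0"
    using smult[of 0 0] by simp
  have "f (\<Sum>i\<in>A. g i) = (\<Sum>i\<in>A. f (g i))" for A and g :: "nat \<Rightarrow> 'k poly"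
    by (induction A rule: infinite_finite_induct) (simp_all add: f0 add)
  from this[of "\<lambda>i. Polynomial.smult (Polynomial.coeff u i) (Ypow i)" "{..Polynomial.degree u}"]
  have "f (\<Sum>i\<le>Polynomial.degree u. Polynomial.smult (Polynomial.coeff u i) (Ypow i)) =
      lin_ext (Phi f) u"
    by (simp only: smult lin_ext_def Phi_def)
  moreover have "(\<Sum>i\<le>Polynomial.degree u. Polynomial.smult (Polynomial.coeff u i) (Ypow i)) = u"
    by (simp add: Polynomial.smult_monom poly_as_sum_of_monoms)
  ultimately show "lin_ext (Phi f) u = f u"
    by simp
qed

lemma ustar_simps:
  "carrier (ustar \<delta>) = Udual \<delta>" "\<one>\<^bsub>ustar \<delta>\<^esub> = lin_ext (s_hur 1)" "\<zero>\<^bsub>ustar \<delta>\<^esub> = lin_ext 0"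
  "f \<otimes>\<^bsub>ustar \<delta>\<^esub> g = lin_ext (Phi f \<star> Phi g)"
  "f \<oplus>\<^bsub>ustar \<delta>\<^esub> g = (\<lambda>u. f u + g u)"
  by (simp_all add: ustar_def eps_U_def s_hur_def Phi_def hurwitz_def lin_ext_fun fun_eq_iff)

lemma s_ustar_eq: "s_ustar x = lin_ext (s_hur x)"
  by (auto simp: s_ustar_def eps_U_def lin_ext_def s_hur_def fun_eq_iff sum_distrib_left mult.assoc
      intro!: sum.cong)

lemma t_ustar_eq: "t_ustar \<delta> y = lin_ext (t y)"
  by (simp add: t_ustar_def t_hur_def)

sublocale ustar: hurwitz_embedding \<delta> "ustar \<delta>" Phi s_ustar "t_ustar \<delta>"
proof (unfold_locales, unfold ustar_simps s_ustar_eq t_ustar_eq)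
  show "inj_on Phi (Udual \<delta>)"
    by (rule inj_on_inverseI[of _ lin_ext]) (rule lin_ext_Phi)
  show "(\<lambda>u. f u + g u) \<in> Udual \<delta>" if "f \<in> Udual \<delta>" "g \<in> Udual \<delta>" for f g
    using that by (simp add: Udual_iff algebra_simps)
  show "\<exists>g\<in>Udual \<delta>. Phi g = - Phi f" for f
    by (intro bexI[of _ "lin_ext (- Phi f)"] lin_ext_Udual) simp
  show "Phi (\<lambda>u. f u + g u) = Phi f + Phi g" for f g
    by (simp add: Phi_def fun_eq_iff)
qed (simp_all add: lin_ext_Udual)

lemma bij_Phi: "bij_betw Phi (carrier (ustar \<delta>)) (carrier hurwitz)"
  using ustar.inj lin_ext_Udual by (auto simp: bij_betw_def ustar_simps intro: image_eqI[of _ _ "lin_ext x" for x])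

lemma kk_algebra_iso_Phi:
  "kk_algebra_iso \<delta> (ustar \<delta>) (source_target (ustar \<delta>) s_ustar (t_ustar \<delta>))
     hurwitz (source_target hurwitz s_hur t) Phi"
  unfolding kk_algebra_iso_def
  by (intro conjI ustar.kk_algebra_hom_source_target hurwitz.source_target_pair_axioms
      ustar.embedding_hom ustar.source ustar.target bij_Phi)

end

context diff_field
begin

section \<open>The ring of the finite dual\<close>

lemma unit_simps [simp]:
  "carrier (unit_dspace \<delta>) = UNIV" "\<zero>\<^bsub>unit_dspace \<delta>\<^esub> = 0" "x \<oplus>\<^bsub>unit_dspace \<delta>\<^esub> y = x + y"
  "x \<odot>\<^bsub>unit_dspace \<delta>\<^esub> y = x * y" "der (unit_dspace \<delta>) = \<delta>"
  by (simp_all add: unit_dspace_def)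

lemma diff_space_unit: "diff_space \<delta> (unit_dspace \<delta>)"
proof -
  have m: "diff_module \<delta> (unit_dspace \<delta>)"
  proof (intro diff_module.intro diff_module_axioms.intro diff_field_axioms moduleI)
    show "abelian_group (unit_dspace \<delta>)"
      by (rule abelian_groupI) (auto simp: add_ac intro: exI[of _ "- x" for x])
  qed (auto intro: cring_from_type_algebra simp: algebra_simps d_add d_mult)
  have "spans (unit_dspace \<delta>) {1}"
    unfolding spans_def
  proof (intro allI impI subsetI)
    fix S x assume "{1} \<subseteq> S" "\<forall>c. \<forall>x\<in>S. c \<odot>\<^bsub>unit_dspace \<delta>\<^esub> x \<in> S"
    then have "x \<odot>\<^bsub>unit_dspace \<delta>\<^esub> 1 \<in> S" by blast
    then show "x \<in> S" by simp
  qed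
  then show ?thesis
    using m finite_dimensional_iff_spans[of "unit_dspace \<delta>"]
    by (auto simp: diff_space_iff diff_module_def)
qed

lemma unit_dual: "(\<lambda>x. k * x) \<in> dual (unit_dspace \<delta>)"
  by (simp add: dual_def algebra_simps)

lemma orbit_unit: "orbit (unit_dspace \<delta>) (\<lambda>x. k * x) m = (\<lambda>n. k * t m n)"
  by (simp add: orbit_def t_hur_def)

lemma ucirc_simps:
  "carrier (ucirc \<delta>) = circ_class \<delta> ` {x. Poly_Mapping.keys x \<subseteq> circ_gens \<delta>}"
  "\<zero>\<^bsub>ucirc \<delta>\<^esub> = circ_class \<delta> 0" "\<one>\<^bsub>ucirc \<delta>\<^esub> = s_circ \<delta> 1"
  "Poly_Mapping.keys x \<subseteq> circ_gens \<delta> \<Longrightarrow> Poly_Mapping.keys y \<subseteq> circ_gens \<delta> \<Longrightarrow>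
    circ_class \<delta> x \<oplus>\<^bsub>ucirc \<delta>\<^esub> circ_class \<delta> y = circ_class \<delta> (x + y)"
  by (simp_all add: ucirc_def circ.carrier_pres circ.one_pres circ.mult_pres)

lemma circ_class_closed:
  "Poly_Mapping.keys x \<subseteq> circ_gens \<delta> \<Longrightarrow> circ_class \<delta> x \<in> carrier (ucirc \<delta>)"
  by (auto simp: ucirc_simps)

lemma ucirc_obtain:
  assumes "Z \<in> carrier (ucirc \<delta>)"
  obtains x where "Poly_Mapping.keys x \<subseteq> circ_gens \<delta>" "Z = circ_class \<delta> x"
  using assms by (auto simp: ucirc_simps)

text \<open>Although the product of two generators is an arbitrarily chosen representative, its sequence is the orbit of the
  tensor, and this is the product of the orbits.\<close>

lemma circ_mult_gen:
  assumes "a \<in> circ_gens \<delta>" "b \<in> circ_gens \<delta>"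
  shows "Poly_Mapping.keys (circ_mult_gen \<delta> a b) \<subseteq> circ_gens \<delta>"
    "circ_seq (circ_mult_gen \<delta> a b) = circ_seq (frag_of a) \<star> circ_seq (frag_of b)"
proof -
  obtain M \<phi> p N \<psi> q where ab: "a = (M, \<phi>, p)" "b = (N, \<psi>, q)" by (cases a, cases b)
  then have M: "diff_space \<delta> M" "\<phi> \<in> dual M" "p \<in> carrier M"
    and N: "diff_space \<delta> N" "\<psi> \<in> dual N" "q \<in> carrier N"
    using assms by (simp_all add: circ_gens_iff)
  interpret T: diff_tensor \<delta> N M
    using M N by (intro diff_tensor.intro diff_spaceD)
  have T: "diff_space \<delta> (tensor_dspace N M)"
    using M N T.diff_module_tensor T.finite_dimensional_tensor by (simp add: diff_space_iff)
  let ?D = "diamond N M \<psi> \<phi>" and ?e = "tensor_elt N M q p"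
  obtain c where c: "c \<in> circ_gens \<delta>" "tclass \<delta> (tensor_dspace N M) ?D ?e = circ_class \<delta> (frag_of c)"
    "circ_seq (frag_of c) = orbit (tensor_dspace N M) ?D ?e"
    using tclass_rep[OF T T.diamond_dual[OF N(2) M(2)] T.ten_simps(1)[OF N(3) M(3)]] .
  have "circ_mult_gen \<delta> a b \<in> tclass \<delta> (tensor_dspace N M) ?D ?e"
    unfolding circ_mult_gen_def ab prod.case
    by (rule someI[of _ "frag_of c"]) (simp add: c(2) circ.self_mem_class)
  then have mem: "circ_mult_gen \<delta> a b \<in> circ_class \<delta> (frag_of c)"
    by (simp add: c(2))
  then show "Poly_Mapping.keys (circ_mult_gen \<delta> a b) \<subseteq> circ_gens \<delta>"
    by (rule circ.keys_mem_class) (simp add: c(1))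
  have "circ_seq (circ_mult_gen \<delta> a b - frag_of c) = 0"
    using mem circ_seq_rel by (simp only: circ.mem_class_iff)
  then have "circ_seq (circ_mult_gen \<delta> a b) = circ_seq (frag_of c)"
    by simp
  also have "\<dots> = orbit N \<psi> q \<star> orbit M \<phi> p"
    unfolding c(3) by (rule T.orbit_diamond[OF N(2) M(2) N(3) M(3)])
  finally show "circ_seq (circ_mult_gen \<delta> a b) = circ_seq (frag_of a) \<star> circ_seq (frag_of b)"
    unfolding ab circ_seq_simps by (simp only: hmul_commute)
qed

lemma hmul_diff:
  "(\<alpha> - \<beta>) \<star> \<gamma> = \<alpha> \<star> \<gamma> - \<beta> \<star> \<gamma>" "\<gamma> \<star> (\<alpha> - \<beta>) = \<gamma> \<star> \<alpha> - \<gamma> \<star> \<beta>"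
  for \<alpha> \<beta> \<gamma> :: "nat \<Rightarrow> 'k"
  using hmul_add_left[of "\<alpha> - \<beta>" \<beta> \<gamma>] hmul_add_right[of \<gamma> "\<alpha> - \<beta>" \<beta>]
  by (simp_all only: diff_add_cancel add_diff_cancel)

lemma circ_mult_frag:
  assumes "Poly_Mapping.keys x \<subseteq> circ_gens \<delta>" "Poly_Mapping.keys y \<subseteq> circ_gens \<delta>"
  shows "Poly_Mapping.keys (frag_extend2 (circ_mult_gen \<delta>) x y) \<subseteq> circ_gens \<delta> \<and>
    circ_seq (frag_extend2 (circ_mult_gen \<delta>) x y) = circ_seq x \<star> circ_seq y"
  using assms
proof (rule frag_extend2_induct)
  show "Poly_Mapping.keys (frag_extend2 (circ_mult_gen \<delta>) x 0) \<subseteq> circ_gens \<delta> \<and>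
      circ_seq (frag_extend2 (circ_mult_gen \<delta>) x 0) = circ_seq x \<star> circ_seq 0" for x
    using hmul_diff(2)[of "circ_seq x" 0 0] by simp
  show "Poly_Mapping.keys (frag_extend2 (circ_mult_gen \<delta>) 0 x) \<subseteq> circ_gens \<delta> \<and>
      circ_seq (frag_extend2 (circ_mult_gen \<delta>) 0 x) = circ_seq 0 \<star> circ_seq x" for x
    by simp
qed (simp_all only: frag_extend2_diff_left frag_extend2_diff_right circ_seq_simps(2) hmul_diff
    frag_extend2_of circ_mult_gen keys_diff_subset simp_thms)

text \<open>The product of classes is independent of the representatives because its sequence is, and sequences separate
  classes. No relation has to be multiplied out.\<close>

lemma ucirc_mult:
  assumes "Poly_Mapping.keys x \<subseteq> circ_gens \<delta>" "Poly_Mapping.keys y \<subseteq> circ_gens \<delta>"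
  shows "circ_class \<delta> x \<otimes>\<^bsub>ucirc \<delta>\<^esub> circ_class \<delta> y =
    circ_class \<delta> (frag_extend2 (circ_mult_gen \<delta>) x y)"
  unfolding ucirc_def monoid.simps
proof (rule induced2_eqI[OF circ.self_mem_class circ.self_mem_class])
  fix x' y' assume x': "x' \<in> circ_class \<delta> x" and y': "y' \<in> circ_class \<delta> y"
  have k: "Poly_Mapping.keys x' \<subseteq> circ_gens \<delta>" "Poly_Mapping.keys y' \<subseteq> circ_gens \<delta>"
    using circ.keys_mem_class x' y' assms by blast+
  have "circ_class \<delta> x' = circ_class \<delta> x" "circ_class \<delta> y' = circ_class \<delta> y"
    using x' y' by (simp_all only: circ.class_eq_iff circ.mem_class_iff)
  then have "circ_seq x' = circ_seq x" "circ_seq y' = circ_seq y"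
    using circ_class_eq_iff k assms by blast+
  then show "circ_class \<delta> (frag_extend2 (circ_mult_gen \<delta>) x' y') =
      circ_class \<delta> (frag_extend2 (circ_mult_gen \<delta>) x y)"
    using circ_mult_frag[OF k] circ_mult_frag[OF assms] by (simp only: circ_class_eq_iff)
qed

lemma act_orbit:
  fixes M :: "('k, 'm) dspace"
  assumes "diff_space \<delta> M" "\<phi> \<in> dual M" "m \<in> carrier M"
  shows "\<phi> (act M m u) = lin_ext (orbit M \<phi> m) u"
proof -
  interpret M: diff_module \<delta> M by (rule diff_spaceD) fact
  have \<phi>0: "\<phi> \<zero>\<^bsub>M\<^esub> = 0"
    using dualD(2)[OF assms(2) M.M.M.zero_closed, of 0] by (simp add: M.smult_laws)
  have cl: "(\<lambda>j. Polynomial.coeff u j \<odot>\<^bsub>M\<^esub> (der M ^^ j) m) \<in> F \<rightarrow> carrier M" for F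
    using assms(3) by simp
  have "\<phi> (\<Oplus>\<^bsub>M\<^esub>j\<in>F. Polynomial.coeff u j \<odot>\<^bsub>M\<^esub> (der M ^^ j) m) =
      (\<Sum>j\<in>F. orbit M \<phi> m j * Polynomial.coeff u j)" if "finite F" for F
    using that
  proof (induction F rule: finite_induct)
    case (insert j F)
    then show ?case
      using M.M.M.finsum_closed[OF cl[of F]] assms(3)
      by (subst M.M.M.finsum_insert) (simp_all add: dualD[OF assms(2)] orbit_def mult.commute)
  qed (simp add: \<phi>0)
  then show ?thesis
    by (simp add: act_def lin_ext_def)
qed

text \<open>The map \<open>u \<mapsto> \<phi>(m \<triangleleft> u)\<close> is the right linear map whose values on the powers
  of \<open>Y\<close> form the orbit.\<close>

lemma zeta_class:
  assumes "Poly_Mapping.keys x \<subseteq> circ_gens \<delta>"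
  shows "zeta (circ_class \<delta> x) = lin_ext (circ_seq x)"
proof -
  let ?h = "\<lambda>x u. frag_sum (\<lambda>(M, \<phi>, m). \<phi> (act M m u)) x"
  have h: "?h x = lin_ext (circ_seq x)" if "Poly_Mapping.keys x \<subseteq> circ_gens \<delta>" for x
    using that
  proof (induction x rule: frag_induction)
    case (one a)
    then show ?case
      by (cases a) (auto simp: act_orbit circ_gens_iff)
  qed (simp_all only: fun_eq_iff frag_sum_0 frag_sum_diff circ_seq_simps lin_ext_fun simp_thms)
  have "?h (r + x) = ?h x" if "r \<in> pres_rel (circ_gens \<delta>) (circ_rels \<delta>)" for r
  proof -
    have "?h r = (\<lambda>u. 0)"
      using h[OF circ.pres_rel_subset[OF that]] circ_seq_rel[OF that] by (simp add: lin_ext_fun fun_eq_iff)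
    then show ?thesis
      by (simp add: frag_sum_add fun_eq_iff)
  qed
  then show ?thesis
    unfolding zeta_def using circ.induced_class[of ?h x] h[OF assms] by simp
qed

definition dlin_map :: "'k triple frag set \<Rightarrow> nat \<Rightarrow> 'k" where
  "dlin_map Z = Phi (zeta Z)"

lemma dlin_map_class:
  "Poly_Mapping.keys x \<subseteq> circ_gens \<delta> \<Longrightarrow> dlin_map (circ_class \<delta> x) = circ_seq x"
  by (simp add: dlin_map_def zeta_class)

lemma zeta_eq: "Z \<in> carrier (ucirc \<delta>) \<Longrightarrow> zeta Z = lin_ext (dlin_map Z)"
  by (erule ucirc_obtain) (simp add: dlin_map_class zeta_class)

lemma tclass_ucirc:
  fixes M :: "('k, 'm) dspace"
  assumes "diff_space \<delta> M" "\<phi> \<in> dual M" "m \<in> carrier M"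
  shows "tclass \<delta> M \<phi> m \<in> carrier (ucirc \<delta>)" "dlin_map (tclass \<delta> M \<phi> m) = orbit M \<phi> m"
    "zeta (tclass \<delta> M \<phi> m) = (\<lambda>u. \<phi> (act M m u))"
proof -
  obtain a where a: "a \<in> circ_gens \<delta>" "tclass \<delta> M \<phi> m = circ_class \<delta> (frag_of a)"
    "circ_seq (frag_of a) = orbit M \<phi> m"
    using tclass_rep[OF assms] .
  then show *: "tclass \<delta> M \<phi> m \<in> carrier (ucirc \<delta>)" "dlin_map (tclass \<delta> M \<phi> m) = orbit M \<phi> m"
    by (simp_all add: circ_class_closed dlin_map_class)
  show "zeta (tclass \<delta> M \<phi> m) = (\<lambda>u. \<phi> (act M m u))"
    by (simp only: zeta_eq[OF *(1)] *(2) act_orbit[OF assms] fun_eq_iff simp_thms)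
qed

lemma s_circ:
  "s_circ \<delta> x \<in> carrier (ucirc \<delta>)" "dlin_map (s_circ \<delta> x) = s_hur x"
  using tclass_ucirc(1,2)[OF diff_space_unit unit_dual, of 1 x]
  by (simp_all add: s_circ_def orbit_unit t_1) (simp add: s_hur_def fun_eq_iff)

lemma t_circ:
  "t_circ \<delta> x \<in> carrier (ucirc \<delta>)" "dlin_map (t_circ \<delta> x) = t x"
  using tclass_ucirc(1,2)[OF diff_space_unit unit_dual, of x 1]
  by (simp_all add: t_circ_def orbit_unit[of 1, simplified])

lemma inj_dlin_map: "inj_on dlin_map (carrier (ucirc \<delta>))"
proof (rule inj_onI)
  fix Z W assume "Z \<in> carrier (ucirc \<delta>)" "W \<in> carrier (ucirc \<delta>)" "dlin_map Z = dlin_map W"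
  then show "Z = W"
    by (elim ucirc_obtain) (simp add: dlin_map_class circ_class_eq_iff)
qed

lemma image_dlin_map: "dlin_map ` carrier (ucirc \<delta>) = Dlin \<delta>"
proof (intro equalityI subsetI)
  fix \<alpha> assume "\<alpha> \<in> Dlin \<delta>"
  then obtain x where "Poly_Mapping.keys x \<subseteq> circ_gens \<delta>" "circ_seq x = \<alpha>"
    using Dlin_circ_seq by blast
  then have "\<alpha> = dlin_map (circ_class \<delta> x)" "circ_class \<delta> x \<in> carrier (ucirc \<delta>)"
    by (simp_all add: dlin_map_class circ_class_closed)
  then show "\<alpha> \<in> dlin_map ` carrier (ucirc \<delta>)" by (rule image_eqI)
next
  fix \<alpha> assume "\<alpha> \<in> dlin_map ` carrier (ucirc \<delta>)"
  then obtain Z where "\<alpha> = dlin_map Z" "Z \<in> carrier (ucirc \<delta>)" by blast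
  then show "\<alpha> \<in> Dlin \<delta>"
    by (elim ucirc_obtain) (simp add: dlin_map_class circ_seq_Dlin)
qed

sublocale ucirc: hurwitz_embedding \<delta> "ucirc \<delta>" dlin_map "s_circ \<delta>" "t_circ \<delta>"
proof
  fix Z assume "Z \<in> carrier (ucirc \<delta>)"
  then obtain x where x: "Poly_Mapping.keys x \<subseteq> circ_gens \<delta>" "Z = circ_class \<delta> x"
    by (rule ucirc_obtain)
  have "circ_seq (- x) = - circ_seq x"
    using circ_seq_simps(3)[of "- x" x] by (simp only: left_minus circ_seq_simps(1) eq_neg_iff_add_eq_0)
  then have "dlin_map (circ_class \<delta> (- x)) = - dlin_map Z"
    using x by (simp only: dlin_map_class keys_minus)
  moreover have "circ_class \<delta> (- x) \<in> carrier (ucirc \<delta>)"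
    using x by (simp add: circ_class_closed)
  ultimately show "\<exists>W\<in>carrier (ucirc \<delta>). dlin_map W = - dlin_map Z"
    by (rule bexI)
  fix W assume "W \<in> carrier (ucirc \<delta>)"
  then obtain y where y: "Poly_Mapping.keys y \<subseteq> circ_gens \<delta>" "W = circ_class \<delta> y"
    by (rule ucirc_obtain)
  show "Z \<oplus>\<^bsub>ucirc \<delta>\<^esub> W \<in> carrier (ucirc \<delta>)" "dlin_map (Z \<oplus>\<^bsub>ucirc \<delta>\<^esub> W) = dlin_map Z + dlin_map W"
    using x y by (simp_all add: ucirc_simps(4) circ_class_closed dlin_map_class keys_add_subset)
  show "Z \<otimes>\<^bsub>ucirc \<delta>\<^esub> W \<in> carrier (ucirc \<delta>)" "dlin_map (Z \<otimes>\<^bsub>ucirc \<delta>\<^esub> W) = dlin_map Z \<star> dlin_map W"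
    using x y circ_mult_frag[OF x(1) y(1)]
    by (simp_all add: ucirc_mult circ_class_closed dlin_map_class)
qed (simp_all add: inj_dlin_map s_circ t_circ ucirc_simps(2,3) circ_class_closed dlin_map_class)

lemma der_circ_class:
  assumes "Poly_Mapping.keys x \<subseteq> circ_gens \<delta>"
  shows "der_circ \<delta> (circ_class \<delta> x) \<in> carrier (ucirc \<delta>)"
    "dlin_map (der_circ \<delta> (circ_class \<delta> x)) = shift (circ_seq x)"
proof -
  let ?d = "frag_extend (\<lambda>(M, \<phi>, m). frag_of (M, \<phi>, der M m))"
  have d: "Poly_Mapping.keys (?d x) \<subseteq> circ_gens \<delta> \<and> circ_seq (?d x) = shift (circ_seq x)"
    if "Poly_Mapping.keys x \<subseteq> circ_gens \<delta>" for x
    using that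
  proof (induction x rule: frag_induction)
    case (one a)
    then show ?case
      by (cases a) (auto simp: circ_gens_iff shift_orbit intro!: diff_module.der_closed diff_spaceD)
  qed (simp_all only: frag_extend_0 frag_extend_diff circ_seq_simps shift_simps(4,5) keys_diff_subset
      keys_zero empty_subsetI simp_thms)
  have "circ_class \<delta> (?d (r + x)) = circ_class \<delta> (?d x)"
    if "r \<in> pres_rel (circ_gens \<delta>) (circ_rels \<delta>)" for r
  proof -
    have "Poly_Mapping.keys (r + x) \<subseteq> circ_gens \<delta>"
      using circ.pres_rel_subset[OF that] assms by (rule keys_add_subset)
    moreover have "circ_seq (r + x) = circ_seq x"
      using circ_seq_rel[OF that] by simp
    ultimately show ?thesis
      using d[of "r + x"] d[OF assms] by (simp only: circ_class_eq_iff)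
  qed
  then have "der_circ \<delta> (circ_class \<delta> x) = circ_class \<delta> (?d x)"
    unfolding der_circ_def by (rule circ.induced_class)
  then show "der_circ \<delta> (circ_class \<delta> x) \<in> carrier (ucirc \<delta>)"
    "dlin_map (der_circ \<delta> (circ_class \<delta> x)) = shift (circ_seq x)"
    using d[OF assms] by (simp_all add: circ_class_closed dlin_map_class)
qed

lemma der_circ:
  "Z \<in> carrier (ucirc \<delta>) \<Longrightarrow> der_circ \<delta> Z \<in> carrier (ucirc \<delta>)"
  "Z \<in> carrier (ucirc \<delta>) \<Longrightarrow> dlin_map (der_circ \<delta> Z) = shift (dlin_map Z)"
  by (elim ucirc_obtain, simp add: der_circ_class dlin_map_class)+

lemma dlin_ring_simps:
  "carrier (dlin_ring \<delta>) = Dlin \<delta>" "\<alpha> \<otimes>\<^bsub>dlin_ring \<delta>\<^esub> \<beta> = \<alpha> \<star> \<beta>" "\<alpha> \<oplus>\<^bsub>dlin_ring \<delta>\<^esub> \<beta> = \<alpha> + \<beta>"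
  "\<one>\<^bsub>dlin_ring \<delta>\<^esub> = s_hur 1" "\<zero>\<^bsub>dlin_ring \<delta>\<^esub> = 0"
  by (simp_all add: dlin_ring_def)

sublocale dlin: hurwitz_embedding \<delta> "dlin_ring \<delta>" "\<lambda>\<alpha>. \<alpha>" s_hur t
proof (unfold_locales, unfold dlin_ring_simps image_dlin_map[symmetric])
  have st: "s_hur x \<in> dlin_map ` carrier (ucirc \<delta>)" "t x \<in> dlin_map ` carrier (ucirc \<delta>)" for x
    using s_circ[of x] t_circ[of x] by (metis imageI)+
  show "s_hur 1 \<in> dlin_map ` carrier (ucirc \<delta>)"
    by (rule st)
  show "s_hur x \<in> dlin_map ` carrier (ucirc \<delta>)" "t x \<in> dlin_map ` carrier (ucirc \<delta>)" for x
    by (rule st)+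
  show "0 \<in> dlin_map ` carrier (ucirc \<delta>)"
    using ucirc.zero by (metis imageI)
  fix \<alpha> assume "\<alpha> \<in> dlin_map ` carrier (ucirc \<delta>)"
  then obtain Z where Z: "\<alpha> = dlin_map Z" "Z \<in> carrier (ucirc \<delta>)" by (rule imageE)
  obtain Z' where "Z' \<in> carrier (ucirc \<delta>)" "dlin_map Z' = - \<alpha>"
    using ucirc.neg[OF Z(2)] unfolding Z(1) by (rule bexE)
  then show "\<exists>\<beta>\<in>dlin_map ` carrier (ucirc \<delta>). \<beta> = - \<alpha>"
    by (intro bexI[of _ "dlin_map Z'"] imageI)
  fix \<beta> assume "\<beta> \<in> dlin_map ` carrier (ucirc \<delta>)"
  then obtain W where W: "\<beta> = dlin_map W" "W \<in> carrier (ucirc \<delta>)" by (rule imageE)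
  show "\<alpha> + \<beta> \<in> dlin_map ` carrier (ucirc \<delta>)"
    unfolding Z(1) W(1) ucirc.add(2)[OF Z(2) W(2), symmetric]
    by (rule imageI) (rule ucirc.add(1)[OF Z(2) W(2)])
  show "\<alpha> \<star> \<beta> \<in> dlin_map ` carrier (ucirc \<delta>)"
    unfolding Z(1) W(1) ucirc.mult(2)[OF Z(2) W(2), symmetric]
    by (rule imageI) (rule ucirc.mult(1)[OF Z(2) W(2)])
qed simp_all

lemma shift_Dlin:
  assumes "\<alpha> \<in> Dlin \<delta>"
  shows "shift \<alpha> \<in> Dlin \<delta>"
proof -
  obtain Z where Z: "\<alpha> = dlin_map Z" "Z \<in> carrier (ucirc \<delta>)"
    using assms unfolding image_dlin_map[symmetric] by (rule imageE)
  show ?thesis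
    unfolding Z(1) der_circ(2)[OF Z(2), symmetric] image_dlin_map[symmetric]
    by (rule imageI) (rule der_circ(1)[OF Z(2)])
qed

lemma bij_dlin_map: "bij_betw dlin_map (carrier (ucirc \<delta>)) (carrier (dlin_ring \<delta>))"
  by (simp add: bij_betw_def inj_dlin_map image_dlin_map dlin_ring_simps)

lemma dlin_map_hom: "dlin_map \<in> ring_hom (ucirc \<delta>) (dlin_ring \<delta>)"
  by (rule ring_hom_memI)
    (auto simp: dlin_ring_simps ucirc.add ucirc.mult ucirc.one simp flip: image_dlin_map)

lemma kk_algebra_iso_dlin_map:
  "kk_algebra_iso \<delta> (ucirc \<delta>) (source_target (ucirc \<delta>) (s_circ \<delta>) (t_circ \<delta>))
     (dlin_ring \<delta>) (source_target (dlin_ring \<delta>) s_hur t) dlin_map"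
  unfolding kk_algebra_iso_def
  by (intro conjI ucirc.kk_algebra_hom_source_target dlin.source_target_pair_axioms
      dlin_map_hom s_circ t_circ bij_dlin_map)

lemma kk_algebra_hom_zeta:
  "kk_algebra_hom \<delta> (ucirc \<delta>) (source_target (ucirc \<delta>) (s_circ \<delta>) (t_circ \<delta>))
     (ustar \<delta>) (source_target (ustar \<delta>) s_ustar (t_ustar \<delta>)) zeta"
proof (intro ucirc.kk_algebra_hom_source_target ustar.source_target_pair_axioms)
  show "zeta \<in> ring_hom (ucirc \<delta>) (ustar \<delta>)"
    by (rule ring_hom_memI)
      (simp_all add: zeta_eq ustar_simps lin_ext_Udual ucirc.add ucirc.mult ucirc.one, 
        simp add: lin_ext_fun fun_eq_iff)
qed (simp_all add: zeta_eq s_circ t_circ s_ustar_eq t_ustar_eq)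

lemma differential_algebra_iso_dlin_map:
  "differential_algebra_iso (ucirc \<delta>) (s_circ \<delta>) (der_circ \<delta>) (dlin_ring \<delta>) s_hur shift dlin_map"
  unfolding differential_algebra_iso_def ring_iso_def
proof (intro conjI CollectI allI ballI dlin_map_hom bij_dlin_map s_circ der_circ)
  show "differential_algebra (ucirc \<delta>) (s_circ \<delta>) (der_circ \<delta>)"
    by (rule ucirc.differential_algebra_embedded) (rule der_circ; assumption)+
  show "differential_algebra (dlin_ring \<delta>) s_hur shift"
    by (rule dlin.differential_algebra_embedded) (simp_all only: dlin_ring_simps shift_Dlin)
qed

end

section \<open>Division in the ring of differential operators\<close>

context diff_field
begin

lemma coeff_times_Y:
  "Polynomial.coeff (times_Y \<delta> p) 0 = \<delta> (Polynomial.coeff p 0)"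
  "Polynomial.coeff (times_Y \<delta> p) (Suc n) = Polynomial.coeff p n + \<delta> (Polynomial.coeff p (Suc n))"
  by (simp_all add: times_Y_def coeff_map_poly)

text \<open>Right multiplication by \<open>Y\<close> raises the degree by one and keeps the leading coefficient; the terms
  \<open>\<partial>(c\<^sub>i)\<close> have lower degree, since \<open>\<partial>(1) = 0\<close>.\<close>

lemma degree_times_Y_pow:
  assumes "Polynomial.lead_coeff p = 1"
  shows "(\<forall>i>Polynomial.degree p + j. Polynomial.coeff ((times_Y \<delta> ^^ j) p) i = 0) \<and>
    Polynomial.coeff ((times_Y \<delta> ^^ j) p) (Polynomial.degree p + j) = 1"
proof (induction j)
  case 0
  then show ?case using assms by (simp add: coeff_eq_0)
next
  case (Suc j)
  have "Polynomial.coeff ((times_Y \<delta> ^^ Suc j) p) i = 0" if "i > Polynomial.degree p + Suc j" for i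
    using Suc that by (cases i) (simp_all add: coeff_times_Y)
  then show ?case
    using Suc by (simp add: coeff_times_Y)
qed

lemma degree_ore_mult:
  assumes "Polynomial.lead_coeff p = 1" "v \<noteq> 0"
  shows "p \<otimes>\<^bsub>ore \<delta>\<^esub> v \<noteq> 0" "Polynomial.degree p \<le> Polynomial.degree (p \<otimes>\<^bsub>ore \<delta>\<^esub> v)"
proof -
  let ?n = "Polynomial.degree v"
  have "Polynomial.coeff (p \<otimes>\<^bsub>ore \<delta>\<^esub> v) (Polynomial.degree p + ?n) =
      (\<Sum>j\<le>?n. Polynomial.coeff v j *
        Polynomial.coeff ((times_Y \<delta> ^^ j) p) (Polynomial.degree p + ?n))"
    by (simp add: ore_def coeff_sum)
  also have "\<dots> = (\<Sum>j\<in>{?n}. Polynomial.coeff v j *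
        Polynomial.coeff ((times_Y \<delta> ^^ j) p) (Polynomial.degree p + ?n))"
    using degree_times_Y_pow[OF assms(1)] by (intro sum.mono_neutral_right) auto
  also have "\<dots> = Polynomial.lead_coeff v"
    using degree_times_Y_pow[OF assms(1), of ?n] by simp
  finally have nz: "Polynomial.coeff (p \<otimes>\<^bsub>ore \<delta>\<^esub> v) (Polynomial.degree p + ?n) \<noteq> 0"
    using assms(2) by simp
  then show "p \<otimes>\<^bsub>ore \<delta>\<^esub> v \<noteq> 0" by auto
  show "Polynomial.degree p \<le> Polynomial.degree (p \<otimes>\<^bsub>ore \<delta>\<^esub> v)"
    using le_degree[OF nz] by simp
qed

lemma ore_mult_Ypow: "p \<otimes>\<^bsub>ore \<delta>\<^esub> Ypow j = (times_Y \<delta> ^^ j) p"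
proof (induction j arbitrary: p)
  case 0
  then show ?case by (simp add: Polynomial.monom_0 ore_mult_pCons)
next
  case (Suc j)
  then show ?case
    by (simp add: Polynomial.monom_Suc ore_mult_pCons funpow_swap1)
qed

text \<open>Division with remainder, by cancelling the coefficient at \<open>n\<close>. The degree is bounded by vanishing of
  coefficients, so that the zero polynomial needs no separate treatment.\<close>

lemma ore_division:
  assumes p: "Polynomial.lead_coeff p = 1" and u: "\<forall>i\<ge>n. Polynomial.coeff u i = 0"
  shows "\<exists>q r. u = p \<otimes>\<^bsub>ore \<delta>\<^esub> q + r \<and> (\<forall>i\<ge>Polynomial.degree p. Polynomial.coeff r i = 0)"
  using u
proof (induction n arbitrary: u)
  case 0
  then show ?case
    by (intro exI[of _ 0] exI[of _ u]) simp
next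
  case (Suc n)
  let ?d = "Polynomial.degree p"
  show ?case
  proof (cases "?d \<le> n")
    case False
    then show ?thesis
      using Suc.prems by (intro exI[of _ 0] exI[of _ u]) simp
  next
    case True
    \<comment> \<open>\<open>p Y\<^sup>k\<close> is monic of degree \<open>n\<close>, so a multiple of it cancels the coefficient at \<open>n\<close>\<close>
    let ?m = "Polynomial.smult (Polynomial.coeff u n) (Ypow (n - ?d))"
    have m: "p \<otimes>\<^bsub>ore \<delta>\<^esub> ?m = Polynomial.smult (Polynomial.coeff u n) ((times_Y \<delta> ^^ (n - ?d)) p)"
      by (simp only: ore_mult_smult_right ore_mult_Ypow)
    have "Polynomial.coeff (u - p \<otimes>\<^bsub>ore \<delta>\<^esub> ?m) i = 0" if "i \<ge> n" for i
      unfolding m using that Suc.prems degree_times_Y_pow[OF p, of "n - ?d"] True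
      by (cases "i = n") auto
    then obtain q r where "u - p \<otimes>\<^bsub>ore \<delta>\<^esub> ?m = p \<otimes>\<^bsub>ore \<delta>\<^esub> q + r" "\<forall>i\<ge>?d. Polynomial.coeff r i = 0"
      using Suc.IH[of "u - p \<otimes>\<^bsub>ore \<delta>\<^esub> ?m"] by blast
    then show ?thesis
      by (intro exI[of _ "q + ?m"] exI[of _ r]) (simp only: ore_mult_add_right, simp add: algebra_simps)
  qed
qed


section \<open>The action of differential operators on Hurwitz series\<close>

text \<open>The right action \<open>\<alpha> \<triangleleft> u\<close> of \<open>U\<close> on the Hurwitz series, where
  \<open>Y\<close> acts by the shift and \<open>\<bbbK>\<close> through \<open>t\<close>.\<close>

definition hact :: "(nat \<Rightarrow> 'k) \<Rightarrow> 'k poly \<Rightarrow> nat \<Rightarrow> 'k" where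
  "hact \<alpha> u = (\<Sum>i\<le>Polynomial.degree u. t (Polynomial.coeff u i) \<star> (shift ^^ i) \<alpha>)"

lemma hact_bound:
  assumes "Polynomial.degree u \<le> n"
  shows "hact \<alpha> u = (\<Sum>i\<le>n. t (Polynomial.coeff u i) \<star> (shift ^^ i) \<alpha>)"
  unfolding hact_def using assms by (intro sum.mono_neutral_left) (auto simp: coeff_eq_0)

lemma hact_0 [simp]: "hact \<alpha> 0 = 0"
  by (simp add: hact_def)

lemma hact_add: "hact \<alpha> (u + v) = hact \<alpha> u + hact \<alpha> v"
proof -
  let ?n = "max (Polynomial.degree u) (Polynomial.degree v)"
  have "Polynomial.degree (u + v) \<le> ?n"
    by (rule degree_add_le) simp_all
  then show ?thesis
    by (simp only: hact_bound[of _ ?n] max.cobounded1 max.cobounded2 Polynomial.coeff_add t_add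
        hmul_add_left sum.distrib)
qed

lemma hact_diff: "hact \<alpha> (u - v) = hact \<alpha> u - hact \<alpha> v"
  using hact_add[of \<alpha> "u - v" v] by (simp only: diff_add_cancel add_diff_cancel)

lemma hact_smult: "hact \<alpha> (Polynomial.smult x u) = t x \<star> hact \<alpha> u"
  using hact_bound[OF degree_smult_le, of \<alpha> x u]
  by (simp only: hact_def Polynomial.coeff_smult t_mult hmul_assoc H.scale_sum_right)

lemma hact_pCons: "hact \<alpha> (pCons a u) = t a \<star> \<alpha> + hact (shift \<alpha>) u"
proof -
  have "hact \<alpha> (pCons a u) = (\<Sum>i\<le>Suc (Polynomial.degree u).
      t (Polynomial.coeff (pCons a u) i) \<star> (shift ^^ i) \<alpha>)"
    by (rule hact_bound) (rule degree_pCons_le)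
  also have "\<dots> = t a \<star> \<alpha> + hact (shift \<alpha>) u"
    unfolding hact_def by (subst sum.atMost_Suc_shift) (simp add: funpow_swap1 del: shift_simps(1))
  finally show ?thesis .
qed

lemma hact_zero_left: "hact 0 u = 0"
  by (induction u) (simp_all only: hact_0 hact_pCons H.scale_zero_right shift_simps(5) add_0_left)

lemma hact_times_Y: "hact \<alpha> (times_Y \<delta> u) = shift (hact \<alpha> u)"
proof (induction u arbitrary: \<alpha>)
  case 0
  have "times_Y \<delta> 0 = 0"
    by (simp add: times_Y_def)
  then show ?case
    by (simp only: hact_0 shift_simps(5))
next
  case (pCons a u)
  have "hact \<alpha> (times_Y \<delta> (pCons a u)) =
      t (\<delta> a) \<star> \<alpha> + (t a \<star> shift \<alpha> + hact (shift (shift \<alpha>)) 0 + shift (hact (shift \<alpha>) u))"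
    by (simp only: times_Y_pCons[OF diff_field] hact_pCons hact_add pCons.IH)
  also have "\<dots> = shift (hact \<alpha> (pCons a u))"
    by (simp only: hact_pCons shift_simps(2) shift_hmul shift_t hact_0 add_0_right add.assoc)
  finally show ?case .
qed

lemma hact_ore_mult: "hact \<alpha> (p \<otimes>\<^bsub>ore \<delta>\<^esub> u) = hact (hact \<alpha> p) u"
  by (induction u arbitrary: p)
    (simp_all only: ore_mult_0 hact_0 ore_mult_pCons hact_add hact_smult hact_times_Y hact_pCons)

lemma hact_Ypow: "hact \<alpha> (Ypow n) = (shift ^^ n) \<alpha>"
proof (induction n arbitrary: \<alpha>)
  case 0
  then show ?case
    by (simp add: Polynomial.monom_0 hact_pCons t_1 s_hur_mult)
next
  case (Suc n)
  then show ?case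
    by (simp only: Polynomial.monom_Suc hact_pCons t_0 hmul_zero_left add_0_left funpow_Suc_right o_apply)
qed

lemma hact_1: "hact \<alpha> 1 = \<alpha>"
  using hact_Ypow[of \<alpha> 0] by (simp add: Polynomial.monom_0 one_pCons)

text \<open>Evaluation at \<open>0\<close> turns the action on \<open>\<alpha>\<close> into the functional
  \<open>f\<^sub>\<alpha>\<close>; in particular \<open>f\<^sub>\<alpha>\<close> vanishes on the annihilator.\<close>

lemma hact_at_0: "hact \<alpha> u 0 = lin_ext \<alpha> u"
  by (simp add: hact_def lin_ext_def sum_fun_apply funpow_shift mult.commute)

lemma annihilator_eq: "annihilator \<delta> \<alpha> = {u. hact \<alpha> u = 0}"
  unfolding annihilator_def hact_def by (simp add: fun_eq_iff sum_fun_apply)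

lemma annihilator_nonzero:
  assumes "\<alpha> \<in> Dlin \<delta>"
  obtains u where "u \<in> annihilator \<delta> \<alpha>" "u \<noteq> 0"
proof -
  obtain d c where c: "c d \<noteq> 0" "(\<Sum>i\<le>d. t (c i) \<star> (shift ^^ i) \<alpha>) = 0"
    using assms by (auto simp: Dlin_iff)
  define u where "u = (\<Sum>i\<le>d. Polynomial.monom (c i) i)"
  have coeff: "Polynomial.coeff u i = (if i \<le> d then c i else 0)" for i
    by (simp add: u_def coeff_sum)
  then have "Polynomial.degree u \<le> d"
    by (intro degree_le) simp
  then have "hact \<alpha> u = 0"
    using c(2) by (simp add: hact_bound coeff)
  moreover have "u \<noteq> 0"
    using coeff[of d] c(1) by auto
  ultimately show thesis
    using that by (simp add: annihilator_eq)
qed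

text \<open>A nonzero element of least degree in the annihilator exists by the recursion, and its leading coefficient can be
  made \<open>1\<close>. It generates, because the remainder of the division of another element of the annihilator lies in
  the annihilator and has smaller degree. A second monic generator has the same degree, so the difference has smaller degree
  and vanishes.\<close>

lemma P_alpha:
  assumes "\<alpha> \<in> Dlin \<delta>"
  shows "right_ideal \<delta> (P_alpha \<delta> \<alpha>) = annihilator \<delta> \<alpha>"
proof -
  let ?I = "annihilator \<delta> \<alpha>"
  obtain w where "w \<in> ?I \<and> w \<noteq> 0"
    using annihilator_nonzero[OF assms] by metis
  from exists_least_iff[THEN iffD1, OF exI, of "\<lambda>n. \<exists>w. w \<in> ?I \<and> w \<noteq> 0 \<and> Polynomial.degree w = n"] this
  obtain w where w: "w \<in> ?I" "w \<noteq> 0" "\<And>v. v \<in> ?I \<Longrightarrow> Polynomial.degree v < Polynomial.degree w \<Longrightarrow> v = 0"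
    by blast
  define p where "p = Polynomial.smult (inverse (Polynomial.lead_coeff w)) w"
  have deg: "Polynomial.degree p = Polynomial.degree w"
    using w(2) by (simp add: p_def)
  have p: "p \<in> ?I" "Polynomial.lead_coeff p = 1"
    using w(1,2) by (simp_all add: p_def annihilator_eq hact_smult)
  have min: "v = 0" if "v \<in> ?I" "\<forall>i\<ge>Polynomial.degree p. Polynomial.coeff v i = 0" for v
  proof (rule ccontr)
    assume "v \<noteq> 0"
    then have "Polynomial.degree v < Polynomial.degree p"
      using that(2) by (metis leading_coeff_0_iff not_le)
    then show False
      using w(3)[OF that(1)] \<open>v \<noteq> 0\<close> deg by simp
  qed
  have ideal: "right_ideal \<delta> p = ?I"
  proof (intro equalityI subsetI)
    fix u assume "u \<in> right_ideal \<delta> p"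
    then show "u \<in> ?I"
      using p(1) by (auto simp: right_ideal_def annihilator_eq hact_ore_mult hact_zero_left)
  next
    fix u assume u: "u \<in> ?I"
    obtain q r where qr: "u = p \<otimes>\<^bsub>ore \<delta>\<^esub> q + r" "\<forall>i\<ge>Polynomial.degree p. Polynomial.coeff r i = 0"
      using ore_division[OF p(2), of "Suc (Polynomial.degree u)" u] by (auto simp: coeff_eq_0)
    have "hact \<alpha> r = 0"
      using u p(1) qr(1) by (simp add: annihilator_eq hact_add hact_ore_mult hact_zero_left)
    then have "r = 0"
      using min qr(2) by (simp add: annihilator_eq)
    then show "u \<in> right_ideal \<delta> p"
      using qr(1) by (simp add: right_ideal_def)
  qed
  have "P_alpha \<delta> \<alpha> = p"
    unfolding P_alpha_def
  proof (rule the_equality)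
    fix q assume q: "Polynomial.lead_coeff q = 1 \<and> right_ideal \<delta> q = ?I"
    have "q \<otimes>\<^bsub>ore \<delta>\<^esub> 1 \<in> right_ideal \<delta> q"
      unfolding right_ideal_def by (rule rangeI)
    then have qI: "q \<in> ?I"
      using q by (simp add: ore_mult_one_right)
    obtain v where v: "p = q \<otimes>\<^bsub>ore \<delta>\<^esub> v"
      using p(1) q unfolding right_ideal_def by auto
    have "v \<noteq> 0"
      using v p(2) by auto
    then have "Polynomial.degree q \<le> Polynomial.degree p"
      using degree_ore_mult(2)[of q v] q unfolding v by simp
    \<comment> \<open>\<open>q\<close> is nonzero and \<open>p\<close> has least degree\<close>
    moreover have "\<not> Polynomial.degree q < Polynomial.degree p"
      using w(3)[OF qI] q unfolding deg by auto
    ultimately have eq: "Polynomial.degree q = Polynomial.degree p" by simp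
    have "q - p = 0"
    proof (rule min)
      show "q - p \<in> ?I"
        using qI p(1) by (simp add: annihilator_eq hact_diff)
      show "\<forall>i\<ge>Polynomial.degree p. Polynomial.coeff (q - p) i = 0"
      proof (intro allI impI)
        fix i assume "Polynomial.degree p \<le> i"
        then show "Polynomial.coeff (q - p) i = 0"
          using q p(2) eq by (cases "i = Polynomial.degree p") (simp_all add: coeff_eq_0)
      qed
    qed
    then show "q = p" by simp
  qed (use p ideal in simp)
  then show ?thesis using ideal by simp
qed

lemma hsub_range_hact:
  assumes "\<alpha> \<in> Dlin \<delta>"
  shows "hsub (range (hact \<alpha>))"
proof -
  obtain B where B: "finite B" "hsub (H.span B)" "\<alpha> \<in> H.span B" "B \<subseteq> range (\<lambda>i. (shift ^^ i) \<alpha>)"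
    using Dlin_shift_pow[OF assms] .
  interpret V: diff_module \<delta> "hspace (H.span B)" by (rule diff_spaceD[OF B(2)])
  have pow: "(shift ^^ i) \<alpha> \<in> H.span B" for i
    using V.der_pow_closed[of \<alpha> i] B(3) unfolding der_hspace hspace_simps .
  have "hact \<alpha> u \<in> H.span B" for u
    unfolding hact_def by (intro H.span_sum H.span_scale pow)
  moreover have "H.subspace (range (hact \<alpha>))"
    unfolding H.subspace_def
  proof (intro conjI ballI allI)
    show "0 \<in> range (hact \<alpha>)"
      by (rule range_eqI[of _ _ 0]) (rule hact_0[symmetric])
    fix \<beta> assume "\<beta> \<in> range (hact \<alpha>)"
    then obtain u where u: "\<beta> = hact \<alpha> u" by (rule rangeE)
    show "t x \<star> \<beta> \<in> range (hact \<alpha>)" for x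
      unfolding u hact_smult[symmetric] by (rule rangeI)
    fix \<gamma> assume "\<gamma> \<in> range (hact \<alpha>)"
    then obtain v where v: "\<gamma> = hact \<alpha> v" by (rule rangeE)
    show "\<beta> + \<gamma> \<in> range (hact \<alpha>)"
      unfolding u v hact_add[symmetric] by (rule rangeI)
  qed
  moreover have "B \<subseteq> range (hact \<alpha>)"
    using B(4) unfolding hact_Ypow[symmetric] by blast
  ultimately have "range (hact \<alpha>) = H.span B"
    using H.span_minimal by blast
  then show ?thesis using B(2) by simp
qed


section \<open>The cyclic module of a differentially recursive sequence\<close>

context
  fixes \<alpha> :: "nat \<Rightarrow> 'k"
  assumes \<alpha>: "\<alpha> \<in> Dlin \<delta>"
begin

abbreviation coset :: "'k poly \<Rightarrow> 'k poly set" where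
  "coset u \<equiv> annihilator \<delta> \<alpha> +>\<^bsub>ore \<delta>\<^esub> u"

text \<open>Cosets of the annihilator are the fibres of \<open>u \<mapsto> \<alpha> \<triangleleft> u\<close>, so a map on
  polynomials descends to \<open>M\<^sub>\<alpha>\<close> as soon as it depends only on \<open>\<alpha> \<triangleleft>
  u\<close>.\<close>

lemma coset_eq: "coset u = {w. hact \<alpha> w = hact \<alpha> u}"
proof (intro equalityI subsetI)
  fix w assume "w \<in> coset u"
  then show "w \<in> {w. hact \<alpha> w = hact \<alpha> u}"
    by (auto simp: a_r_coset_def r_coset_def annihilator_eq hact_add)
next
  fix w assume "w \<in> {w. hact \<alpha> w = hact \<alpha> u}"
  then have "hact \<alpha> (w - u) = 0" "w = (w - u) + u"
    by (simp_all add: hact_diff)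
  then show "w \<in> coset u"
    by (auto simp: a_r_coset_def r_coset_def annihilator_eq)
qed

lemma coset_eq_iff: "coset u = coset v \<longleftrightarrow> hact \<alpha> u = hact \<alpha> v"
  by (auto simp: coset_eq)

lemma induced_coset:
  assumes "\<And>w. hact \<alpha> w = hact \<alpha> u \<Longrightarrow> h w = h u"
  shows "induced h (coset u) = h u"
proof -
  have "h ` coset u = {h u}"
  proof (intro equalityI subsetI)
    fix y assume "y \<in> h ` coset u"
    then obtain w where w: "y = h w" "w \<in> coset u" by (rule imageE)
    have "h w = h u"
      by (rule assms) (use w(2) in \<open>simp add: coset_eq\<close>)
    then show "y \<in> {h u}" by (simp add: w(1))
  next
    fix y assume "y \<in> {h u}"
    then have "y = h u" by simp
    then show "y \<in> h ` coset u"
      by (rule image_eqI) (simp add: coset_eq)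
  qed
  then show ?thesis by (simp add: induced_def)
qed

lemma coset_add: "coset u <+>\<^bsub>ore \<delta>\<^esub> coset v = coset (u + v)"
proof (intro equalityI subsetI)
  fix w assume "w \<in> coset u <+>\<^bsub>ore \<delta>\<^esub> coset v"
  then show "w \<in> coset (u + v)"
    by (auto simp: set_add_def set_mult_def coset_eq hact_add)
next
  fix w assume "w \<in> coset (u + v)"
  then have "hact \<alpha> (w - u) = hact \<alpha> v" "w = u + (w - u)"
    by (simp_all add: coset_eq hact_add hact_diff)
  then show "w \<in> coset u <+>\<^bsub>ore \<delta>\<^esub> coset v"
    unfolding set_add_def set_mult_def coset_eq
    by (intro UN_I[of u] UN_I[of "w - u"]) simp_all
qed

lemma M_alpha_simps:
  "carrier (M_alpha \<delta> \<alpha>) = range coset" "\<zero>\<^bsub>M_alpha \<delta> \<alpha>\<^esub> = coset 0"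
  "coset u \<oplus>\<^bsub>M_alpha \<delta> \<alpha>\<^esub> coset v = coset (u + v)"
  "x \<odot>\<^bsub>M_alpha \<delta> \<alpha>\<^esub> coset u = coset (Polynomial.smult x u)"
  "der (M_alpha \<delta> \<alpha>) (coset u) = coset (times_Y \<delta> u)"
  "one_alpha \<delta> \<alpha> = coset 1"
proof -
  have "annihilator \<delta> \<alpha> = coset 0"
    by (simp add: coset_eq) (simp add: annihilator_eq)
  then show "\<zero>\<^bsub>M_alpha \<delta> \<alpha>\<^esub> = coset 0"
    by (simp add: M_alpha_def Let_def P_alpha[OF \<alpha>])
  show "carrier (M_alpha \<delta> \<alpha>) = range coset"
    by (auto simp: M_alpha_def Let_def P_alpha[OF \<alpha>] A_RCOSETS_def RCOSETS_def a_r_coset_def)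
  show "x \<odot>\<^bsub>M_alpha \<delta> \<alpha>\<^esub> coset u = coset (Polynomial.smult x u)"
    unfolding M_alpha_def Let_def P_alpha[OF \<alpha>] module.simps ore_mult_scal
    by (rule induced_coset) (simp only: coset_eq_iff hact_smult)
  have "w \<otimes>\<^bsub>ore \<delta>\<^esub> Ypow 1 = times_Y \<delta> w" for w
    by (simp add: ore_mult_Ypow)
  then show "der (M_alpha \<delta> \<alpha>) (coset u) = coset (times_Y \<delta> u)"
    unfolding M_alpha_def Let_def P_alpha[OF \<alpha>] dspace.simps
    by (simp only:) (rule induced_coset, simp only: coset_eq_iff hact_times_Y)
qed (simp_all add: M_alpha_def one_alpha_def Let_def P_alpha[OF \<alpha>] coset_add)

lemma f_alpha_eq: "f_alpha \<delta> \<alpha> = lin_ext \<alpha>"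
  unfolding f_alpha_def
  by (rule inv_into_f_eq[OF ustar.inj]) (simp_all add: ustar_simps lin_ext_Udual)

lemma induced_hact: "induced (hact \<alpha>) (coset u) = hact \<alpha> u"
  by (rule induced_coset)

text \<open>The quotient of \<open>U\<close> by the annihilator of \<open>\<alpha>\<close> is the cyclic submodule
  \<open>\<alpha> \<triangleleft> U\<close> of the Hurwitz series.\<close>

lemma M_alpha_iso:
  "diff_space \<delta> (M_alpha \<delta> \<alpha>)"
  "induced (hact \<alpha>) \<in> dspace_isos (M_alpha \<delta> \<alpha>) (hspace (range (hact \<alpha>)))"
proof -
  let ?h = "induced (hact \<alpha>)" and ?M = "M_alpha \<delta> \<alpha>"
  note h = induced_hact
  have bij: "bij_betw ?h (carrier ?M) (carrier (hspace (range (hact \<alpha>))))"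
    unfolding bij_betw_def M_alpha_simps hspace_simps
  proof
    show "inj_on ?h (range coset)"
      by (rule inj_onI) (elim rangeE, simp only: h coset_eq_iff)
    show "?h ` range coset = range (hact \<alpha>)"
      by (simp only: image_image h)
  qed
  have *: "\<zero>\<^bsub>?M\<^esub> \<in> carrier ?M" "?h \<zero>\<^bsub>?M\<^esub> = \<zero>\<^bsub>hspace (range (hact \<alpha>))\<^esub>"
    "Z \<in> carrier ?M \<Longrightarrow> W \<in> carrier ?M \<Longrightarrow> Z \<oplus>\<^bsub>?M\<^esub> W \<in> carrier ?M"
    "Z \<in> carrier ?M \<Longrightarrow> W \<in> carrier ?M \<Longrightarrow>
      ?h (Z \<oplus>\<^bsub>?M\<^esub> W) = ?h Z \<oplus>\<^bsub>hspace (range (hact \<alpha>))\<^esub> ?h W"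
    "Z \<in> carrier ?M \<Longrightarrow> x \<odot>\<^bsub>?M\<^esub> Z \<in> carrier ?M"
    "Z \<in> carrier ?M \<Longrightarrow> ?h (x \<odot>\<^bsub>?M\<^esub> Z) = x \<odot>\<^bsub>hspace (range (hact \<alpha>))\<^esub> ?h Z"
    "Z \<in> carrier ?M \<Longrightarrow> der ?M Z \<in> carrier ?M"
    "Z \<in> carrier ?M \<Longrightarrow> ?h (der ?M Z) = der (hspace (range (hact \<alpha>))) (?h Z)" for Z W x
    unfolding M_alpha_simps(1,2) hspace_simps
    by (auto simp only: M_alpha_simps h hact_add hact_smult hact_times_Y hact_0)
  show "diff_space \<delta> ?M"
    by (rule diff_space_transport(1)[OF hsub_range_hact[OF \<alpha>] bij *])
  show "?h \<in> dspace_isos ?M (hspace (range (hact \<alpha>)))"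
    by (rule diff_space_transport(2)[OF hsub_range_hact[OF \<alpha>] bij *])
qed

lemma f_tilde:
  "f_tilde \<delta> \<alpha> = compose (carrier (M_alpha \<delta> \<alpha>)) (eval0 (range (hact \<alpha>))) (induced (hact \<alpha>))"
proof -
  have "induced (f_alpha \<delta> \<alpha>) (coset u) = eval0 (range (hact \<alpha>)) (hact \<alpha> u)" for u
  proof -
    have "induced (f_alpha \<delta> \<alpha>) (coset u) = f_alpha \<delta> \<alpha> u"
      by (rule induced_coset) (simp add: f_alpha_eq flip: hact_at_0)
    then show ?thesis
      by (simp add: f_alpha_eq eval0_def flip: hact_at_0)
  qed
  then show ?thesis
    by (auto simp: f_tilde_def compose_def restrict_def fun_eq_iff M_alpha_simps(1) induced_hact)
qed

lemma dlin_map_M_alpha: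
  "tclass \<delta> (M_alpha \<delta> \<alpha>) (f_tilde \<delta> \<alpha>) (one_alpha \<delta> \<alpha>) \<in> carrier (ucirc \<delta>)"
  "dlin_map (tclass \<delta> (M_alpha \<delta> \<alpha>) (f_tilde \<delta> \<alpha>) (one_alpha \<delta> \<alpha>)) = \<alpha>"
proof -
  let ?V = "range (hact \<alpha>)"
  have hom: "induced (hact \<alpha>) \<in> dspace_homs (M_alpha \<delta> \<alpha>) (hspace ?V)"
    using M_alpha_iso(2) by (simp add: dspace_isos_def)
  note V = hsub_range_hact[OF \<alpha>] and M = diff_spaceD[OF M_alpha_iso(1)]
  have one: "one_alpha \<delta> \<alpha> \<in> carrier (M_alpha \<delta> \<alpha>)" "induced (hact \<alpha>) (one_alpha \<delta> \<alpha>) = \<alpha>"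
    by (simp_all add: M_alpha_simps induced_hact hact_1)
  have dual: "f_tilde \<delta> \<alpha> \<in> dual (M_alpha \<delta> \<alpha>)"
    unfolding f_tilde by (rule dual_comp[OF M hom eval0_dual[OF V]])
  have "\<alpha> \<in> ?V"
    by (rule range_eqI[of _ _ 1]) (rule hact_1[symmetric])
  then have "orbit (M_alpha \<delta> \<alpha>) (f_tilde \<delta> \<alpha>) (one_alpha \<delta> \<alpha>) = \<alpha>"
    unfolding f_tilde orbit_hom[OF M hom one(1)] one(2) by (rule orbit_eval0[OF V])
  then show "tclass \<delta> (M_alpha \<delta> \<alpha>) (f_tilde \<delta> \<alpha>) (one_alpha \<delta> \<alpha>) \<in> carrier (ucirc \<delta>)"
    "dlin_map (tclass \<delta> (M_alpha \<delta> \<alpha>) (f_tilde \<delta> \<alpha>) (one_alpha \<delta> \<alpha>)) = \<alpha>"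
    using tclass_ucirc(1,2)[OF M_alpha_iso(1) dual one(1)] by simp_all
qed

end

end

theorem theorem2p21:
  fixes \<delta> :: "'k::field \<Rightarrow> 'k"
  assumes "differential_field \<delta>"
  shows
    "kk_algebra_iso \<delta>
       (ustar \<delta>) (source_target (ustar \<delta>) s_ustar (t_ustar \<delta>))
       hurwitz (source_target hurwitz s_hur (t_hur \<delta>)) Phi
   \<and> kk_algebra_hom \<delta>
       (ucirc \<delta>) (source_target (ucirc \<delta>) (s_circ \<delta>) (t_circ \<delta>))
       (ustar \<delta>) (source_target (ustar \<delta>) s_ustar (t_ustar \<delta>)) zeta
   \<and> (\<forall>(M :: ('k, 'm) dspace) \<phi> m.
        diff_space \<delta> M \<longrightarrow> \<phi> \<in> dual M \<longrightarrow> m \<in> carrier M \<longrightarrow>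
        tclass \<delta> M \<phi> m \<in> carrier (ucirc \<delta>) \<and> zeta (tclass \<delta> M \<phi> m) = (\<lambda>u. \<phi> (act M m u)))
   \<and> (\<exists>F.
        kk_algebra_iso \<delta>
          (ucirc \<delta>) (source_target (ucirc \<delta>) (s_circ \<delta>) (t_circ \<delta>))
          (dlin_ring \<delta>) (source_target (dlin_ring \<delta>) s_hur (t_hur \<delta>)) F
      \<and> (\<forall>Z\<in>carrier (ucirc \<delta>). Phi (zeta Z) = F Z)
      \<and> (\<forall>(M :: ('k, 'm) dspace) \<phi> m.
           diff_space \<delta> M \<longrightarrow> \<phi> \<in> dual M \<longrightarrow> m \<in> carrier M \<longrightarrow>
           F (tclass \<delta> M \<phi> m) = (\<lambda>n. \<phi> ((der M ^^ n) m)))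
      \<and> (\<forall>\<alpha>\<in>Dlin \<delta>. inv_into (carrier (ucirc \<delta>)) F \<alpha> =
           tclass \<delta> (M_alpha \<delta> \<alpha>) (f_tilde \<delta> \<alpha>) (one_alpha \<delta> \<alpha>))
      \<and> differential_algebra_iso
          (ucirc \<delta>) (s_circ \<delta>) (der_circ \<delta>) (dlin_ring \<delta>) s_hur shift F)"
proof -
  interpret diff_field \<delta>
    by unfold_locales (rule assms)
  have formula: "dlin_map (tclass \<delta> M \<phi> m) = (\<lambda>n. \<phi> ((der M ^^ n) m))"
    if "diff_space \<delta> M" "\<phi> \<in> dual M" "m \<in> carrier M" for M :: "('k, 'm) dspace" and \<phi> m
    using tclass_ucirc(2)[OF that] by (simp add: orbit_def)
  have inverse: "inv_into (carrier (ucirc \<delta>)) dlin_map \<alpha> =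
      tclass \<delta> (M_alpha \<delta> \<alpha>) (f_tilde \<delta> \<alpha>) (one_alpha \<delta> \<alpha>)" if "\<alpha> \<in> Dlin \<delta>" for \<alpha>
    by (rule inv_into_f_eq[OF inj_dlin_map dlin_map_M_alpha[OF that]])
  show ?thesis
    by (intro conjI exI[of _ dlin_map] allI impI ballI kk_algebra_iso_Phi kk_algebra_hom_zeta
        tclass_ucirc kk_algebra_iso_dlin_map formula inverse differential_algebra_iso_dlin_map)
      (simp_all add: dlin_map_def)
qed

end
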